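(* Let $k$ be an integer. There exists a cuspidal Hecke eigenform $f$ of weight $k$ for $\operatorname{SL}_2(\mathbb{Z})$ such that $L(f,k/2)\neq 0$ if and only if $k\geq 12$ and $4$ divides $k$.
   Context: Let $\Gamma(1)=\operatorname{SL}_2(\mathbb{Z})$, and let $\mathcal{S}_k(\Gamma(1))$ be the complex vector space of cusp forms of weight $k$ for $\Gamma(1)$ (level one, trivial character). A cuspidal Hecke eigenform of weight $k$ is a nonzero element $f\in\mathcal{S}_k(\Gamma(1))$ that is an eigenvector of all Hecke operators $T_n$, $n\geq 1$. For $f\in\mathcal{S}_k(\Gamma(1))$ with Fourier expansion $f(\tau)=\sum_{n\geq 1}a_n e^{2\pi i n\tau}$ on the upper half-plane, the Hecke $L$-function of $f$ is $L(f,s)=\sum_{n\geq 1}a_n n^{-s}$ for $\operatorname{Re}(s)>k/2+1$. It extends to an entire function of $s\in\mathbb{C}$, and $L(f,k/2)$ denotes the value of this holomorphic continuation at $s=k/2$. *)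

theory Defs
  imports "HOL-Complex_Analysis.Complex_Analysis"
begin

definition upper_half_plane :: "complex set" where
  "upper_half_plane = {\<tau>. Im \<tau> > 0}"

definition q_expansion :: "(complex \<Rightarrow> complex) \<Rightarrow> (nat \<Rightarrow> complex) \<Rightarrow> bool" where
  "q_expansion f a \<longleftrightarrow>
     (\<forall>\<tau>\<in>upper_half_plane. (\<lambda>n. a n * exp (2 * of_real pi * \<i> * of_nat n * \<tau>)) sums f \<tau>)"

(* Uniquely determined whenever f has such an expansion (coefficients of a power series in
   q = exp (2 pi i tau) converging on the unit disc). *)
definition fourier_coeff :: "(complex \<Rightarrow> complex) \<Rightarrow> nat \<Rightarrow> complex" where
  "fourier_coeff f = (THE a. q_expansion f a)"

(* A function on the upper half-plane is represented by its extension by 0 to all of the complex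
   plane, so that equality of forms is equality in HOL. The existence of an expansion without
   negative powers of q is holomorphy at the cusp, and a 0 = 0 is cuspidality. *)
definition cusp_forms :: "int \<Rightarrow> (complex \<Rightarrow> complex) set" where
  "cusp_forms k = {f.
     f holomorphic_on upper_half_plane \<and>
     (\<forall>\<tau>. \<tau> \<notin> upper_half_plane \<longrightarrow> f \<tau> = 0) \<and>
     (\<forall>a b c d :: int. a * d - b * c = 1 \<longrightarrow>
        (\<forall>\<tau>\<in>upper_half_plane.
           f ((of_int a * \<tau> + of_int b) / (of_int c * \<tau> + of_int d)) =
           (of_int c * \<tau> + of_int d) powi k * f \<tau>)) \<and>
     (\<exists>a. q_expansion f a \<and> a 0 = 0)}"

(* The matrices (n/d, b; 0, d) with d dividing n and 0 <= b < d represent the integral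
   matrices of determinant n modulo left multiplication by SL_2(Z). *)
definition hecke_operator ::
    "int \<Rightarrow> nat \<Rightarrow> (complex \<Rightarrow> complex) \<Rightarrow> complex \<Rightarrow> complex" where
  "hecke_operator k n f \<tau> =
     (if \<tau> \<in> upper_half_plane then
        of_nat n powi (k - 1) *
        (\<Sum>d | d dvd n. \<Sum>b<d.
           of_nat d powi (- k) * f ((of_nat (n div d) * \<tau> + of_nat b) / of_nat d))
      else 0)"

definition cuspidal_hecke_eigenform :: "int \<Rightarrow> (complex \<Rightarrow> complex) \<Rightarrow> bool" where
  "cuspidal_hecke_eigenform k f \<longleftrightarrow>
     f \<in> cusp_forms k \<and> f \<noteq> (\<lambda>\<tau>. 0) \<and>
     (\<forall>n\<ge>1. \<exists>c. hecke_operator k n f = (\<lambda>\<tau>. c * f \<tau>))"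

(* The holomorphic continuation of the Dirichlet series: by the identity theorem at most one
   entire function satisfies the condition, and by Hecke one exists for every cusp form. *)
definition hecke_L :: "int \<Rightarrow> (complex \<Rightarrow> complex) \<Rightarrow> complex \<Rightarrow> complex" where
  "hecke_L k f =
     (THE L. L holomorphic_on UNIV \<and>
        (\<forall>s. Re s > of_int k / 2 + 1 \<longrightarrow>
           (\<lambda>n. fourier_coeff f (Suc n) * of_nat (Suc n) powr (- s)) sums L s))"

end

theory Submission
  imports Defs "HOL-Real_Asymp.Real_Asymp" "HOL-Computational_Algebra.Fundamental_Theorem_Algebra"
begin

text \<open>
  If \<open>f\<close> is a cusp form of weight \<open>k\<close>, then \<open>|f|\<^sup>2 y\<^sup>k\<close> is invariant under SL(2,Z) and attains its maximum at a point
  with \<open>y\<^sup>2 \<ge> 3/4\<close>; the maximum principle for \<open>f / q\<^sup>m\<close> as a function of \<open>q\<close> then shows that \<open>f\<close> vanishes when its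
  first \<open>m\<close> Fourier coefficients do (the constant one included) and \<open>k \<le> 10 m\<close>. The case \<open>m = 1\<close> excludes
  \<open>k \<le> 10\<close>, and forms of odd weight vanish because of the matrix \<open>-1\<close>. The integral
  \<open>\<integral>f(iy) y\<^bsup>s-1\<^esup> dy\<close>, taken over \<open>y \<ge> 1\<close> after use of \<open>f(i/y) = (iy)\<^sup>k f(iy)\<close>, continues the L-function, and
  its value at \<open>k/2\<close> has the factor \<open>1 + i\<^sup>k\<close>, which vanishes for \<open>k \<equiv> 2\<close> modulo 4.

  If \<open>k = 12 + 4 j\<close>, let \<open>E\<^sub>1, E\<^sub>2, E\<^sub>3\<close> be the Eisenstein series of weight 4 and level 2. The cusp form
  \<open>- E\<^sub>1 E\<^sub>2 E\<^sub>3 (E\<^sub>1 + E\<^sub>2 + E\<^sub>3)\<^sup>j\<close> is positive on the imaginary axis by the Lipschitz formula, so its central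
  value is positive.

  The Hecke operators at primes commute and are self-adjoint for the Petersson product. The latter is written as an
  integral over pairs \<open>(\<omega>\<^sub>1, \<omega>\<^sub>2)\<close> of complex numbers whose lattice has covolume between 1 and 2, with a weight
  whose SL(2,Z)-translates sum to 1. Unfolding turns \<open>\<langle>T\<^sub>p f, g\<rangle>\<close> into a sum over all integral matrices of
  determinant \<open>p\<close>, on which \<open>M \<mapsto> adj M\<close> interchanges \<open>f\<close> and \<open>g\<close>. Hence every form in a Hecke-stable subspace
  is a sum of eigenvectors of \<open>T\<^sub>p\<close> in that subspace, so on a Hecke-stable subspace of minimal dimension not
  contained in the kernel of \<open>f \<mapsto> L(f, k/2)\<close> each \<open>T\<^sub>p\<close> is a scalar, and any element outside the kernel is an
  eigenform.
\<close>

subsection \<open>Lattice bases and reduction\<close>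

text \<open>A nonzero form vanishing to order \<open>m\<close> at the cusp, with maximum at height
  \<open>y0\<close>, satisfies \<open>4 * pi * m * y0 \<le> k\<close>, and
  \<open>y0^2 \<ge> 3/4\<close> makes \<open>4 * pi * y0\<close> exceed 10.8. The integer 10 leaves
  room for a crude estimate and still excludes every weight below 11. Pairs of complex numbers
  replace the half-plane for two reasons: SL(2,R) preserves Lebesgue measure on them by shears
  alone, and Hecke operators become plain sums of translates, without automorphy factors. The price
  is an additional integration over scale and phase. The functional fed to the minimal subspace is
  \<open>half_mellin\<close> at \<open>k / 2\<close>, which is visibly linear in the form; the
  central value is a nonzero multiple of it when 4 divides \<open>k\<close>. The sum of the three
  Eisenstein series is 15/16 of the level one series G_4, and their product is a multiple of the
  discriminant Delta. The chosen form is thus a positive multiple of Delta E_4^j; writing it through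
  level 2 reduces its sign on the axis to signs of single rows of lattice sums, and its modularity
  to a permutation of three vectors.\<close>

type_synonym mat2 = "int \<times> int \<times> int \<times> int"

fun act :: "mat2 \<Rightarrow> complex \<times> complex \<Rightarrow> complex \<times> complex" where
  "act (a, b, c, d) (u, v) = (of_int a * u + of_int b * v, of_int c * u + of_int d * v)"

fun mat_mult :: "mat2 \<Rightarrow> mat2 \<Rightarrow> mat2" where
  "mat_mult (a, b, c, d) (a', b', c', d') =
     (a * a' + b * c', a * b' + b * d', c * a' + d * c', c * b' + d * d')"

fun mat_det :: "mat2 \<Rightarrow> int" where
  "mat_det (a, b, c, d) = a * d - b * c"

fun mat_adj :: "mat2 \<Rightarrow> mat2" where
  "mat_adj (a, b, c, d) = (d, - b, - c, a)"

text \<open>A pair \<open>(\<omega>\<^sub>1, \<omega>\<^sub>2)\<close> of complex numbers is read as a lattice basis: \<open>area\<close> is its oriented covolume and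
  \<open>lift k f\<close> the function of degree \<open>- k\<close> on lattices that \<open>f\<close> represents.\<close>

definition area :: "complex \<times> complex \<Rightarrow> real" where
  "area w = Im (fst w * cnj (snd w))"

definition lift :: "int \<Rightarrow> (complex \<Rightarrow> complex) \<Rightarrow> complex \<times> complex \<Rightarrow> complex" where
  "lift k f w = snd w powi (- k) * f (fst w / snd w)"

lemma act_mat_mult: "act (mat_mult M N) w = act M (act N w)"
  by (cases M; cases N; cases w) (auto simp: algebra_simps)

lemma mat_mult_assoc: "mat_mult (mat_mult L M) N = mat_mult L (mat_mult M N)"
  by (cases L; cases M; cases N) (auto simp: algebra_simps)

lemma mat_det_mult: "mat_det (mat_mult M N) = mat_det M * mat_det N"
  by (cases M; cases N) (auto simp: algebra_simps)

lemma mat_det_adj [simp]: "mat_det (mat_adj M) = mat_det M"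
  by (cases M) (auto simp: algebra_simps)

lemma mat_adj_adj [simp]: "mat_adj (mat_adj M) = M"
  by (cases M) auto

lemma mat_mult_one [simp]: "mat_mult (1, 0, 0, 1) M = M" "mat_mult M (1, 0, 0, 1) = M"
  by (cases M, simp)+

lemma mat_mult_adj: "mat_mult (mat_adj M) M = (mat_det M, 0, 0, mat_det M)"
  "mat_mult M (mat_adj M) = (mat_det M, 0, 0, mat_det M)"
  by (cases M, simp add: algebra_simps)+

lemma area_act: "area (act M w) = of_int (mat_det M) * area w"
  by (cases M; cases w) (auto simp: area_def algebra_simps)

lemma area_pos_nonzero:
  assumes "area w > 0"
  shows "fst w \<noteq> 0" "snd w \<noteq> 0"
  using assms by (auto simp: area_def)

lemma Im_quotient: "Im (fst w / snd w) = area w / (cmod (snd w))\<^sup>2"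
  by (simp add: area_def Im_divide cmod_def power2_eq_square algebra_simps)

lemma quotient_in_upper: "area w > 0 \<Longrightarrow> fst w / snd w \<in> upper_half_plane"
  using area_pos_nonzero[of w] by (simp add: upper_half_plane_def Im_quotient)

text \<open>The automorphy factor cancels against the change of the second basis vector, so that
  modularity of weight \<open>k\<close> becomes plain invariance.\<close>

lemma lift_act:
  assumes f: "f \<in> cusp_forms k" and g: "mat_det g = 1" and w: "area w > 0"
  shows "lift k f (act g w) = lift k f w"
proof -
  obtain a b c d where gg: "g = (a, b, c, d)" by (cases g)
  obtain u v where ww: "w = (u, v)" by (cases w)
  have v: "v \<noteq> 0" using area_pos_nonzero[OF w] ww by simp
  have "area (act g w) > 0" using w g by (simp add: area_act)
  hence nz: "of_int c * u + of_int d * v \<noteq> 0" using area_pos_nonzero(2) gg ww by fastforce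
  define t where "t = u / v"
  have t: "t \<in> upper_half_plane" using quotient_in_upper[OF w] ww by (simp add: t_def)
  have u: "u = t * v" using v by (simp add: t_def)
  have nz': "of_int c * t + of_int d \<noteq> (0::complex)"
  proof
    assume "of_int c * t + of_int d = (0::complex)"
    hence "(of_int c * t + of_int d) * v = 0" by simp
    thus False using nz by (simp add: u algebra_simps)
  qed
  have e1: "of_int a * u + of_int b * v = (of_int a * t + of_int b) * v"
    "of_int c * u + of_int d * v = (of_int c * t + of_int d) * v"
    by (simp_all add: u algebra_simps)
  have fm: "f ((of_int a * t + of_int b) / (of_int c * t + of_int d)) =
           (of_int c * t + of_int d) powi k * f t"
    using f g t by (auto simp: cusp_forms_def gg)
  have "lift k f (act g w) = ((of_int c * t + of_int d) * v) powi (-k) *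
     f ((of_int a * t + of_int b) / (of_int c * t + of_int d))"
    using v by (simp add: lift_def gg ww e1)
  also have "\<dots> = v powi (-k) * f t"
    unfolding fm power_int_mult_distrib using nz' v by (simp add: power_int_minus)
  finally show ?thesis by (simp add: lift_def ww t_def)
qed

section \<open>The invariant norm and reduced bases\<close>

definition inv_norm :: "int \<Rightarrow> (complex \<Rightarrow> complex) \<Rightarrow> complex \<Rightarrow> real" where
  "inv_norm k f t = (cmod (f t))\<^sup>2 * Im t powi k"

text \<open>The right-hand side depends on the lattice alone, because \<open>lift\<close> and
  \<open>area\<close> are both invariant under SL(2,Z); this is how the invariance of
  \<open>inv_norm\<close> is obtained.\<close>

lemma inv_norm_lift:
  assumes w: "area w > 0"
  shows "inv_norm k f (fst w / snd w) = (cmod (lift k f w))\<^sup>2 * area w powi k"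
proof -
  have v: "snd w \<noteq> 0" using area_pos_nonzero[OF w] by simp
  have "((cmod (snd w))\<^sup>2) powi k * ((cmod (snd w)) powi (-k))\<^sup>2 = 1"
    using v by (simp add: power_int_minus field_simps flip: power_int_power' power_int_mult)
      (simp add: power_int_power power2_eq_square mult.commute flip: power_int_mult_distrib)
  thus ?thesis using v
    by (simp add: inv_norm_def lift_def Im_quotient norm_mult norm_power_int power_int_divide_distrib
        power_mult_distrib field_simps)
qed

text \<open>For \<open>z = m u + n v\<close> the imaginary parts of \<open>z * cnj v\<close> and
  \<open>z * cnj u\<close> are \<open>m\<close> and \<open>- n\<close> times the area; bounding them
  by the absolute values and adding the squares gives the claim. It controls both the lattice points
  in a disc and the convergence of the Eisenstein series.\<close>

lemma quadratic_form_bound: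
  fixes m n :: real
  shows "(area (u, v))\<^sup>2 * (m\<^sup>2 + n\<^sup>2) \<le> (cmod (of_real m * u + of_real n * v))\<^sup>2 * ((cmod u)\<^sup>2 + (cmod v)\<^sup>2)"
proof -
  define z where "z = of_real m * u + of_real n * v"
  have 1: "Im (z * cnj v) = m * area (u, v)"
    by (simp add: z_def area_def algebra_simps)
  have 2: "Im (z * cnj u) = - n * area (u, v)"
    by (simp add: z_def area_def algebra_simps)
  have "(Im (z * cnj v))\<^sup>2 \<le> (cmod (z * cnj v))\<^sup>2"
    using abs_Im_le_cmod[of "z * cnj v"] by (metis abs_ge_zero power2_abs power_mono)
  moreover have "(Im (z * cnj u))\<^sup>2 \<le> (cmod (z * cnj u))\<^sup>2"
    using abs_Im_le_cmod[of "z * cnj u"] by (metis abs_ge_zero power2_abs power_mono)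
  ultimately show ?thesis unfolding 1 2 z_def[symmetric]
    by (simp add: norm_mult power_mult_distrib algebra_simps)
qed

lemma quadratic_form_bound_int:
  fixes m n :: int
  shows "(area (u, v))\<^sup>2 * of_int (m\<^sup>2 + n\<^sup>2) \<le> (cmod (of_int m * u + of_int n * v))\<^sup>2 * ((cmod u)\<^sup>2 + (cmod v)\<^sup>2)"
  using quadratic_form_bound[of u v "of_int m" "of_int n"] by simp

text \<open>For \<open>t = fst w / snd w\<close> this says \<open>Im t > 0\<close>,
  \<open>\<bar>Re t\<bar> \<le> 1 / 2\<close> and \<open>cmod t \<ge> 1\<close>: the closed standard
  fundamental domain, expressed without division.\<close>

definition reduced_pair :: "complex \<times> complex \<Rightarrow> bool" where
  "reduced_pair w \<longleftrightarrow> area w > 0 \<and> 2 * \<bar>Re (fst w * cnj (snd w))\<bar> \<le> (cmod (snd w))\<^sup>2 \<and> cmod (snd w) \<le> cmod (fst w)"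

lemma norm_split: "(cmod u)\<^sup>2 * (cmod v)\<^sup>2 = (Re (u * cnj v))\<^sup>2 + (area (u, v))\<^sup>2"
  unfolding area_def fst_conv snd_conv cmod_power2[symmetric]
  by (simp add: norm_mult power_mult_distrib)

text \<open>Both follow from \<open>norm_split\<close>, in which the real part contributes at most a
  quarter of \<open>(cmod v)^4\<close>. The first is \<open>Im (u / v)^2 \<ge> 3 / 4\<close>; the
  second bounds the longer vector once the shorter one is known.\<close>

lemma reduced_bounds:
  assumes "reduced_pair (u, v)"
  shows "3 * ((cmod v)\<^sup>2)\<^sup>2 \<le> 4 * (area (u, v))\<^sup>2"
    and "4 * ((cmod u)\<^sup>2 * (cmod v)\<^sup>2) \<le> ((cmod v)\<^sup>2)\<^sup>2 + 4 * (area (u, v))\<^sup>2"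
proof -
  have r: "2 * \<bar>Re (u * cnj v)\<bar> \<le> (cmod v)\<^sup>2" "cmod v \<le> cmod u"
    using assms by (auto simp: reduced_pair_def)
  have "(2 * \<bar>Re (u * cnj v)\<bar>)\<^sup>2 \<le> ((cmod v)\<^sup>2)\<^sup>2"
    using r(1) by (intro power_mono) auto
  hence 1: "4 * (Re (u * cnj v))\<^sup>2 \<le> ((cmod v)\<^sup>2)\<^sup>2" by (simp add: power_mult_distrib)
  have "(cmod v)\<^sup>2 * (cmod v)\<^sup>2 \<le> (cmod u)\<^sup>2 * (cmod v)\<^sup>2"
    using r(2) by (intro mult_right_mono power_mono) auto
  hence 2: "((cmod v)\<^sup>2)\<^sup>2 \<le> (cmod u)\<^sup>2 * (cmod v)\<^sup>2" by (simp add: power2_eq_square)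
  show "3 * ((cmod v)\<^sup>2)\<^sup>2 \<le> 4 * (area (u, v))\<^sup>2"
    using 1 2 norm_split[of u v] by linarith
  show "4 * ((cmod u)\<^sup>2 * (cmod v)\<^sup>2) \<le> ((cmod v)\<^sup>2)\<^sup>2 + 4 * (area (u, v))\<^sup>2"
    using 1 norm_split[of u v] by linarith
qed

lemma reduced_snd_bound:
  assumes "reduced_pair (u, v)"
  shows "(cmod v)\<^sup>2 \<le> 2 * area (u, v)"
proof -
  have a: "area (u, v) > 0" using assms by (simp add: reduced_pair_def)
  define X where "X = (cmod v)\<^sup>2"
  have "(2 * area (u, v))\<^sup>2 = 4 * (area (u, v))\<^sup>2" by (simp add: power_mult_distrib)
  moreover have "3 * X\<^sup>2 \<le> 4 * (area (u, v))\<^sup>2" using reduced_bounds(1)[OF assms] unfolding X_def .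
  ultimately have "X\<^sup>2 \<le> (2 * area (u, v))\<^sup>2" using zero_le_power2[of X] by linarith
  hence "X \<le> 2 * area (u, v)" by (rule power2_le_imp_le) (use a in simp)
  thus ?thesis by (simp add: X_def)
qed

lemma finite_bounded_pairs:
  assumes "area (u, v) > 0"
  shows "finite {(m::int, n::int). (cmod (of_int m * u + of_int n * v))\<^sup>2 \<le> K}"
proof -
  define S where "S = (cmod u)\<^sup>2 + (cmod v)\<^sup>2"
  define A where "A = area (u, v)"
  have A: "A > 0" using assms by (simp add: A_def)
  have S0: "S \<ge> 0" by (simp add: S_def)
  define N where "N = \<lceil>\<bar>K\<bar> * S / A\<^sup>2\<rceil>"
  have sq: "\<bar>x\<bar> \<le> x\<^sup>2" for x :: int
    using self_le_power[of "\<bar>x\<bar>" 2] by (cases "x = 0") auto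
  have "{(m::int, n::int). (cmod (of_int m * u + of_int n * v))\<^sup>2 \<le> K} \<subseteq> {-N..N} \<times> {-N..N}"
  proof clarsimp
    fix m n :: int assume h: "(cmod (of_int m * u + of_int n * v))\<^sup>2 \<le> K"
    have "A\<^sup>2 * of_int (m\<^sup>2 + n\<^sup>2) \<le> (cmod (of_int m * u + of_int n * v))\<^sup>2 * S"
      using quadratic_form_bound_int[of u v m n] by (simp add: A_def S_def)
    also have "\<dots> \<le> \<bar>K\<bar> * S" using h S0 by (intro mult_right_mono) auto
    finally have "of_int (m\<^sup>2 + n\<^sup>2) \<le> \<bar>K\<bar> * S / A\<^sup>2" using A by (simp add: field_simps)
    hence "m\<^sup>2 + n\<^sup>2 \<le> N" unfolding N_def by (metis ceiling_mono ceiling_of_int)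
    moreover have "\<bar>m\<bar> \<le> m\<^sup>2" "\<bar>n\<bar> \<le> n\<^sup>2"
      using sq by blast+
    moreover have "m\<^sup>2 \<ge> 0" "n\<^sup>2 \<ge> 0" by auto
    ultimately show "- N \<le> m \<and> m \<le> N \<and> - N \<le> n \<and> n \<le> N" by linarith
  qed
  thus ?thesis by (rule finite_subset) auto
qed

text \<open>In a reduced basis of a fixed lattice the second vector has length bounded above in
  terms of the area and below by the shortest lattice vector. Hence the first is bounded too, and
  both rows of the matrix range over finite sets.\<close>

lemma finite_reducing:
  assumes "area w > 0"
  shows "finite {g. mat_det g = 1 \<and> reduced_pair (act g w)}"
proof -
  obtain u v where ww: "w = (u, v)" by (cases w)
  define S where "S = (cmod u)\<^sup>2 + (cmod v)\<^sup>2"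
  define A where "A = area (u, v)"
  have A: "A > 0" using assms by (simp add: A_def ww)
  have v0: "v \<noteq> 0" using area_pos_nonzero[OF assms] ww by simp
  have S0: "S > 0" using v0 by (simp add: S_def add_nonneg_pos)
  define e where "e = A\<^sup>2 / S"
  have e: "e > 0" using A S0 by (simp add: e_def)
  \<comment> \<open>A common bound for the squared lengths: the first two summands serve for
    \<open>u'\<close>, the last for \<open>v'\<close>.\<close>
  define K where "K = A / 2 + A\<^sup>2 / e + 2 * A"
  define P where "P = {(m::int, n::int). (cmod (of_int m * u + of_int n * v))\<^sup>2 \<le> K}"
  have fP: "finite P" unfolding P_def using assms ww by (intro finite_bounded_pairs) simp
  have "{g. mat_det g = 1 \<and> reduced_pair (act g w)} \<subseteq> (\<lambda>((a,b),(c,d)). (a,b,c,d)) ` (P \<times> P)"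
  proof clarify
    fix a b c d assume det: "mat_det (a, b, c, d) = 1" and red: "reduced_pair (act (a, b, c, d) w)"
    define u' v' where "u' = of_int a * u + of_int b * v" and "v' = of_int c * u + of_int d * v"
    have red': "reduced_pair (u', v')" using red by (simp add: ww u'_def v'_def)
    have A': "area (u', v') = A" using area_act[of "(a,b,c,d)" w] unfolding det
      by (simp add: ww u'_def v'_def A_def)
    have 1: "(cmod v')\<^sup>2 \<le> 2 * A" using reduced_snd_bound[OF red'] A' by simp
    have "c\<^sup>2 + d\<^sup>2 \<noteq> 0" using det by (auto simp: sum_power2_eq_zero_iff)
    moreover have "c\<^sup>2 + d\<^sup>2 \<ge> 0" by simp
    ultimately have "c\<^sup>2 + d\<^sup>2 \<ge> 1" by linarith
    hence "A\<^sup>2 * 1 \<le> A\<^sup>2 * of_int (c\<^sup>2 + d\<^sup>2)" by (intro mult_left_mono) (auto simp flip: of_int_power of_int_add)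
    also have "\<dots> \<le> (cmod v')\<^sup>2 * S"
      using quadratic_form_bound_int[of u v c d] by (simp add: A_def S_def v'_def)
    finally have 2: "e \<le> (cmod v')\<^sup>2" using S0 by (simp add: e_def field_simps)
    have aux: "p \<le> x / 4 + B / x" if "4 * (p * x) \<le> x\<^sup>2 + 4 * B" "x > 0" for p x B :: real
    proof -
      have "x / 4 + B / x - p = (x\<^sup>2 + 4 * B - 4 * (p * x)) / (4 * x)"
        using that(2) by (simp add: field_simps power2_eq_square)
      thus ?thesis using that divide_nonneg_pos[of "x\<^sup>2 + 4 * B - 4 * (p * x)" "4 * x"] by linarith
    qed
    have "4 * ((cmod u')\<^sup>2 * (cmod v')\<^sup>2) \<le> ((cmod v')\<^sup>2)\<^sup>2 + 4 * A\<^sup>2"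
      using reduced_bounds(2)[OF red'] A' by simp
    hence "(cmod u')\<^sup>2 \<le> (cmod v')\<^sup>2 / 4 + A\<^sup>2 / (cmod v')\<^sup>2"
      using 2 e by (intro aux) auto
    also have "(cmod v')\<^sup>2 / 4 + A\<^sup>2 / (cmod v')\<^sup>2 \<le> A / 2 + A\<^sup>2 / e"
      using 1 2 e by (intro add_mono divide_left_mono mult_pos_pos) auto
    finally have "(cmod u')\<^sup>2 \<le> K" using A by (simp add: K_def)
    moreover have "(cmod v')\<^sup>2 \<le> K" using 1 A zero_le_power2[of A] e divide_nonneg_pos[of "A\<^sup>2" e] unfolding K_def by linarith
    ultimately show "(a, b, c, d) \<in> (\<lambda>((a,b),(c,d)). (a,b,c,d)) ` (P \<times> P)"
      by (intro image_eqI[of _ _ "((a,b),(c,d))"]) (auto simp: P_def u'_def v'_def)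
  qed
  thus ?thesis by (rule finite_subset) (use fP in auto)
qed

text \<open>Among all matrices one is taken whose second basis vector is shortest; the minimum
  exists because only finitely many lattice vectors compete. A translation then makes the real part
  small and leaves the second vector unchanged.\<close>

lemma exists_reducing:
  assumes "area w > 0"
  shows "\<exists>g. mat_det g = 1 \<and> reduced_pair (act g w)"
proof -
  obtain u v where ww: "w = (u, v)" by (cases w)
  define q where "q g = cmod (snd (act g w))" for g
  define G where "G = {g. mat_det g = 1 \<and> q g \<le> q (1,0,0,1)}"
  define P where "P = {(m::int, n::int). (cmod (of_int m * u + of_int n * v))\<^sup>2 \<le> (cmod v)\<^sup>2}"
  have fP: "finite P" unfolding P_def using assms ww by (intro finite_bounded_pairs) simp
  have "q ` G \<subseteq> (\<lambda>(c,d). cmod (of_int c * u + of_int d * v)) ` P"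
  proof (rule image_subsetI)
    fix g assume g: "g \<in> G"
    obtain a b c d where gg: "g = (a, b, c, d)" by (cases g)
    show "q g \<in> (\<lambda>(c,d). cmod (of_int c * u + of_int d * v)) ` P"
      using g by (intro image_eqI[of _ _ "(c,d)"]) (auto simp: G_def gg q_def ww P_def)
  qed
  hence fin: "finite (q ` G)" by (rule finite_subset) (use fP in auto)
  have ne: "(1,0,0,1) \<in> G" by (simp add: G_def)
  obtain g0 where g0: "g0 \<in> G" "q g0 = Min (q ` G)"
    using Min_in[OF fin] ne by (metis (no_types, lifting) empty_iff imageE image_eqI)
  have min: "q g0 \<le> q g" if "mat_det g = 1" for g
  proof (cases "g \<in> G")
    case True thus ?thesis using g0 fin by simp
  next
    case False
    have "q g0 \<le> q (1,0,0,1)" using g0 by (simp add: G_def)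
    thus ?thesis using False that by (simp add: G_def)
  qed
  obtain u1 v1 where w1: "act g0 w = (u1, v1)" by (cases "act g0 w")
  have d0: "mat_det g0 = 1" using g0 by (simp add: G_def)
  have a1: "area (u1, v1) > 0" using area_act[of g0 w] assms d0 w1 by simp
  have v1: "v1 \<noteq> 0" using area_pos_nonzero[OF a1] by simp
  define x where "x = Re (u1 * cnj v1) / (cmod v1)\<^sup>2"
  define m where "m = - round x"
  define g1 where "g1 = mat_mult (1, m, 0, 1) g0"
  have d1: "mat_det g1 = 1" by (simp add: g1_def mat_det_mult d0)
  have act1: "act g1 w = (u1 + of_int m * v1, v1)" by (simp add: g1_def act_mat_mult w1)
  have a2: "area (act g1 w) > 0" using assms by (simp add: area_act d1)
  have "\<bar>x + of_int m\<bar> \<le> 1 / 2"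
    using of_int_round_abs_le[of x] by (simp add: m_def abs_minus_commute)
  moreover have "Re ((u1 + of_int m * v1) * cnj v1) = (x + of_int m) * (cmod v1)\<^sup>2"
  proof -
    have "(cmod v1)\<^sup>2 = Re (v1 * cnj v1)" by (simp only: complex_norm_square[symmetric] Re_complex_of_real)
    moreover have "Re (u1 * cnj v1) = x * (cmod v1)\<^sup>2" using v1 by (simp add: x_def)
    moreover have "Re ((u1 + of_int m * v1) * cnj v1) = Re (u1 * cnj v1) + of_int m * Re (v1 * cnj v1)"
      by (simp add: algebra_simps)
    ultimately show ?thesis by (simp add: algebra_simps)
  qed
  ultimately have r1: "2 * \<bar>Re ((u1 + of_int m * v1) * cnj v1)\<bar> \<le> (cmod v1)\<^sup>2"
    using mult_right_mono[of "\<bar>x + of_int m\<bar>" "1 / 2" "(cmod v1)\<^sup>2"] by (simp add: abs_mult)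
  \<comment> \<open>Exchanging the two vectors gives a competitor for the minimum, which yields the
    last inequality of \<open>reduced_pair\<close>.\<close>
  define g2 where "g2 = mat_mult (0, -1, 1, 0) g1"
  have d2: "mat_det g2 = 1" by (simp add: g2_def mat_det_mult d1)
  have "q g0 \<le> q g2" by (rule min[OF d2])
  hence "cmod v1 \<le> cmod (u1 + of_int m * v1)"
    by (simp add: q_def g2_def act_mat_mult act1 w1)
  thus ?thesis using d1 a2 r1 by (intro exI[of _ g1]) (simp add: reduced_pair_def act1)
qed

lemma reduced_Im:
  assumes "reduced_pair (u, v)"
  shows "3 / 4 \<le> (Im (u / v))\<^sup>2" "\<bar>Re (u / v)\<bar> \<le> 1 / 2" "Im (u / v) > 0"
proof -
  have a: "area (u, v) > 0" using assms by (simp add: reduced_pair_def)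
  have v: "v \<noteq> 0" using area_pos_nonzero[OF a] by simp
  have I: "Im (u / v) = area (u, v) / (cmod v)\<^sup>2" using Im_quotient[of "(u,v)"] by simp
  show "3 / 4 \<le> (Im (u / v))\<^sup>2" unfolding I using reduced_bounds(1)[OF assms] v
    by (simp add: power_divide field_simps)
  have R: "Re (u / v) = Re (u * cnj v) / (cmod v)\<^sup>2"
    by (simp add: Re_divide cmod_def power2_eq_square algebra_simps)
  show "\<bar>Re (u / v)\<bar> \<le> 1 / 2" unfolding R using assms v by (simp add: reduced_pair_def field_simps)
  show "Im (u / v) > 0" unfolding I using a v by simp
qed

subsection \<open>Fourier expansions and the maximum principle\<close>

definition nome :: "complex \<Rightarrow> complex" where
  "nome t = exp (2 * of_real pi * \<i> * t)"

lemma nome_power: "exp (2 * of_real pi * \<i> * of_nat n * t) = nome t ^ n"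
  unfolding nome_def exp_of_nat_mult[symmetric] by (simp add: mult_ac)

lemma norm_nome: "cmod (nome t) = exp (- 2 * pi * Im t)"
  by (simp add: nome_def)

lemma nome_nonzero [simp]: "nome t \<noteq> 0"
  by (simp add: nome_def)

lemma norm_nome_less_1: "t \<in> upper_half_plane \<Longrightarrow> cmod (nome t) < 1"
  by (simp add: norm_nome upper_half_plane_def)

lemma exists_nome:
  assumes "z \<noteq> 0"
  shows "\<exists>t. nome t = z \<and> Im t = - ln (cmod z) / (2 * pi)"
proof (intro exI conjI)
  define t where "t = Ln z / (2 * of_real pi * \<i>)"
  show "nome t = z" using assms by (simp add: nome_def t_def)
  have "t = - \<i> * Ln z / of_real (2 * pi)" by (simp add: t_def field_simps)
  hence "Im t = Im (- \<i> * Ln z) / (2 * pi)" by (simp only: Im_divide_of_real)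
  thus "Im t = - ln (cmod z) / (2 * pi)" using assms by simp
qed

lemma exists_nome_upper:
  assumes "z \<noteq> 0" "cmod z < 1"
  shows "\<exists>t\<in>upper_half_plane. nome t = z"
proof -
  have "ln (cmod z) < 0" using assms by simp
  hence "- ln (cmod z) / (2 * pi) > 0" by (simp add: field_simps)
  moreover obtain t where "nome t = z" "Im t = - ln (cmod z) / (2 * pi)"
    using exists_nome[OF assms(1)] by blast
  ultimately show ?thesis by (intro bexI[of _ t]) (simp_all add: upper_half_plane_def)
qed

lemma q_expansion_nome:
  "q_expansion f a \<longleftrightarrow> (\<forall>t\<in>upper_half_plane. (\<lambda>n. a n * nome t ^ n) sums f t)"
  by (simp add: q_expansion_def nome_power)

text \<open>The nome maps the half-plane onto the punctured unit disc, so the expansion is a power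
  series converging at every point of the disc.\<close>

lemma q_expansion_summable:
  assumes "q_expansion f a" "cmod z < 1"
  shows "summable (\<lambda>n. a n * z ^ n)" "summable (\<lambda>n. norm (a n * z ^ n))"
proof -
  have *: "summable (\<lambda>n. a n * z ^ n)" if zz: "cmod z < 1" for z
  proof (cases "z = 0")
    case False
    obtain t where t: "t \<in> upper_half_plane" "nome t = z" using exists_nome_upper[OF False zz] by blast
    have "(\<lambda>n. a n * nome t ^ n) sums f t" using assms(1) t(1) unfolding q_expansion_nome by blast
    thus ?thesis unfolding t(2) by (rule sums_summable)
  qed simp
  show "summable (\<lambda>n. a n * z ^ n)" by (rule *[OF assms(2)])
  obtain r where r: "cmod z < r" "r < 1" using assms(2) dense by blast
  have "cmod (of_real r) < 1" using r order.strict_trans1[OF norm_ge_zero r(1)] by simp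
  from *[OF this] show "summable (\<lambda>n. norm (a n * z ^ n))"
    by (rule powser_insidea) (use r in auto)
qed

text \<open>When the coefficients below \<open>m\<close> vanish, this is \<open>f / q^m\<close> as a
  function of \<open>q\<close>, defined also at the cusp \<open>q = 0\<close>.\<close>

definition shifted_powser :: "nat \<Rightarrow> (nat \<Rightarrow> complex) \<Rightarrow> complex \<Rightarrow> complex" where
  "shifted_powser m a z = (\<Sum>n. a (n + m) * z ^ n)"

lemma shifted_powser_sums:
  assumes "q_expansion f a" "cmod z < 1"
  shows "(\<lambda>n. a (n + m) * z ^ n) sums shifted_powser m a z"
proof (cases "z = 0")
  case True
  thus ?thesis by (simp add: shifted_powser_def powser_zero powser_sums_zero_iff)
next
  case False
  have "summable (\<lambda>n. a (n + m) * z ^ (n + m))"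
    using q_expansion_summable(1)[OF assms] by (subst summable_iff_shift)
  hence "summable (\<lambda>n. a (n + m) * z ^ (n + m) * inverse (z ^ m))" by (rule summable_mult2)
  hence "summable (\<lambda>n. a (n + m) * z ^ n)" using False by (simp add: power_add field_simps)
  thus ?thesis by (simp add: shifted_powser_def summable_sums)
qed

lemma shifted_powser_holomorphic:
  assumes "q_expansion f a"
  shows "shifted_powser m a holomorphic_on ball 0 1"
  by (rule power_series_holomorphic[of _ _ "\<lambda>n. a (n + m)"])
     (use shifted_powser_sums[OF assms] in \<open>auto simp: dist_norm\<close>)

lemma q_expansion_shifted:
  assumes "q_expansion f a" "\<And>i. i < m \<Longrightarrow> a i = 0" "t \<in> upper_half_plane"
  shows "f t = nome t ^ m * shifted_powser m a (nome t)"
proof -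
  have "(\<lambda>n. a n * nome t ^ n) sums f t" using assms by (auto simp: q_expansion_nome)
  hence "(\<lambda>n. a (n + m) * nome t ^ (n + m)) sums f t"
    using assms(2) by (subst sums_iff_shift) simp
  moreover have "(\<lambda>n. nome t ^ m * (a (n + m) * nome t ^ n)) sums (nome t ^ m * shifted_powser m a (nome t))"
    by (intro sums_mult shifted_powser_sums[OF assms(1)] norm_nome_less_1 assms)
  ultimately show ?thesis by (simp add: power_add mult_ac sums_iff)
qed

text \<open>If all earlier coefficients vanish, the shifted series is zero on the punctured disc,
  and by continuity its value \<open>a m\<close> at 0 is zero as well.\<close>

lemma q_expansion_zero_unique:
  assumes "q_expansion (\<lambda>t. 0) a"
  shows "a m = 0"
proof (induction m rule: less_induct)
  case (less m)
  have z: "shifted_powser m a z = 0" if zz: "z \<noteq> 0" "cmod z < 1" for z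
  proof -
    obtain t where t: "t \<in> upper_half_plane" "nome t = z" using exists_nome_upper[OF zz] by blast
    have "0 = nome t ^ m * shifted_powser m a (nome t)"
      by (rule q_expansion_shifted[OF assms _ t(1)]) (use less in auto)
    thus ?thesis using t zz by simp
  qed
  have "continuous_on (ball 0 1) (shifted_powser m a)"
    using shifted_powser_holomorphic[OF assms] by (rule holomorphic_on_imp_continuous_on)
  hence "isCont (shifted_powser m a) 0" by (simp add: continuous_on_eq_continuous_at)
  hence "(shifted_powser m a \<longlongrightarrow> shifted_powser m a 0) (at 0)" by (simp add: isCont_def)
  moreover have "(shifted_powser m a \<longlongrightarrow> 0) (at 0)"
  proof (rule tendsto_eventually)
    have "eventually (\<lambda>z. z \<in> ball 0 1) (at (0::complex))"
      by (intro eventually_at_in_open') auto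
    moreover have "eventually (\<lambda>z. z \<noteq> 0) (at (0::complex))"
      by (simp add: eventually_at_filter)
    ultimately show "eventually (\<lambda>z. shifted_powser m a z = 0) (at 0)"
      by eventually_elim (use z in auto)
  qed
  ultimately have "shifted_powser m a 0 = 0" using tendsto_unique[OF at_neq_bot] by blast
  thus "a m = 0" by (simp add: shifted_powser_def powser_zero)
qed

lemma q_expansion_unique:
  assumes "q_expansion f a" "q_expansion f b"
  shows "a = b"
proof
  fix n
  have "q_expansion (\<lambda>t. 0) (\<lambda>n. a n - b n)"
    unfolding q_expansion_nome
  proof
    fix t assume t: "t \<in> upper_half_plane"
    have "(\<lambda>n. a n * nome t ^ n) sums f t" "(\<lambda>n. b n * nome t ^ n) sums f t"
      using assms t by (auto simp: q_expansion_nome)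
    from sums_diff[OF this] show "(\<lambda>n. (a n - b n) * nome t ^ n) sums 0" by (simp add: algebra_simps)
  qed
  from q_expansion_zero_unique[OF this] show "a n = b n" by simp
qed

lemma fourier_coeff_eq: "q_expansion f a \<Longrightarrow> fourier_coeff f = a"
  unfolding fourier_coeff_def by (rule the_equality) (auto intro: q_expansion_unique)

lemma cusp_form_q_expansion:
  assumes "f \<in> cusp_forms k"
  shows "q_expansion f (fourier_coeff f)" "fourier_coeff f 0 = 0"
  using assms fourier_coeff_eq by (fastforce simp: cusp_forms_def)+

lemma cusp_form_outside: "f \<in> cusp_forms k \<Longrightarrow> t \<notin> upper_half_plane \<Longrightarrow> f t = 0"
  by (simp add: cusp_forms_def)

text \<open>Cuspidality splits off one factor \<open>q\<close>; the remaining series is bounded on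
  the closed disc that corresponds to \<open>Im t \<ge> y0\<close>.\<close>

lemma cusp_form_decay:
  assumes f: "f \<in> cusp_forms k" and y0: "y0 > 0"
  shows "\<exists>C>0. \<forall>t. Im t \<ge> y0 \<longrightarrow> cmod (f t) \<le> C * exp (- 2 * pi * Im t)"
proof -
  define a where "a = fourier_coeff f"
  have q: "q_expansion f a" "a 0 = 0" using cusp_form_q_expansion[OF f] by (auto simp: a_def)
  define r where "r = exp (- 2 * pi * y0)"
  have r: "r < 1" "r > 0" using y0 by (auto simp: r_def)
  have "continuous_on (cball 0 r) (shifted_powser 1 a)"
    using holomorphic_on_subset[OF shifted_powser_holomorphic[OF q(1), of 1], of "cball 0 r"] r
    by (intro holomorphic_on_imp_continuous_on) (auto simp: subset_iff)
  hence "bounded (shifted_powser 1 a ` cball 0 r)"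
    by (intro compact_imp_bounded compact_continuous_image) auto
  then obtain C where C: "C > 0" "\<And>z. z \<in> cball 0 r \<Longrightarrow> cmod (shifted_powser 1 a z) \<le> C"
    unfolding bounded_pos by blast
  show ?thesis
  proof (intro exI conjI allI impI)
    show "C > 0" by fact
    fix t assume t: "Im t \<ge> y0"
    have H: "t \<in> upper_half_plane" using t y0 by (simp add: upper_half_plane_def)
    have "f t = nome t ^ 1 * shifted_powser 1 a (nome t)"
      by (rule q_expansion_shifted[OF q(1) _ H]) (use q in auto)
    moreover have "nome t \<in> cball 0 r" using t by (simp add: norm_nome r_def)
    ultimately have "cmod (f t) \<le> exp (- 2 * pi * Im t) * C"
      using C(2) by (simp add: norm_mult norm_nome)
    thus "cmod (f t) \<le> C * exp (- 2 * pi * Im t)" by (simp add: mult.commute)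
  qed
qed

lemma inv_norm_moebius:
  assumes f: "f \<in> cusp_forms k" and t: "t \<in> upper_half_plane"
  shows "\<exists>t'. 3 / 4 \<le> (Im t')\<^sup>2 \<and> \<bar>Re t'\<bar> \<le> 1 / 2 \<and> Im t' > 0 \<and> inv_norm k f t' = inv_norm k f t"
proof -
  have a: "area (t, 1) > 0" using t by (simp add: area_def upper_half_plane_def)
  obtain g where g: "mat_det g = 1" "reduced_pair (act g (t, 1))" using exists_reducing[OF a] by blast
  obtain u v where uv: "act g (t, 1) = (u, v)" by (cases "act g (t, 1)")
  have a': "area (act g (t, 1)) > 0" using a g by (simp add: area_act)
  have "inv_norm k f (u / v) = inv_norm k f t"
    using inv_norm_lift[OF a', of k f] inv_norm_lift[OF a, of k f] lift_act[OF f g(1) a] g(1)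
    by (simp add: uv[symmetric] area_act) (simp add: uv)
  thus ?thesis using reduced_Im[of u v] g(2) uv by (intro exI[of _ "u / v"]) auto
qed

text \<open>Exponential decay beats \<open>y^k\<close>, so high points of the fundamental domain
  have a smaller norm than one fixed point where \<open>f\<close> is nonzero. What remains of the
  domain is compact, and every orbit meets the domain.\<close>

lemma cusp_form_max:
  assumes f: "f \<in> cusp_forms k"
  shows "\<exists>t0. 3 / 4 \<le> (Im t0)\<^sup>2 \<and> Im t0 > 0 \<and> (\<forall>t\<in>upper_half_plane. inv_norm k f t \<le> inv_norm k f t0)"
proof (cases "\<exists>t1\<in>upper_half_plane. f t1 \<noteq> 0")
  case False
  thus ?thesis by (intro exI[of _ \<i>]) (auto simp: inv_norm_def upper_half_plane_def)
next
  case True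
  then obtain t1 where t1: "t1 \<in> upper_half_plane" "f t1 \<noteq> 0" by blast
  obtain t2 where t2: "3 / 4 \<le> (Im t2)\<^sup>2" "\<bar>Re t2\<bar> \<le> 1 / 2" "Im t2 > 0" "inv_norm k f t2 = inv_norm k f t1"
    using inv_norm_moebius[OF f t1(1)] by blast
  have pos: "inv_norm k f t1 > 0" using t1 by (auto simp: inv_norm_def upper_half_plane_def zero_less_power_int)
  obtain C where C: "C > 0" "\<And>t. Im t \<ge> 1 / 2 \<Longrightarrow> cmod (f t) \<le> C * exp (- 2 * pi * Im t)"
    using cusp_form_decay[OF f, of "1 / 2"] by auto
  have half: "y \<ge> 1 / 2" if "3 / 4 \<le> y\<^sup>2" "y > 0" for y :: real
  proof (rule ccontr)
    assume "\<not> y \<ge> 1 / 2"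
    hence "y\<^sup>2 \<le> (1 / 2)\<^sup>2" using that by (intro power_mono) auto
    thus False using that by (simp add: power2_eq_square)
  qed
  have "((\<lambda>y. C\<^sup>2 * exp (- 2 * pi * y) ^ 2 * y powi k) \<longlongrightarrow> 0) at_top"
  proof -
    have "((\<lambda>y. C\<^sup>2 * exp (- 2 * pi * y) ^ 2 * y powr (of_int k)) \<longlongrightarrow> 0) at_top"
      by real_asymp
    moreover have "eventually (\<lambda>y. C\<^sup>2 * exp (- 2 * pi * y) ^ 2 * y powr (of_int k) = C\<^sup>2 * exp (- 2 * pi * y) ^ 2 * y powi k) at_top"
      using eventually_gt_at_top[of 0] by eventually_elim (simp add: powr_real_of_int')
    ultimately show ?thesis by (rule Lim_transform_eventually)
  qed
  hence "eventually (\<lambda>y. C\<^sup>2 * exp (- 2 * pi * y) ^ 2 * y powi k < inv_norm k f t1) at_top"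
    using pos by (intro order_tendstoD)
  then obtain Y where Y: "\<And>y. y \<ge> Y \<Longrightarrow> C\<^sup>2 * exp (- 2 * pi * y) ^ 2 * y powi k < inv_norm k f t1"
    by (auto simp: eventually_at_top_linorder)
  have small: "inv_norm k f t < inv_norm k f t1" if "Im t \<ge> Y" "Im t \<ge> 1 / 2" for t
  proof -
    have "inv_norm k f t \<le> (C * exp (- 2 * pi * Im t))\<^sup>2 * Im t powi k"
      unfolding inv_norm_def using that C(2)[of t] by (intro mult_right_mono power_mono zero_le_power_int) auto
    also have "\<dots> < inv_norm k f t1" using Y[OF that(1)] by (simp add: power_mult_distrib)
    finally show ?thesis .
  qed
  \<comment> \<open>The bound \<open>1 / 2 \<le> Im t\<close> selects the positive solutions of
    \<open>3 / 4 \<le> (Im t)^2\<close> by a closed condition.\<close>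
  define K where "K = {t. \<bar>Re t\<bar> \<le> 1 / 2 \<and> 1 / 2 \<le> Im t \<and> 3 / 4 \<le> (Im t)\<^sup>2 \<and> Im t \<le> Y}"
  have K: "K \<subseteq> upper_half_plane" by (auto simp: K_def upper_half_plane_def)
  have "closed K" unfolding K_def by (intro closed_Collect_conj closed_Collect_le continuous_intros)
  moreover have "K \<subseteq> cbox (Complex (-1/2) 0) (Complex (1/2) Y)"
    by (auto simp: K_def in_cbox_complex_iff)
  hence "bounded K" using bounded_cbox bounded_subset by blast
  ultimately have "compact K" by (simp add: compact_eq_bounded_closed)
  moreover have "t2 \<in> K" using t2 half[of "Im t2"] small[of t2]
    by (auto simp: K_def intro: ccontr)
  moreover have "continuous_on K (inv_norm k f)"
  proof -
    have "f holomorphic_on upper_half_plane" using f by (simp add: cusp_forms_def)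
    hence "continuous_on K f" using K holomorphic_on_imp_continuous_on continuous_on_subset by blast
    moreover have "\<forall>t\<in>K. Im t \<noteq> 0" using K by (auto simp: upper_half_plane_def)
    ultimately show ?thesis unfolding inv_norm_def
      by (intro continuous_intros) auto
  qed
  ultimately obtain t0 where t0: "t0 \<in> K" "\<And>t. t \<in> K \<Longrightarrow> inv_norm k f t \<le> inv_norm k f t0"
    using continuous_attains_sup[of K "inv_norm k f"] by blast
  show ?thesis
  proof (intro exI conjI ballI)
    show "3 / 4 \<le> (Im t0)\<^sup>2" "Im t0 > 0" using t0 by (auto simp: K_def)
    fix t assume t: "t \<in> upper_half_plane"
    obtain t' where t': "3 / 4 \<le> (Im t')\<^sup>2" "\<bar>Re t'\<bar> \<le> 1 / 2" "Im t' > 0" "inv_norm k f t' = inv_norm k f t"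
      using inv_norm_moebius[OF f t] by blast
    show "inv_norm k f t \<le> inv_norm k f t0"
    proof (cases "Im t' \<le> Y")
      case True
      hence "t' \<in> K" using t' half[of "Im t'"] by (auto simp: K_def)
      thus ?thesis using t0 t' by metis
    next
      case False
      hence "inv_norm k f t' < inv_norm k f t1" using small[of t'] half[of "Im t'"] t' by auto
      also have "\<dots> \<le> inv_norm k f t0" using t0(2)[OF \<open>t2 \<in> K\<close>] t2 by simp
      finally show ?thesis using t' by simp
    qed
  qed
qed

text \<open>The maximum point \<open>t0\<close> is compared with the horizontal line slightly below
  it, which is a circle around \<open>q = 0\<close>. There \<open>inv_norm\<close> is at most its
  maximum, so the maximum principle bounds \<open>f / q^m\<close> at \<open>t0\<close>; if
  \<open>k\<close> is too small this contradicts the size of \<open>f t0\<close>.\<close>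

lemma cusp_form_eq_0_if_high_order:
  assumes f: "f \<in> cusp_forms k" and z: "\<And>i. i < m \<Longrightarrow> fourier_coeff f i = 0"
    and km: "k \<le> 10 * int m" and m: "m > 0"
  shows "f = (\<lambda>t. 0)"
proof (rule ccontr)
  assume nz: "f \<noteq> (\<lambda>t. 0)"
  define a where "a = fourier_coeff f"
  have q: "q_expansion f a" using cusp_form_q_expansion[OF f] by (auto simp: a_def)
  note fq = q_expansion_shifted[OF q z[folded a_def]]
  define G where "G = shifted_powser m a"
  obtain t1 where t1: "t1 \<in> upper_half_plane" "f t1 \<noteq> 0" using nz cusp_form_outside[OF f] by blast
  obtain t0 where t0: "3 / 4 \<le> (Im t0)\<^sup>2" "Im t0 > 0"
    "\<And>t. t \<in> upper_half_plane \<Longrightarrow> inv_norm k f t \<le> inv_norm k f t0"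
    using cusp_form_max[OF f] by blast
  have H0: "t0 \<in> upper_half_plane" using t0 by (simp add: upper_half_plane_def)
  have "inv_norm k f t1 > 0" using t1 by (auto simp: inv_norm_def upper_half_plane_def zero_less_power_int)
  hence pos: "inv_norm k f t0 > 0" using t0(3)[OF t1(1)] by linarith
  \<comment> \<open>Letting \<open>y\<close> tend to \<open>Im t0\<close> would give
    \<open>4 * pi * m * Im t0 \<le> k\<close>; this fixed ratio loses little enough to contradict
    \<open>k \<le> 10 * int m\<close>.\<close>
  define y where "y = 99 / 100 * Im t0"
  have y: "y > 0" using t0 by (simp add: y_def)
  define r where "r = exp (- 2 * pi * y)"
  have r: "0 < r" "r < 1" using y by (auto simp: r_def)
  have N0: "inv_norm k f t0 = (cmod (f t0))\<^sup>2 * Im t0 powi k" by (simp add: inv_norm_def)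
  \<comment> \<open>The bound for \<open>f / q^m\<close> on the circle that results from
    \<open>inv_norm k f t \<le> inv_norm k f t0\<close> at height \<open>y\<close>.\<close>
  define B where "B = sqrt (inv_norm k f t0 / y powi k) / r ^ m"
  have "cmod (G (nome t0)) \<le> B"
  proof (rule maximum_modulus_frontier[where f = G and S = "cball 0 r"])
    show "G holomorphic_on interior (cball 0 r)" "continuous_on (closure (cball 0 r)) G"
      using holomorphic_on_subset[OF shifted_powser_holomorphic[OF q, of m], of "ball 0 r"]
        holomorphic_on_subset[OF shifted_powser_holomorphic[OF q, of m], of "cball 0 r"] r
      by (auto simp: G_def subset_iff intro!: holomorphic_on_imp_continuous_on)
    show "bounded (cball (0::complex) r)" by simp
    show "nome t0 \<in> cball 0 r" using t0 by (simp add: norm_nome r_def y_def)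
  next
    fix z :: complex assume "z \<in> frontier (cball 0 r)"
    hence zr: "cmod z = r" by (simp add: frontier_cball)
    hence "z \<noteq> 0" using r by auto
    then obtain t where t: "nome t = z" "Im t = - ln (cmod z) / (2 * pi)" using exists_nome by blast
    have Im: "Im t = y" using t(2) by (simp add: zr r_def)
    have H: "t \<in> upper_half_plane" using Im y by (simp add: upper_half_plane_def)
    have "(cmod (f t))\<^sup>2 * y powi k \<le> inv_norm k f t0" using t0(3)[OF H] by (simp add: inv_norm_def Im)
    hence "(cmod (f t))\<^sup>2 \<le> inv_norm k f t0 / y powi k" using y by (simp add: field_simps zero_less_power_int)
    hence "cmod (f t) \<le> sqrt (inv_norm k f t0 / y powi k)" by (rule real_le_rsqrt)
    moreover have "cmod (f t) = r ^ m * cmod (G z)"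
      using fq[OF _ H] t zr by (simp add: norm_mult norm_power G_def)
    ultimately show "cmod (G z) \<le> B" using r by (simp add: B_def field_simps)
  qed
  hence "(cmod (G (nome t0)))\<^sup>2 \<le> B\<^sup>2" by (intro power_mono) auto
  hence 1: "(cmod (G (nome t0)))\<^sup>2 \<le> inv_norm k f t0 / y powi k / (r ^ m)\<^sup>2"
    using pos y by (simp add: B_def power_divide zero_le_power_int)
  have "(cmod (f t0))\<^sup>2 = (cmod (nome t0) ^ m)\<^sup>2 * (cmod (G (nome t0)))\<^sup>2"
    using fq[OF _ H0] by (simp add: norm_mult norm_power power_mult_distrib G_def)
  also have "\<dots> \<le> (cmod (nome t0) ^ m)\<^sup>2 * (inv_norm k f t0 / y powi k / (r ^ m)\<^sup>2)"
    by (intro mult_left_mono 1) auto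
  also have "\<dots> = (cmod (f t0))\<^sup>2 * ((Im t0 / y) powi k * (cmod (nome t0) / r) ^ (2 * m))"
    by (simp add: N0 power_int_divide_distrib power_divide power_mult[symmetric] mult.commute[of 2 m])
  finally have 2: "1 \<le> (Im t0 / y) powi k * (cmod (nome t0) / r) ^ (2 * m)"
    using pos by (auto simp: N0 mult_le_cancel_left1)
  have e1: "Im t0 / y = 100 / 99" using t0 by (simp add: y_def)
  have "cmod (nome t0) / r = exp (- 2 * pi * (Im t0 / 100))"
    unfolding norm_nome r_def exp_diff[symmetric] by (simp add: y_def algebra_simps)
  hence e2: "(cmod (nome t0) / r) ^ (2 * m) = exp (- (4 * pi * m * Im t0 / 100))"
    by (simp only: exp_of_nat_mult[symmetric]) (simp add: algebra_simps)
  have "(100 / 99 :: real) powi k \<le> (100 / 99) powi (10 * int m)"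
    by (rule power_int_increasing) (use km in auto)
  also have "\<dots> = (100 / 99) ^ (10 * m)" by (simp add: power_int_def nat_mult_distrib)
  \<comment> \<open>From \<open>100 / 99 = 1 + 1 / 99 \<le> exp (1 / 99)\<close>.\<close>
  also have "\<dots> \<le> exp (1 / 99) ^ (10 * m)"
    using exp_ge_add_one_self[of "1 / 99 :: real"] by (intro power_mono) auto
  also have "\<dots> = exp (10 * m / 99)" unfolding exp_of_nat_mult[symmetric] by simp
  finally have 3: "(100 / 99 :: real) powi k \<le> exp (10 * m / 99)" .
  have "1 \<le> exp (10 * m / 99) * exp (- (4 * pi * m * Im t0 / 100))"
    using 2 3 unfolding e1 e2 by (smt (verit) exp_gt_zero mult_right_mono)
  hence "1 \<le> exp (10 * m / 99 - 4 * pi * m * Im t0 / 100)" by (simp add: exp_diff exp_minus field_simps)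
  hence "4 * pi * m * Im t0 / 100 \<le> 10 * m / 99" by simp
  hence "pi * Im t0 \<le> 10 / 99 * 25" using m by (simp add: field_simps)
  \<comment> \<open>The number 17/20 lies just below \<open>sqrt 3 / 2\<close>; with
    \<open>pi \<ge> 31 / 10\<close> the product is at least 2.635, against the upper bound
    250/99.\<close>
  moreover have "Im t0 \<ge> 17 / 20"
  proof (rule ccontr)
    assume "\<not> Im t0 \<ge> 17 / 20"
    hence "(Im t0)\<^sup>2 \<le> (17 / 20)\<^sup>2" using t0 by (intro power_mono) auto
    thus False using t0 by (simp add: power2_eq_square)
  qed
  hence "31 / 10 * (17 / 20) \<le> pi * Im t0" using pi_approx by (intro mult_mono) auto
  ultimately show False by simp
qed

subsection \<open>The functional equation\<close>

lemma cusp_form_norm_bound: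
  assumes f: "f \<in> cusp_forms k"
  shows "\<exists>M>0. \<forall>t\<in>upper_half_plane. cmod (f t) \<le> M * Im t powr (- (of_int k / 2))"
proof -
  obtain t0 where t0: "\<And>t. t \<in> upper_half_plane \<Longrightarrow> inv_norm k f t \<le> inv_norm k f t0" "Im t0 > 0"
    using cusp_form_max[OF f] by blast
  \<comment> \<open>The summand 1 keeps \<open>M\<close> positive for the zero form.\<close>
  define M where "M = sqrt (inv_norm k f t0) + 1"
  have N0: "inv_norm k f t0 \<ge> 0" using t0(2) by (simp add: inv_norm_def zero_le_power_int)
  hence M: "M > 0" by (simp add: M_def add_nonneg_pos)
  have "cmod (f t) \<le> M * Im t powr (- (of_int k / 2))" if t: "t \<in> upper_half_plane" for t
  proof -
    have y: "Im t > 0" using t by (simp add: upper_half_plane_def)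
    have e: "(Im t powr (of_int k / 2))\<^sup>2 = Im t powi k"
      using y by (simp add: powr_real_of_int' [symmetric] powr_power)
    have "(cmod (f t) * Im t powr (of_int k / 2))\<^sup>2 \<le> inv_norm k f t0"
      using t0(1)[OF t] by (simp add: power_mult_distrib e inv_norm_def)
    hence "cmod (f t) * Im t powr (of_int k / 2) \<le> sqrt (inv_norm k f t0)" by (rule real_le_rsqrt)
    hence "cmod (f t) * Im t powr (of_int k / 2) \<le> M" by (simp add: M_def)
    thus ?thesis using y by (simp add: powr_minus field_simps)
  qed
  thus ?thesis using M by blast
qed

text \<open>Cauchy's estimate on the circle at height \<open>1 / n\<close>: there \<open>f\<close>
  is of size \<open>n powr (k / 2)\<close>, and dividing by \<open>r ^ n = exp (- 2 * pi)\<close>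
  costs only a constant.\<close>

lemma hecke_coefficient_bound:
  assumes f: "f \<in> cusp_forms k"
  shows "\<exists>C>0. \<forall>n>0. cmod (fourier_coeff f n) \<le> C * real n powr (of_int k / 2)"
proof -
  define a where "a = fourier_coeff f"
  have q: "q_expansion f a" "a 0 = 0" using cusp_form_q_expansion[OF f] by (auto simp: a_def)
  define g where "g = shifted_powser 0 a"
  have hol: "g holomorphic_on ball 0 1" unfolding g_def by (rule shifted_powser_holomorphic[OF q(1)])
  have fg: "f t = g (nome t)" if "t \<in> upper_half_plane" for t
    using q_expansion_shifted[OF q(1) _ that, of 0] by (simp add: g_def)
  have "q_expansion f (\<lambda>n. (deriv ^^ n) g 0 / fact n)"
    unfolding q_expansion_nome
  proof
    fix t assume t: "t \<in> upper_half_plane"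
    have "(\<lambda>n. (deriv ^^ n) g 0 / fact n * (nome t - 0) ^ n) sums g (nome t)"
      by (rule holomorphic_power_series[OF hol]) (use norm_nome_less_1[OF t] in simp)
    thus "(\<lambda>n. (deriv ^^ n) g 0 / fact n * nome t ^ n) sums f t" by (simp add: fg[OF t])
  qed
  hence a: "a = (\<lambda>n. (deriv ^^ n) g 0 / fact n)" using q(1) q_expansion_unique by blast
  obtain M where M: "M > 0" "\<And>t. t \<in> upper_half_plane \<Longrightarrow> cmod (f t) \<le> M * Im t powr (- (of_int k / 2))"
    using cusp_form_norm_bound[OF f] by blast
  have "cmod (a n) \<le> (M * exp (2 * pi)) * real n powr (of_int k / 2)" if n: "n > 0" for n
  proof -
    define r where "r = exp (- 2 * pi / n)"
    have r: "r > 0" "r < 1" using n by (auto simp: r_def)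
    have B: "cmod (g z) \<le> M * real n powr (of_int k / 2)" if z: "norm (0 - z) = r" for z
    proof -
      have zr: "cmod z = r" using z by simp
      hence "z \<noteq> 0" using r by auto
      then obtain t where t: "nome t = z" "Im t = - ln (cmod z) / (2 * pi)" using exists_nome by blast
      have Im: "Im t = 1 / n" using t(2) n by (simp add: zr r_def)
      have H: "t \<in> upper_half_plane" using Im n by (simp add: upper_half_plane_def)
      have "(1 / real n) powr (- (of_int k / 2)) = real n powr (of_int k / 2)"
        using n by (simp add: powr_minus powr_divide)
      thus ?thesis using M(2)[OF H] fg[OF H] t Im by simp
    qed
    have "norm ((deriv ^^ n) g 0) \<le> fact n * (M * real n powr (of_int k / 2)) / r ^ n"
    proof (rule Cauchy_inequality[OF _ _ r(1) B])
      show "g holomorphic_on ball 0 r" "continuous_on (cball 0 r) g"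
        using holomorphic_on_subset[OF hol, of "ball 0 r"] holomorphic_on_subset[OF hol, of "cball 0 r"] r
        by (auto simp: subset_iff intro!: holomorphic_on_imp_continuous_on)
    qed
    moreover have "r ^ n = exp (- (2 * pi))"
      using n unfolding r_def exp_of_nat_mult[symmetric] by simp
    ultimately show ?thesis by (simp add: a norm_divide exp_minus field_simps)
  qed
  moreover have "M * exp (2 * pi) > 0" using M by simp
  ultimately show ?thesis unfolding a_def by blast
qed

section \<open>Mellin transforms along the imaginary axis\<close>

lemma continuous_on_of_real_powr:
  "continuous_on {0<..} (\<lambda>t. complex_of_real t powr s)"
  by (intro continuous_intros) auto

text \<open>Euler's Gamma integral after the substitution of \<open>c * y\<close> for the variable;
  the power of \<open>c\<close> collects the Jacobian and the scaling of
  \<open>y powr (s - 1)\<close>.\<close>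

lemma mellin_exp:
  assumes s: "Re s > 0" and c: "c > 0"
  shows "has_bochner_integral lborel
           (\<lambda>y. indicator {0<..} y *\<^sub>R (of_real y powr (s - 1) * of_real (exp (- (c * y)))))
           (of_real c powr (- s) * Gamma s :: complex)"
proof -
  define g where "g t = indicat_real {0<..} t *\<^sub>R (complex_of_real t powr (s - 1) * of_real (exp (- t)))" for t
  have gm: "g \<in> borel_measurable lborel"
    unfolding g_def by (auto intro!: borel_measurable_continuous_on_indicator continuous_on_of_real_powr continuous_intros)
  have geq: "(\<lambda>t. indicat_real {0<..} t *\<^sub>R (complex_of_real t powr (s - 1) / of_real (exp t))) = g"
    by (auto simp: fun_eq_iff g_def exp_minus field_simps)
  have abs: "set_integrable lebesgue {0<..} (\<lambda>t. complex_of_real t powr (s - 1) / of_real (exp t))"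
    by (rule absolutely_integrable_Gamma_integral'[OF s])
  have "integrable lebesgue g" using abs by (simp add: set_integrable_def geq)
  hence int: "integrable lborel g" using integrable_completion[OF gm] by simp
  have "integral\<^sup>L lebesgue g = Gamma s"
    using set_lebesgue_integral_eq_integral(2)[OF abs] integral_unique[OF Gamma_integral_complex'[OF s]]
    by (simp add: set_lebesgue_integral_def geq)
  hence "integral\<^sup>L lborel g = Gamma s" using integral_completion[OF gm] by simp
  with int have "has_bochner_integral lborel g (Gamma s)" by (simp add: has_bochner_integral_iff)
  hence "has_bochner_integral lborel (\<lambda>y. g (0 + c * y)) (Gamma s /\<^sub>R \<bar>c\<bar>)"
    using lborel_has_bochner_integral_real_affine_iff[of c g _ 0] c by simp
  hence h: "has_bochner_integral lborel (\<lambda>y. of_real c powr (1 - s) * g (0 + c * y)) (of_real c powr (1 - s) * (Gamma s /\<^sub>R \<bar>c\<bar>))"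
    by (intro has_bochner_integral_mult_right)
  have 1: "of_real c powr (1 - s) * of_real c powr (s - 1) = (1::complex)"
    using c by (simp add: powr_add[symmetric])
  have "of_real c powr (1 - s) * g (0 + c * y) = indicator {0<..} y *\<^sub>R (of_real y powr (s - 1) * of_real (exp (- (c * y))))" for y
  proof (cases "y > 0")
    case True
    have "of_real (c * y) powr (s - 1) = (of_real c powr (s - 1) * of_real y powr (s - 1) :: complex)"
      using True c by (simp add: powr_times_real)
    thus ?thesis using True c 1 by (simp add: g_def mult_ac)
  next
    case False thus ?thesis using c by (simp add: g_def zero_less_mult_iff)
  qed
  moreover have "of_real c powr (1 - s) * (Gamma s /\<^sub>R \<bar>c\<bar>) = of_real c powr (- s) * Gamma s"
  proof -
    have "of_real c powr (1 - s) = (of_real c powr 1 * of_real c powr (- s) :: complex)"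
      by (simp only: powr_add[symmetric]) simp
    thus ?thesis using c by (simp add: scaleR_conv_of_real)
  qed
  ultimately show ?thesis using h by simp
qed

text \<open>Taking norms replaces \<open>s\<close> by its real part, so this is another Gamma value;
  it measures the terms when sum and integral are interchanged.\<close>

lemma mellin_exp_norm:
  assumes s: "Re s > 0" and c: "c > 0"
  shows "(LINT y|lborel. norm (indicator {0<..} y *\<^sub>R (of_real y powr (s - 1) * of_real (exp (- (c * y)) :: real) :: complex)))
     = c powr (- Re s) * Re (Gamma (of_real (Re s)))"
proof -
  have *: "norm (indicator {0<..} y *\<^sub>R (of_real y powr (s - 1) * of_real (exp (- (c * y))) :: complex)) =
    Re (indicator {0<..} y *\<^sub>R (of_real y powr (of_real (Re s) - 1) * of_real (exp (- (c * y)))))" for y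
  proof (cases "y > 0")
    case True
    have "of_real y powr (of_real (Re s) - 1) = complex_of_real (y powr (Re s - 1))"
      using powr_of_real[of y "Re s - 1"] True by simp
    thus ?thesis using True by (simp add: norm_mult norm_powr_real_powr)
  qed simp
  have "has_bochner_integral lborel
     (\<lambda>y. Re (indicator {0<..} y *\<^sub>R (of_real y powr (of_real (Re s) - 1) * of_real (exp (- (c * y))))))
     (Re (of_real c powr (- of_real (Re s)) * Gamma (of_real (Re s))))"
    using has_bochner_integral_bounded_linear[OF bounded_linear_Re mellin_exp[of "of_real (Re s)" c]] s c by simp
  hence "(LINT y|lborel. Re (indicator {0<..} y *\<^sub>R (of_real y powr (of_real (Re s) - 1) * of_real (exp (- (c * y)))))) =
     Re (of_real c powr (- of_real (Re s)) * Gamma (of_real (Re s)))"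
    by (simp add: has_bochner_integral_iff)
  moreover have "of_real c powr (- of_real (Re s)) = complex_of_real (c powr (- Re s))"
    using powr_of_real[of c "- Re s"] c by simp
  ultimately show ?thesis unfolding * by simp
qed

lemma integrable_exp_tail:
  fixes c :: real
  assumes c: "c > 0"
  shows "set_integrable lborel {1..} (\<lambda>y. exp (- (c * y)))"
proof -
  have "integrable lborel (\<lambda>y. norm (indicator {0<..} y *\<^sub>R (of_real y powr (1 - 1) * of_real (exp (- (c * y)) :: real) :: complex)))"
    using mellin_exp[of 1 c] c by (intro integrable_norm) (auto simp: has_bochner_integral_iff)
  hence "set_integrable lborel {0<..} (\<lambda>y. exp (- (c * y)))"
    unfolding set_integrable_def
    by (rule back_subst[of "integrable lborel"]) (auto simp: fun_eq_iff indicator_def)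
  thus ?thesis by (rule set_integrable_subset) auto
qed

definition on_imag_axis :: "(complex \<Rightarrow> complex) \<Rightarrow> real \<Rightarrow> complex" where
  "on_imag_axis f y = f (\<i> * of_real y)"

text \<open>The part \<open>y < 1\<close> of the Mellin transform is folded back by \<open>y \<mapsto> 1 / y\<close>, so that only this integral,
  entire in \<open>s\<close>, is needed.\<close>

definition half_mellin :: "(complex \<Rightarrow> complex) \<Rightarrow> complex \<Rightarrow> complex" where
  "half_mellin f s = (LINT y:{1..}|lborel. on_imag_axis f y * of_real y powr (s - 1))"

lemma axis_continuous:
  assumes "f \<in> cusp_forms k"
  shows "continuous_on {0<..} (on_imag_axis f)"
proof -
  have "continuous_on upper_half_plane f"
    using assms by (auto simp: cusp_forms_def intro: holomorphic_on_imp_continuous_on)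
  thus ?thesis unfolding on_imag_axis_def[abs_def]
    by (rule continuous_on_compose2) (auto simp: upper_half_plane_def intro!: continuous_intros)
qed

text \<open>The constant depends only on the bound for \<open>Re s\<close>, which makes the
  convergence of the tail integrals locally uniform in \<open>s\<close>. Of the decay
  \<open>exp (- y) * exp (- y)\<close> one factor absorbs the power of \<open>y\<close> and the
  other is kept.\<close>

lemma axis_tail_bound:
  assumes f: "f \<in> cusp_forms k"
  shows "\<exists>C>0. \<forall>s y. Re s \<le> R \<longrightarrow> 1 \<le> y \<longrightarrow> cmod (on_imag_axis f y * of_real y powr (s - 1)) \<le> C * exp (- y)"
proof -
  obtain C where C: "C > 0" "\<And>t. Im t \<ge> 1 \<Longrightarrow> cmod (f t) \<le> C * exp (- 2 * pi * Im t)"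
    using cusp_form_decay[OF f, of 1] by auto
  define h where "h y = y powr \<bar>R\<bar> * exp (- y)" for y :: real
  have "(h \<longlongrightarrow> 0) at_top" unfolding h_def by real_asymp
  hence "eventually (\<lambda>y. h y < 1) at_top" by (rule order_tendstoD) simp
  then obtain Y where Y: "\<And>y. y \<ge> Y \<Longrightarrow> h y < 1" by (auto simp: eventually_at_top_linorder)
  define D where "D = max 1 \<bar>Y\<bar> powr \<bar>R\<bar> + 1"
  have hD: "h y \<le> D" if "y \<ge> 1" for y
  proof (cases "y \<ge> Y")
    case True
    moreover have "D \<ge> 1" by (simp add: D_def)
    ultimately show ?thesis using Y[of y] by linarith
  next
    case False
    have "h y \<le> y powr \<bar>R\<bar> * 1" unfolding h_def using that by (intro mult_left_mono) auto
    also have "\<dots> \<le> max 1 \<bar>Y\<bar> powr \<bar>R\<bar>" using that False by (simp add: powr_mono2)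
    finally show ?thesis by (simp add: D_def)
  qed
  have D: "D > 0" using hD[of 1] by (simp add: h_def D_def add_nonneg_pos)
  have "cmod (on_imag_axis f y * of_real y powr (s - 1)) \<le> C * D * exp (- y)" if s: "Re s \<le> R" and y: "1 \<le> y" for s y
  proof -
    have 1: "cmod (on_imag_axis f y) \<le> C * exp (- 2 * pi * y)"
      using C(2)[of "\<i> * of_real y"] y by (simp add: on_imag_axis_def[abs_def])
    have "Re s - 1 \<le> \<bar>R\<bar>" using s by linarith
    hence 2: "cmod (of_real y powr (s - 1)) \<le> y powr \<bar>R\<bar>"
      using y by (simp add: norm_powr_real_powr powr_mono)
    have "exp (- 2 * pi * y) \<le> exp (- y) * exp (- y)"
      unfolding exp_add[symmetric] using y pi_gt3 by (simp add: mult_right_mono)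
    hence "cmod (on_imag_axis f y) \<le> C * (exp (- y) * exp (- y))" using 1 C(1) by (smt (verit) mult_left_mono)
    hence "cmod (on_imag_axis f y * of_real y powr (s - 1)) \<le> C * (exp (- y) * exp (- y)) * y powr \<bar>R\<bar>"
      using 2 C(1) unfolding norm_mult by (intro mult_mono) auto
    also have "\<dots> = C * h y * exp (- y)" by (simp add: h_def)
    also have "\<dots> \<le> C * D * exp (- y)" using hD[OF y] C(1) by (intro mult_right_mono mult_left_mono) auto
    finally show ?thesis .
  qed
  thus ?thesis using C(1) D by (intro exI[of _ "C * D"]) auto
qed

lemma half_mellin_integrable:
  assumes f: "f \<in> cusp_forms k"
  shows "set_integrable lborel {1..} (\<lambda>y. on_imag_axis f y * of_real y powr (s - 1))"
proof -
  obtain C where C: "C > 0" "\<And>y. 1 \<le> y \<Longrightarrow> cmod (on_imag_axis f y * of_real y powr (s - 1)) \<le> C * exp (- y)"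
    using axis_tail_bound[OF f, of "Re s"] by auto
  have "set_integrable lborel {1..} (\<lambda>y. C * exp (- (1 * y)))"
    by (rule set_integrable_mult_right, rule integrable_exp_tail) simp
  thus ?thesis
  proof (rule set_integrable_bound)
    show "set_borel_measurable lborel {1..} (\<lambda>y. on_imag_axis f y * of_real y powr (s - 1))"
      unfolding set_borel_measurable_def measurable_lborel2
      by (intro borel_measurable_continuous_on_indicator continuous_intros
          continuous_on_subset[OF axis_continuous[OF f]] continuous_on_subset[OF continuous_on_of_real_powr]) auto
    show "AE y in lborel. y \<in> {1..} \<longrightarrow> cmod (on_imag_axis f y * of_real y powr (s - 1)) \<le> norm (C * exp (- (1 * y)))"
      using C by (intro AE_I2) auto
  qed
qed

text \<open>The integrals over bounded intervals are entire by differentiation under the integral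
  sign, and they converge uniformly on unit discs.\<close>

lemma half_mellin_holomorphic:
  assumes f: "f \<in> cusp_forms k"
  shows "half_mellin f holomorphic_on UNIV"
proof (rule holomorphic_uniform_sequence)
  define F where "F n s = integral {1..real n + 1} (\<lambda>y. on_imag_axis f y * of_real y powr (s - 1))" for n s
  have cont: "continuous_on {1..real n + 1} (on_imag_axis f)" for n
    by (rule continuous_on_subset[OF axis_continuous[OF f]]) auto
  show "open (UNIV :: complex set)" by simp
  fix n
  show "F n holomorphic_on UNIV"
    unfolding F_def
  proof (rule leibniz_rule_holomorphic[where a = 1 and b = "real n + 1", unfolded cbox_interval])
    show "((\<lambda>s. on_imag_axis f y * of_real y powr (s - 1)) has_field_derivative on_imag_axis f y * (Ln (of_real y) * of_real y powr (s - 1))) (at s within UNIV)"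
      if "y \<in> {1..real n + 1}" for s y
    proof -
      have "((\<lambda>z. of_real y powr z) has_field_derivative Ln (of_real y) * of_real y powr (s - 1)) (at (s - 1))"
        by (rule has_field_derivative_powr_right) (use that in auto)
      hence "((\<lambda>s. of_real y powr (s - 1)) has_field_derivative Ln (of_real y) * of_real y powr (s - 1) * 1) (at s)"
        by (rule DERIV_chain2) (auto intro!: derivative_eq_intros)
      thus ?thesis by (intro DERIV_cmult) simp
    qed
    show "(\<lambda>y. on_imag_axis f y * of_real y powr (s - 1)) integrable_on {1..real n + 1}" for s
      by (intro integrable_continuous_interval continuous_intros cont) auto
    have "continuous_on (UNIV \<times> {1..real n + 1}) (\<lambda>p. on_imag_axis f (snd p))"
      by (rule continuous_on_compose2[OF cont[of n]]) (auto intro!: continuous_intros)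
    thus "continuous_on (UNIV \<times> {1..real n + 1}) (\<lambda>(s, y). on_imag_axis f y * (Ln (of_real y) * of_real y powr (s - 1)))"
      unfolding case_prod_unfold
      by (intro continuous_intros) (auto simp: complex_nonpos_Reals_iff)
  qed simp
next
  define F where "F n s = integral {1..real n + 1} (\<lambda>y. on_imag_axis f y * of_real y powr (s - 1))" for n s
  fix s0 :: complex
  obtain C where C: "C > 0" "\<And>s y. Re s \<le> Re s0 + 1 \<Longrightarrow> 1 \<le> y \<Longrightarrow> cmod (on_imag_axis f y * of_real y powr (s - 1)) \<le> C * exp (- y)"
    using axis_tail_bound[OF f, of "Re s0 + 1"] by blast
  \<comment> \<open>Beyond \<open>real n + 1\<close> the bound \<open>exp (- y)\<close> is split as
    \<open>exp (- n / 2) * exp (- y / 2)\<close>: the first factor tends to 0, and \<open>I\<close>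
    is the integral of the second.\<close>
  define I :: real where "I = (LINT y:{1..}|lborel. exp (- (1 / 2 * y)))"
  have "uniform_limit (cball s0 1) F (half_mellin f) sequentially"
  proof (rule uniform_limitI)
    fix e :: real assume e: "e > 0"
    have "((\<lambda>n. C * exp (- (real n / 2)) * I) \<longlongrightarrow> C * 0 * I) sequentially"
      by (intro tendsto_intros) real_asymp
    hence "eventually (\<lambda>n. C * exp (- (real n / 2)) * I < e) sequentially"
      by (rule order_tendstoD) (use e in simp)
    thus "\<forall>\<^sub>F n in sequentially. \<forall>s\<in>cball s0 1. dist (F n s) (half_mellin f s) < e"
    proof eventually_elim
      case (elim n)
      show ?case
      proof
        fix s assume "s \<in> cball s0 1"
        hence "\<bar>Re (s - s0)\<bar> \<le> 1" using abs_Re_le_cmod[of "s - s0"] by (simp add: dist_norm norm_minus_commute)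
        hence s: "Re s \<le> Re s0 + 1" by simp
        define G where "G y = on_imag_axis f y * of_real y powr (s - 1)" for y
        have iG: "set_integrable lborel {1..} G" unfolding G_def by (rule half_mellin_integrable[OF f])
        have iG1: "set_integrable lborel {1..real n + 1} G" by (rule set_integrable_subset[OF iG]) auto
        have iG2: "set_integrable lborel {real n + 1<..} G" by (rule set_integrable_subset[OF iG]) auto
        have "half_mellin f s = (LINT y:{1..real n + 1} \<union> {real n + 1<..}|lborel. G y)"
          unfolding half_mellin_def G_def[symmetric] by (rule arg_cong[of _ _ "\<lambda>A. LINT y:A|lborel. G y"]) auto
        also have "\<dots> = (LINT y:{1..real n + 1}|lborel. G y) + (LINT y:{real n + 1<..}|lborel. G y)"
          by (rule set_integral_Un) (use iG1 iG2 in auto)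
        also have "(LINT y:{1..real n + 1}|lborel. G y) = F n s"
          using set_borel_integral_eq_integral(2)[OF iG1] by (simp add: F_def G_def[abs_def])
        finally have "half_mellin f s - F n s = (LINT y:{real n + 1<..}|lborel. G y)" by simp
        moreover have "cmod (LINT y:{real n + 1<..}|lborel. G y) \<le> (LINT y|lborel. C * exp (- (real n / 2)) * (indicator {1..} y *\<^sub>R exp (- (1 / 2 * y))))"
          unfolding set_lebesgue_integral_def
        proof (rule Bochner_Integration.integral_norm_bound_integral)
          show "integrable lborel (\<lambda>y. indicat_real {real n + 1<..} y *\<^sub>R G y)" using iG2 by (simp add: set_integrable_def)
          show "integrable lborel (\<lambda>y. C * exp (- (real n / 2)) * (indicator {1..} y *\<^sub>R exp (- (1 / 2 * y))))"
            using integrable_exp_tail[of "1/2"] unfolding set_integrable_def by (intro integrable_mult_right) auto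
          fix y :: real
          show "cmod (indicat_real {real n + 1<..} y *\<^sub>R G y) \<le> C * exp (- (real n / 2)) * (indicator {1..} y *\<^sub>R exp (- (1 / 2 * y)))"
          proof (cases "y > real n + 1")
            case True
            have "cmod (G y) \<le> C * exp (- y)" unfolding G_def by (rule C(2)[OF s]) (use True in simp)
            also have "exp (- y) \<le> exp (- (real n / 2)) * exp (- (1 / 2 * y))"
              unfolding exp_add[symmetric] using True by simp
            finally show ?thesis using True C(1) by (simp add: mult.assoc)
          qed (use C(1) in simp)
        qed
        ultimately have "cmod (half_mellin f s - F n s) \<le> C * exp (- (real n / 2)) * I"
          by (simp add: I_def set_lebesgue_integral_def)
        thus "dist (F n s) (half_mellin f s) < e" using elim by (simp add: dist_norm norm_minus_commute)
      qed
    qed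
  qed
  thus "\<exists>d>0. cball s0 d \<subseteq> UNIV \<and>
          uniform_limit (cball s0 d) (\<lambda>n s. integral {1..real n + 1} (\<lambda>y. on_imag_axis f y * of_real y powr (s - 1))) (half_mellin f) sequentially"
    unfolding F_def by (intro exI[of _ 1]) auto
qed

lemma integral_inverse_substitution:
  fixes F :: "real \<Rightarrow> complex"
  assumes cont: "continuous_on {0<..} F" and int: "set_integrable lborel {0<..1} F"
    and int': "set_integrable lborel {1..} (\<lambda>x. of_real (1 / x\<^sup>2) * F (1 / x))"
  shows "(LINT y:{0<..1}|lborel. F y) = (LINT x:{1..}|lborel. of_real (1 / x\<^sup>2) * F (1 / x))"
proof -
  have img: "(\<lambda>x::real. 1 / x) ` {1..} = {0<..1}"
  proof
    show "{0<..1} \<subseteq> (\<lambda>x::real. 1 / x) ` {1..}"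
    proof
      fix y :: real assume "y \<in> {0<..1}"
      thus "y \<in> (\<lambda>x::real. 1 / x) ` {1..}" by (intro image_eqI[of _ _ "1 / y"]) auto
    qed
  qed auto
  have leb: "set_integrable lebesgue A h" if "set_integrable lborel A h" for A and h :: "real \<Rightarrow> real"
    using that unfolding set_integrable_def
    using integrable_completion[of "\<lambda>x. indicat_real A x *\<^sub>R h x" lborel] borel_measurable_integrable by blast
  \<comment> \<open>The substitution is made for real functions; \<open>h\<close> stands for
    \<open>Re\<close> and for \<open>Im\<close>.\<close>
  have re: "integral {0<..1} (\<lambda>y. h (F y)) = integral {1..} (\<lambda>x. h (of_real (1 / x\<^sup>2) * F (1 / x)))"
    if h: "bounded_linear h" "\<And>r z. h (of_real r * z) = r * h z" for h :: "complex \<Rightarrow> real"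
  proof -
    have 1: "set_integrable lborel {0<..1} (\<lambda>y. h (F y))"
      using integrable_bounded_linear[OF h(1) int[unfolded set_integrable_def]]
      by (simp add: set_integrable_def linear_simps[OF h(1)])
    define G where "G y = h (F y)" for y
    have "G absolutely_integrable_on ((\<lambda>x. 1 / x) ` {1..}) \<and> integral ((\<lambda>x. 1 / x) ` {1..}) G = integral {0<..1} G"
      using leb[OF 1] by (simp add: img G_def[abs_def])
    moreover have "inj_on (\<lambda>x::real. 1 / x) {1..}" by (auto simp: inj_on_def)
    moreover have "((\<lambda>x. 1 / x) has_field_derivative - 1 / x\<^sup>2) (at x within {1..})" if "x \<in> {1..}" for x :: real
      using that by (auto intro!: derivative_eq_intros simp: power2_eq_square)
    moreover have "{1::real..} \<in> sets lebesgue" by simp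
    ultimately have "integral {1..} (\<lambda>x. \<bar>- 1 / x\<^sup>2\<bar> * G (1 / x)) = integral {0<..1} G"
      using has_absolute_integral_change_of_variables_1'[of "{1..}" "\<lambda>x::real. 1 / x" "\<lambda>x. - 1 / x\<^sup>2" G "integral {0<..1} G"]
      by blast
    thus ?thesis unfolding h(2) G_def[abs_def] by simp
  qed
  have eq: "integral {0<..1} F = integral {1..} (\<lambda>x. of_real (1 / x\<^sup>2) * F (1 / x))" (is "_ = integral _ ?G")
  proof (rule complex_eqI)
    have iF: "F integrable_on {0<..1}" by (rule set_borel_integral_eq_integral[OF int])
    have iG: "?G integrable_on {1..}" by (rule set_borel_integral_eq_integral[OF int'])
    show "Re (integral {0<..1} F) = Re (integral {1..} ?G)"
      using integral_linear[OF iF bounded_linear_Re] integral_linear[OF iG bounded_linear_Re] re[OF bounded_linear_Re]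
      by (simp add: o_def)
    show "Im (integral {0<..1} F) = Im (integral {1..} ?G)"
      using integral_linear[OF iF bounded_linear_Im] integral_linear[OF iG bounded_linear_Im] re[OF bounded_linear_Im]
      by (simp add: o_def)
  qed
  show ?thesis using eq set_borel_integral_eq_integral(2)[OF int] set_borel_integral_eq_integral(2)[OF int'] by simp
qed

lemma cusp_form_moebius:
  fixes a b c d :: int
  assumes "f \<in> cusp_forms k" "a * d - b * c = 1" "t \<in> upper_half_plane"
  shows "f ((of_int a * t + of_int b) / (of_int c * t + of_int d)) = (of_int c * t + of_int d) powi k * f t"
  using assms unfolding cusp_forms_def by blast

lemma on_imag_axis_inverse:
  assumes f: "f \<in> cusp_forms (2 * j)" and y: "y > 0"
  shows "on_imag_axis f (1 / y) = (- 1) powi j * of_real y powi (2 * j) * on_imag_axis f y"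
proof -
  have H: "\<i> * of_real y \<in> upper_half_plane" using y by (simp add: upper_half_plane_def)
  have "f ((- 1) / (\<i> * of_real y)) = (\<i> * of_real y) powi (2 * j) * f (\<i> * of_real y)"
    using cusp_form_moebius[OF f, of 0 0 "-1" 1, OF _ H] by simp
  moreover have "(- 1) / (\<i> * of_real y) = \<i> * of_real (1 / y)" using y by (simp add: field_simps)
  moreover have "\<i> powi (2 * j) = (- 1) powi j" by (simp add: power_int_mult)
  ultimately show ?thesis by (simp add: on_imag_axis_def power_int_mult_distrib)
qed

text \<open>Termwise integration is justified by the coefficient bound: the integrals of the norms
  are of size \<open>n powr (k / 2 - Re s)\<close>, a convergent series precisely when
  \<open>Re s > k / 2 + 1\<close>.\<close>

lemma cusp_form_mellin:
  assumes f: "f \<in> cusp_forms k" and k: "k \<ge> 0" and s: "Re s > of_int k / 2 + 1"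
  shows "set_integrable lborel {0<..} (\<lambda>y. on_imag_axis f y * of_real y powr (s - 1))" (is ?A)
    and "(\<lambda>n. fourier_coeff f (Suc n) * (of_real (2 * pi * real (Suc n)) powr (- s) * Gamma s)) sums
      (LINT y:{0<..}|lborel. on_imag_axis f y * of_real y powr (s - 1))" (is ?B)
proof -
  define a where "a = fourier_coeff f"
  have q: "q_expansion f a" "a 0 = 0" using cusp_form_q_expansion[OF f] by (auto simp: a_def)
  have s0: "Re s > 0" using s k by (smt (verit) divide_nonneg_nonneg of_int_nonneg)
  define c where "c n = 2 * pi * real (Suc n)" for n
  have c: "c n > 0" for n by (simp add: c_def)
  define E where "E n y = indicator {0<..} y *\<^sub>R (of_real y powr (s - 1) * of_real (exp (- (c n * y))) :: complex)" for n y
  define T where "T n y = a (Suc n) * E n y" for n y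
  have hE: "has_bochner_integral lborel (E n) (of_real (c n) powr (- s) * Gamma s)" for n
    unfolding E_def[abs_def] by (rule mellin_exp[OF s0 c])
  have iT: "integrable lborel (T n)" for n
    unfolding T_def[abs_def] using hE[of n] by (intro integrable_mult_right) (auto simp: has_bochner_integral_iff)
  have vT: "integral\<^sup>L lborel (T n) = a (Suc n) * (of_real (c n) powr (- s) * Gamma s)" for n
    unfolding T_def[abs_def] using hE[of n] by (simp add: has_bochner_integral_iff)
  have TS: "(\<lambda>n. T n y) sums (indicator {0<..} y *\<^sub>R (on_imag_axis f y * of_real y powr (s - 1)))"
    and TN: "summable (\<lambda>n. norm (T n y))" for y
  proof -
    have "(\<lambda>n. T n y) sums (indicator {0<..} y *\<^sub>R (on_imag_axis f y * of_real y powr (s - 1))) \<and> summable (\<lambda>n. norm (T n y))"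
    proof (cases "y > 0")
      case True
      define t where "t = \<i> * of_real y"
      have H: "t \<in> upper_half_plane" using True by (simp add: upper_half_plane_def t_def)
      have nt: "nome t ^ n = of_real (exp (- (2 * pi * real n * y)))" for n
        unfolding nome_power[symmetric] t_def exp_of_real[symmetric] by (rule arg_cong[of _ _ exp]) simp
      have e: "T n y = of_real y powr (s - 1) * (a (Suc n) * nome t ^ Suc n)" for n
        unfolding T_def E_def nt using True by (simp add: c_def)
      have "(\<lambda>n. a n * nome t ^ n) sums f t" using q H by (simp add: q_expansion_nome)
      hence "(\<lambda>n. a (Suc n) * nome t ^ Suc n) sums f t" using q(2) by (subst sums_Suc_iff) simp
      hence "(\<lambda>n. T n y) sums (of_real y powr (s - 1) * f t)" unfolding e by (rule sums_mult)
      moreover have "summable (\<lambda>n. norm (a n * nome t ^ n))"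
        by (rule q_expansion_summable(2)[OF q(1) norm_nome_less_1[OF H]])
      hence "summable (\<lambda>n. norm (a (Suc n) * nome t ^ Suc n))" by (subst summable_Suc_iff)
      hence "summable (\<lambda>n. norm (T n y))" unfolding e norm_mult[of "of_real y powr (s - 1)"] by (rule summable_mult)
      ultimately show ?thesis using True by (simp add: on_imag_axis_def t_def mult.commute)
    qed (simp add: T_def E_def)
    thus "(\<lambda>n. T n y) sums (indicator {0<..} y *\<^sub>R (on_imag_axis f y * of_real y powr (s - 1)))"
      "summable (\<lambda>n. norm (T n y))" by blast+
  qed
  have SN: "summable (\<lambda>n. LINT y|lborel. norm (T n y))"
  proof -
    obtain C where C: "C > 0" "\<And>n. n > 0 \<Longrightarrow> cmod (a n) \<le> C * real n powr (of_int k / 2)"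
      using hecke_coefficient_bound[OF f] unfolding a_def by blast
    define R where "R = \<bar>Re (Gamma (of_real (Re s)))\<bar>"
    have "summable (\<lambda>n. real n powr (of_int k / 2 - Re s))" using s by (subst summable_real_powr_iff) simp
    hence "summable (\<lambda>n. real (Suc n) powr (of_int k / 2 - Re s))" by (subst summable_Suc_iff)
    hence "summable (\<lambda>n. C * R * real (Suc n) powr (of_int k / 2 - Re s))" by (rule summable_mult)
    thus ?thesis
    proof (rule summable_comparison_test')
      fix n :: nat
      have "(LINT y|lborel. norm (T n y)) = cmod (a (Suc n)) * (LINT y|lborel. norm (E n y))"
        unfolding T_def norm_mult by simp
      also have "(LINT y|lborel. norm (E n y)) = c n powr (- Re s) * Re (Gamma (of_real (Re s)))"
        unfolding E_def by (rule mellin_exp_norm[OF s0 c])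
      finally have 1: "norm (LINT y|lborel. norm (T n y)) = cmod (a (Suc n)) * (c n powr (- Re s) * R)"
        by (simp add: R_def abs_mult)
      have "c n powr (- Re s) \<le> real (Suc n) powr (- Re s)"
      proof (rule powr_mono2')
        show "real (Suc n) \<le> c n" unfolding c_def using pi_gt3 by (simp add: mult_le_cancel_right1)
      qed (use s0 in auto)
      hence "norm (LINT y|lborel. norm (T n y)) \<le> (C * real (Suc n) powr (of_int k / 2)) * (real (Suc n) powr (- Re s) * R)"
        unfolding 1 using C(1) by (intro mult_mono C(2) mult_nonneg_nonneg) (auto simp: R_def)
      also have "\<dots> = C * R * (real (Suc n) powr (of_int k / 2) * real (Suc n) powr (- Re s))"
        by (simp only: mult_ac)
      also have "\<dots> = C * R * real (Suc n) powr (of_int k / 2 - Re s)"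
        unfolding powr_add[symmetric] by simp
      finally show "norm (LINT y|lborel. norm (T n y)) \<le> C * R * real (Suc n) powr (of_int k / 2 - Re s)" .
    qed
  qed
  have eq: "(\<lambda>y. \<Sum>n. T n y) = (\<lambda>y. indicator {0<..} y *\<^sub>R (on_imag_axis f y * of_real y powr (s - 1)))"
    using TS by (auto simp: fun_eq_iff sums_iff)
  have "integrable lborel (\<lambda>y. \<Sum>n. T n y)"
    by (rule integrable_suminf[OF iT _ SN]) (use TN in auto)
  thus ?A unfolding eq set_integrable_def .
  have "(\<lambda>n. integral\<^sup>L lborel (T n)) sums (LINT y|lborel. (\<Sum>n. T n y))"
    by (rule sums_integral[OF iT _ SN]) (use TN in auto)
  hence "(\<lambda>n. a (Suc n) * (of_real (c n) powr (- s) * Gamma s)) sums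
      (LINT y:{0<..}|lborel. on_imag_axis f y * of_real y powr (s - 1))"
    unfolding eq set_lebesgue_integral_def vT .
  thus ?B unfolding a_def c_def .
qed

lemma mellin_split:
  assumes f: "f \<in> cusp_forms (2 * j)"
    and int: "set_integrable lborel {0<..} (\<lambda>y. on_imag_axis f y * of_real y powr (s - 1))"
  shows "(LINT y:{0<..}|lborel. on_imag_axis f y * of_real y powr (s - 1)) =
    half_mellin f s + (- 1) powi j * half_mellin f (of_int (2 * j) - s)"
proof -
  define F where "F y = on_imag_axis f y * of_real y powr (s - 1)" for y
  have int': "set_integrable lborel {0<..} F" using int by (simp add: F_def[abs_def])
  have i1: "set_integrable lborel {0<..1} F" by (rule set_integrable_subset[OF int']) auto
  have i2: "set_integrable lborel {1..} F" by (rule set_integrable_subset[OF int']) auto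
  have i3: "set_integrable lborel {1<..} F" by (rule set_integrable_subset[OF int']) auto
  have cF: "continuous_on {0<..} F" unfolding F_def
    by (intro continuous_intros axis_continuous[OF f] continuous_on_of_real_powr)
  \<comment> \<open>The exponents add up as \<open>- 2 + 2 * j + (1 - s)\<close>: Jacobian,
    modularity and Mellin kernel at \<open>1 / x\<close>.\<close>
  have eq: "of_real (1 / x\<^sup>2) * F (1 / x) = (- 1) powi j * (on_imag_axis f x * of_real x powr (of_int (2 * j) - s - 1))"
    if x: "x \<ge> 1" for x
  proof -
    have x0: "x > 0" "complex_of_real x \<noteq> 0" using x by auto
    have 1: "of_real (1 / x) powr (s - 1) = complex_of_real x powr (1 - s)"
    proof -
      have "Ln (complex_of_real (1 / x)) = - Ln (complex_of_real x)"
        using x0 Ln_of_real[of "1 / x"] Ln_of_real[of x] by (simp add: ln_div del: of_real_divide)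
      thus ?thesis using x0 by (simp add: powr_def algebra_simps)
    qed
  have 2: "of_real (1 / x\<^sup>2) = complex_of_real x powr (- 2)"
      using x0 powr_neg_numeral[of x] by (simp add: powr_minus divide_simps)
    have 3: "complex_of_real x powi (2 * j) = complex_of_real x powr of_int (2 * j)"
      using x0 by (intro complex_powr_of_int[symmetric]) auto
    have "of_real (1 / x\<^sup>2) * F (1 / x) = (- 1) powi j * on_imag_axis f x *
       (complex_of_real x powr (- 2) * (complex_of_real x powr of_int (2 * j) * complex_of_real x powr (1 - s)))"
      unfolding F_def on_imag_axis_inverse[OF f x0(1)] 1 2 3 by (simp only: mult_ac)
    also have "\<dots> = (- 1) powi j * on_imag_axis f x * complex_of_real x powr (of_int (2 * j) - s - 1)"
      unfolding powr_add[symmetric] by (simp add: algebra_simps)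
    finally show ?thesis by (simp only: mult.assoc)
  qed
  have i4: "set_integrable lborel {1..} (\<lambda>x. of_real (1 / x\<^sup>2) * F (1 / x))"
  proof -
    have "set_integrable lborel {1..} (\<lambda>x. (- 1) powi j * (on_imag_axis f x * of_real x powr (of_int (2 * j) - s - 1)))"
      by (rule set_integrable_mult_right, rule half_mellin_integrable[OF f])
    also have "?this = ?thesis" by (rule set_integrable_cong) (use eq in auto)
    finally show ?thesis .
  qed
  have "(LINT y:{0<..}|lborel. F y) = (LINT y:{0<..1} \<union> {1<..}|lborel. F y)"
    by (rule arg_cong[of _ _ "\<lambda>A. LINT y:A|lborel. F y"]) auto
  also have "\<dots> = (LINT y:{0<..1}|lborel. F y) + (LINT y:{1<..}|lborel. F y)"
    by (rule set_integral_Un) (use i1 i3 in auto)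
  also have "(LINT y:{1<..}|lborel. F y) = (LINT y:{1..}|lborel. F y)"
    unfolding set_lebesgue_integral_def
  proof (rule integral_cong_AE)
    show "AE y in lborel. indicat_real {1<..} y *\<^sub>R F y = indicat_real {1..} y *\<^sub>R F y"
      using AE_lborel_singleton[of 1] by eventually_elim (auto simp: indicator_def)
  qed (use i2 i3 in \<open>auto simp: set_integrable_def\<close>)
  also have "(LINT y:{0<..1}|lborel. F y) = (LINT x:{1..}|lborel. of_real (1 / x\<^sup>2) * F (1 / x))"
    by (rule integral_inverse_substitution[OF cF i1 i4])
  also have "\<dots> = (LINT x:{1..}|lborel. (- 1) powi j * (on_imag_axis f x * of_real x powr (of_int (2 * j) - s - 1)))"
    by (rule set_lebesgue_integral_cong) (use eq in auto)
  also have "\<dots> = (- 1) powi j * half_mellin f (of_int (2 * j) - s)"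
    unfolding half_mellin_def by (rule set_integral_mult_right)
  finally show ?thesis by (simp add: F_def half_mellin_def)
qed

text \<open>Using \<open>rGamma\<close> makes the right-hand side entire. It agrees with the
  Dirichlet series on the half-plane of convergence, and analytic continuation from there gives the
  uniqueness that the description operator in \<open>hecke_L\<close> asks for.\<close>

theorem hecke_L_formula:
  assumes f: "f \<in> cusp_forms (2 * j)" and j: "j \<ge> 0"
  shows "hecke_L (2 * j) f s = of_real (2 * pi) powr s * rGamma s *
    (half_mellin f s + (- 1) powi j * half_mellin f (of_int (2 * j) - s))"
proof -
  define L where "L s = of_real (2 * pi) powr s * rGamma s *
    (half_mellin f s + (- 1) powi j * half_mellin f (of_int (2 * j) - s))" for s :: complex
  define P where "P L \<longleftrightarrow> L holomorphic_on UNIV \<and> (\<forall>s. Re s > of_int (2 * j) / 2 + 1 \<longrightarrow>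
     (\<lambda>n. fourier_coeff f (Suc n) * of_nat (Suc n) powr (- s)) sums L s)" for L
  note hm = half_mellin_holomorphic[OF f]
  have "(\<lambda>s. half_mellin f (of_int (2 * j) - s)) holomorphic_on UNIV"
    by (rule holomorphic_on_compose[of "\<lambda>s. of_int (2 * j) - s" UNIV "half_mellin f", unfolded o_def])
      (auto intro!: holomorphic_intros holomorphic_on_subset[OF hm])
  hence hol: "L holomorphic_on UNIV" unfolding L_def[abs_def]
    by (intro holomorphic_intros hm) auto
  have "(\<lambda>n. fourier_coeff f (Suc n) * of_nat (Suc n) powr (- s)) sums L s"
    if s: "Re s > of_int (2 * j) / 2 + 1" for s
  proof -
    have j2: "2 * j \<ge> 0" using j by simp
    have s0: "Re s > 0" using s j by (smt (verit) divide_nonneg_nonneg of_int_nonneg)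
    have "s \<notin> \<int>\<^sub>\<le>\<^sub>0" using s0 by (auto elim!: nonpos_Ints_cases)
    hence G: "Gamma s * rGamma s = 1" by (simp add: Gamma_def rGamma_eq_zero_iff)
    have 1: "(\<lambda>n. of_real (2 * pi) powr s * rGamma s * (fourier_coeff f (Suc n) * (of_real (2 * pi * real (Suc n)) powr (- s) * Gamma s))) sums L s"
      unfolding L_def mellin_split[OF f cusp_form_mellin(1)[OF f j2 s], symmetric]
      by (rule sums_mult, rule cusp_form_mellin(2)[OF f j2 s])
    have "of_real (2 * pi) powr s * rGamma s * (fourier_coeff f (Suc n) * (of_real (2 * pi * real (Suc n)) powr (- s) * Gamma s))
        = fourier_coeff f (Suc n) * of_nat (Suc n) powr (- s)" for n
    proof -
      have a: "of_real (2 * pi * real (Suc n)) powr (- s) = of_real (2 * pi) powr (- s) * (of_nat (Suc n) powr (- s) :: complex)"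
        using powr_times_real[of "of_real (2 * pi)" "of_real (real (Suc n))" "- s"] by simp
      have b: "of_real (2 * pi) powr s * of_real (2 * pi) powr (- s) = (1 :: complex)"
        by (simp add: powr_add[symmetric])
      have "of_real (2 * pi) powr s * rGamma s * (fourier_coeff f (Suc n) * (of_real (2 * pi * real (Suc n)) powr (- s) * Gamma s)) =
         (of_real (2 * pi) powr s * of_real (2 * pi) powr (- s)) * (Gamma s * rGamma s) * (fourier_coeff f (Suc n) * of_nat (Suc n) powr (- s))"
        unfolding a by (simp only: mult_ac)
      thus ?thesis unfolding G b by simp
    qed
    thus ?thesis using 1 by (simp only:)
  qed
  hence PL: "P L" using hol by (auto simp: P_def)
  have unique: "L' = L" if "P L'" for L'
  proof
    fix z
    show "L' z = L z"
    proof (rule analytic_continuation_open[where f = L' and g = L and s = "{s. Re s > of_int (2 * j) / 2 + 1}" and s' = UNIV])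
      show "{s. Re s > of_int (2 * j) / 2 + 1} \<noteq> {}"
        by (auto intro!: exI[of _ "of_real (of_int (2 * j) / 2 + 2)"])
      show "open {s. Re s > of_int (2 * j) / 2 + 1}" by (rule open_halfspace_Re_gt)
      show "L' s = L s" if "s \<in> {s. Re s > of_int (2 * j) / 2 + 1}" for s
        using that \<open>P L'\<close> PL unfolding P_def by (auto intro: sums_unique2)
    qed (use \<open>P L'\<close> PL in \<open>auto simp: P_def\<close>)
  qed
  have "(THE L. P L) = L" using PL unique by (rule the_equality)
  thus ?thesis by (simp add: hecke_L_def P_def L_def)
qed

subsection \<open>Hecke operators\<close>

text \<open>The classical formula for the Fourier coefficients of the image under the
  \<open>n\<close>-th Hecke operator, as an operation on arbitrary sequences.\<close>

definition hecke_coeff :: "int \<Rightarrow> nat \<Rightarrow> (nat \<Rightarrow> complex) \<Rightarrow> nat \<Rightarrow> complex" where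
  "hecke_coeff k n a m = (\<Sum>e | e dvd n \<and> e dvd m. of_nat e powi (k - 1) * a (m * n div e\<^sup>2))"

lemma sum_roots_of_unity:
  assumes "d > 0"
  shows "(\<Sum>b<d. exp (2 * of_real pi * \<i> * of_nat (m * b) / of_nat d)) = (if d dvd m then of_nat d else (0::complex))"
proof -
  define z :: complex where "z = exp (2 * of_real pi * \<i> * of_nat m / of_nat d)"
  have z1: "z = 1 \<longleftrightarrow> d dvd m"
    using complex_root_unity_eq_1[of d m] assms by (simp add: z_def)
  have zd: "z ^ d = 1" using complex_root_unity[of d m] assms by (simp add: z_def)
  have e: "exp (2 * of_real pi * \<i> * of_nat (m * b) / of_nat d) = z ^ b" for b
    unfolding z_def exp_of_nat_mult[symmetric] by (simp add: field_simps)
  show ?thesis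
  proof (cases "z = 1")
    case True
    thus ?thesis using z1 by (simp only: e) simp
  next
    case False
    have "(\<Sum>b<d. z ^ b) = 0" using False zd by (simp add: geometric_sum)
    thus ?thesis using z1 False by (simp only: e) simp
  qed
qed

lemma hecke_arg_in_upper:
  assumes "t \<in> upper_half_plane" "e > 0" "d > 0"
  shows "(of_nat e * t + of_nat b) / of_nat d \<in> upper_half_plane"
proof -
  have "Im ((of_nat e * t + of_nat b) / of_nat d) = real e * Im t / real d"
    using Im_divide_of_real[of "of_nat e * t + of_nat b" "real d"] by simp
  thus ?thesis using assms by (simp add: upper_half_plane_def)
qed

text \<open>For each divisor \<open>d\<close> the sum over \<open>b\<close> is a sum of roots of
  unity, which keeps only the exponents divisible by \<open>d\<close>; the exponent
  \<open>d * r\<close> of the old expansion becomes \<open>(n div d) * r\<close> in the new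
  one.\<close>

lemma hecke_q_expansion:
  assumes q: "q_expansion f a" and n: "n > 0"
  shows "q_expansion (hecke_operator k n f) (hecke_coeff k n a)"
  unfolding q_expansion_nome
proof
  fix t assume t: "t \<in> upper_half_plane"
  define S where "S d = (\<Sum>b<d. f ((of_nat (n div d) * t + of_nat b) / of_nat d))" for d
  \<comment> \<open>The contribution of the divisor \<open>d\<close>, indexed by the resulting
    exponent of \<open>q\<close>, with zeros between the multiples of
    \<open>n div d\<close>.\<close>
  define H where "H d s = (if n div d dvd s then of_nat d * a (d * (s div (n div d))) * nome t ^ s else 0)" for d s
  have HS: "H d sums S d" if d: "d dvd n" for d
  proof -
    define e where "e = n div d"
    have n_eq: "n = d * e" using d by (simp add: e_def)
    have pos: "d > 0" "e > 0" using n n_eq by auto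
    define h where "h m = a m * exp (2 * of_real pi * \<i> * (of_nat m * of_nat e * t / of_nat d)) * (if d dvd m then of_nat d else 0)" for m
    have "(\<lambda>m. \<Sum>b<d. a m * nome ((of_nat e * t + of_nat b) / of_nat d) ^ m) sums S d"
      unfolding S_def e_def[symmetric]
      by (rule sums_sum) (use q hecke_arg_in_upper[OF t pos(2,1)] in \<open>auto simp: q_expansion_nome\<close>)
    moreover have "(\<Sum>b<d. a m * nome ((of_nat e * t + of_nat b) / of_nat d) ^ m) = h m" for m
    proof -
      have "nome ((of_nat e * t + of_nat b) / of_nat d) ^ m =
         exp (2 * of_real pi * \<i> * (of_nat m * of_nat e * t / of_nat d)) * exp (2 * of_real pi * \<i> * of_nat (m * b) / of_nat d)" for b
        unfolding nome_power[symmetric] exp_add[symmetric] using pos by (simp add: field_simps)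
      hence "(\<Sum>b<d. a m * nome ((of_nat e * t + of_nat b) / of_nat d) ^ m) =
         a m * exp (2 * of_real pi * \<i> * (of_nat m * of_nat e * t / of_nat d)) * (\<Sum>b<d. exp (2 * of_real pi * \<i> * of_nat (m * b) / of_nat d))"
        by (simp only: sum_distrib_left mult.assoc)
      thus ?thesis unfolding sum_roots_of_unity[OF pos(1)] h_def .
    qed
    ultimately have "h sums S d" by simp
    hence "(\<lambda>r. h (d * r)) sums S d"
      by (subst sums_mono_reindex) (use pos in \<open>auto simp: strict_mono_def h_def dvd_def image_def\<close>)
    moreover have "h (d * r) = H d (e * r)" for r
    proof -
      have "2 * of_real pi * \<i> * (of_nat (d * r) * of_nat e * t / of_nat d) = 2 * of_real pi * \<i> * of_nat (e * r) * t"
        using pos by simp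
      hence "exp (2 * of_real pi * \<i> * (of_nat (d * r) * of_nat e * t / of_nat d)) = nome t ^ (e * r)"
        by (simp only: nome_power)
      thus ?thesis using pos unfolding h_def H_def e_def[symmetric] by (simp del: of_nat_mult)
    qed
    ultimately have "(\<lambda>r. H d (e * r)) sums S d" by simp
    thus ?thesis
      by (subst (asm) sums_mono_reindex) (use pos in \<open>auto simp: strict_mono_def H_def e_def[symmetric] dvd_def image_def\<close>)
  qed
  have fin: "finite {d. d dvd n}" using n by simp
  have op: "hecke_operator k n f t = (\<Sum>d | d dvd n. of_nat n powi (k - 1) * of_nat d powi (- k) * S d)"
    using t by (simp add: hecke_operator_def S_def sum_distrib_left mult.assoc)
  have "(\<lambda>s. \<Sum>d | d dvd n. of_nat n powi (k - 1) * of_nat d powi (- k) * H d s) sums hecke_operator k n f t"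
    unfolding op by (intro sums_sum sums_mult HS) auto
  moreover have "(\<Sum>d | d dvd n. of_nat n powi (k - 1) * of_nat d powi (- k) * H d s) = hecke_coeff k n a s * nome t ^ s" for s
  proof -
    define g where "g e = (if e dvd s then of_nat e powi (k - 1) * a (s * n div e\<^sup>2) * nome t ^ s else 0)" for e
    have "of_nat n powi (k - 1) * of_nat d powi (- k) * H d s = g (n div d)" if d: "d dvd n" for d
    proof -
      define e where "e = n div d"
      have n_eq: "n = d * e" using d by (simp add: e_def)
      have pos: "d > 0" "e > 0" using n n_eq by auto
      show ?thesis
      proof (cases "e dvd s")
        case True
        then obtain r where r: "s = e * r" by blast
        have 1: "d * (s div e) = s * n div e\<^sup>2" using pos by (simp add: r n_eq power2_eq_square)
        have "(of_nat n :: complex) powi (k - 1) * of_nat d powi (- k) * of_nat d = of_nat e powi (k - 1)"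
          using pos by (simp add: n_eq power_int_mult_distrib power_int_minus power_int_diff field_simps)
        hence 2: "(of_nat n :: complex) powi (k - 1) * (of_nat d powi (- k) * (of_nat d * z)) = of_nat e powi (k - 1) * z" for z
          by (simp only: mult.assoc[symmetric])
        show ?thesis using True unfolding H_def g_def e_def[symmetric] 1
          by (simp add: mult.assoc 2)
      next
        case False thus ?thesis by (simp add: H_def g_def e_def[symmetric])
      qed
    qed
    hence "(\<Sum>d | d dvd n. of_nat n powi (k - 1) * of_nat d powi (- k) * H d s) = (\<Sum>d | d dvd n. g (n div d))"
      by (intro sum.cong) auto
    also have "\<dots> = (\<Sum>e | e dvd n. g e)"
      by (rule sum.reindex_bij_witness[of _ "\<lambda>e. n div e" "\<lambda>e. n div e"]) (use n in auto)
    also have "\<dots> = (\<Sum>e | e dvd n \<and> e dvd s. of_nat e powi (k - 1) * a (s * n div e\<^sup>2) * nome t ^ s)"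
      by (rule sum.mono_neutral_cong_right) (use fin in \<open>auto simp: g_def\<close>)
    finally show ?thesis by (simp add: hecke_coeff_def sum_distrib_right)
  qed
  ultimately show "(\<lambda>s. hecke_coeff k n a s * nome t ^ s) sums hecke_operator k n f t" by simp
qed

lemma hecke_coeff_1 [simp]: "hecke_coeff k (Suc 0) a = a"
proof
  fix m
  have "{e. e dvd Suc 0 \<and> e dvd m} = {1}" by auto
  thus "hecke_coeff k (Suc 0) a m = a m" by (simp add: hecke_coeff_def)
qed

lemma hecke_coeff_at_0: "n > 0 \<Longrightarrow> a 0 = 0 \<Longrightarrow> hecke_coeff k n a 0 = 0"
  by (simp add: hecke_coeff_def)

lemma hecke_coeff_prime:
  assumes p: "prime p"
  shows "hecke_coeff k p b m = b (p * m) + (if p dvd m then of_nat p powi (k - 1) * b (m div p) else 0)"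
proof -
  have p0: "p > 1" using p by (rule prime_gt_1_nat)
  show ?thesis
  proof (cases "p dvd m")
    case True
    then obtain r where r: "m = p * r" by blast
    have "{e. e dvd p \<and> e dvd m} = {1, p}" using p r by (auto simp: prime_nat_iff)
    thus ?thesis using p0 True by (simp add: hecke_coeff_def r power2_eq_square mult_ac)
  next
    case False
    have "{e. e dvd p \<and> e dvd m} = {1}" using p False by (auto simp: prime_nat_iff)
    thus ?thesis using False by (simp add: hecke_coeff_def mult_ac)
  qed
qed

text \<open>All four terms are sums of the same function \<open>g\<close>, over sets of divisors.
  The subsets \<open>W\<close> of \<open>X\<close> and \<open>Y\<close> of \<open>Z\<close> consist
  of the members divisible by \<open>p\<close>; for the other members a factor \<open>p\<close> is
  irrelevant to divisibility, so \<open>X - W = Z - Y\<close>.\<close>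

lemma hecke_coeff_prime_mult:
  assumes p: "prime p" and n: "n > 0"
  shows "hecke_coeff k p (hecke_coeff k n a) m =
    hecke_coeff k (p * n) a m + (if p dvd n then of_nat p powi (k - 1) * hecke_coeff k (n div p) a m else 0)"
proof -
  have p0: "p > 0" using p by (simp add: prime_gt_0_nat)
  define g where "g e = of_nat e powi (k - 1) * a (p * m * n div e\<^sup>2)" for e
  define X where "X = {e. e dvd n \<and> e dvd p * m}"
  define Y where "Y = {e. e dvd p * n \<and> e dvd m \<and> p dvd e}"
  define Z where "Z = {e. e dvd p * n \<and> e dvd m}"
  define W where "W = {e. e dvd n \<and> e dvd p * m \<and> p dvd e}"
  have fin: "finite X" "finite Z"
    using n p0 by (auto simp: X_def Z_def intro: finite_subset[of _ "{e. e dvd n}"] finite_subset[of _ "{e. e dvd p * n}"])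
  have scale: "of_nat p powi (k - 1) * (of_nat d powi (k - 1) * a x) = g (p * d)" if "x = p * m * n div (p * d)\<^sup>2" for d x
    using that by (simp add: g_def power_int_mult_distrib)
  have 1: "hecke_coeff k n a (p * m) = sum g X"
    by (simp add: hecke_coeff_def X_def g_def)
  have 2: "(if p dvd m then of_nat p powi (k - 1) * hecke_coeff k n a (m div p) else 0) = sum g Y"
  proof (cases "p dvd m")
    case True
    then obtain r where r: "m = p * r" by blast
    have "of_nat p powi (k - 1) * hecke_coeff k n a (m div p) =
       (\<Sum>d | d dvd n \<and> d dvd m div p. of_nat p powi (k - 1) * (of_nat d powi (k - 1) * a (m div p * n div d\<^sup>2)))"
      by (simp add: hecke_coeff_def sum_distrib_left)
    also have "\<dots> = (\<Sum>d | d dvd n \<and> d dvd m div p. g (p * d))"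
    proof (rule sum.cong[OF refl], rule scale)
      fix d
      have "p * m * n div (p * d)\<^sup>2 = p\<^sup>2 * (r * n) div (p\<^sup>2 * d\<^sup>2)" by (simp add: r power2_eq_square mult_ac)
      also have "\<dots> = r * n div d\<^sup>2" using p0 by (subst div_mult_mult1) auto
      finally show "m div p * n div d\<^sup>2 = p * m * n div (p * d)\<^sup>2" using p0 by (simp add: r)
    qed
    also have "\<dots> = sum g Y"
      by (rule sum.reindex_bij_witness[of _ "\<lambda>e. e div p" "\<lambda>d. p * d"]) (use p0 in \<open>auto simp: Y_def r\<close>)
    finally show ?thesis using True by simp
  next
    case False
    hence "Y = {}" using dvd_trans by (auto simp: Y_def)
    thus ?thesis using False by simp
  qed
  have 3: "hecke_coeff k (p * n) a m = sum g Z"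
    by (simp add: hecke_coeff_def Z_def g_def mult_ac)
  have 4: "(if p dvd n then of_nat p powi (k - 1) * hecke_coeff k (n div p) a m else 0) = sum g W"
  proof (cases "p dvd n")
    case True
    then obtain r where r: "n = p * r" by blast
    have "of_nat p powi (k - 1) * hecke_coeff k (n div p) a m =
       (\<Sum>d | d dvd n div p \<and> d dvd m. of_nat p powi (k - 1) * (of_nat d powi (k - 1) * a (m * (n div p) div d\<^sup>2)))"
      by (simp add: hecke_coeff_def sum_distrib_left)
    also have "\<dots> = (\<Sum>d | d dvd n div p \<and> d dvd m. g (p * d))"
    proof (rule sum.cong[OF refl], rule scale)
      fix d
      have "p * m * n div (p * d)\<^sup>2 = p\<^sup>2 * (m * r) div (p\<^sup>2 * d\<^sup>2)" by (simp add: r power2_eq_square mult_ac)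
      also have "\<dots> = m * r div d\<^sup>2" using p0 by (subst div_mult_mult1) auto
      finally show "m * (n div p) div d\<^sup>2 = p * m * n div (p * d)\<^sup>2" using p0 by (simp add: r)
    qed
    also have "\<dots> = sum g W"
      by (rule sum.reindex_bij_witness[of _ "\<lambda>e. e div p" "\<lambda>d. p * d"]) (use p0 in \<open>auto simp: W_def r\<close>)
    finally show ?thesis using True by simp
  next
    case False
    hence "W = {}" using dvd_trans by (auto simp: W_def)
    thus ?thesis using False by simp
  qed
  have XW: "X - W = Z - Y"
  proof (rule set_eqI)
    fix e
    have "e dvd p * x \<longleftrightarrow> e dvd x" if "\<not> p dvd e" for x
      using that p by (metis coprime_commute coprime_dvd_mult_right_iff prime_imp_coprime)
    thus "e \<in> X - W \<longleftrightarrow> e \<in> Z - Y" by (auto simp: X_def W_def Y_def Z_def)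
  qed
  have "W \<subseteq> X" "Y \<subseteq> Z" by (auto simp: X_def W_def Z_def Y_def)
  hence "sum g X = sum g (X - W) + sum g W" "sum g Z = sum g (Z - Y) + sum g Y"
    using fin by (auto intro: sum.subset_diff)
  hence "sum g X + sum g Y = sum g Z + sum g W" by (simp add: XW)
  thus ?thesis unfolding hecke_coeff_prime[OF p] 1 2 3 4 .
qed

text \<open>For distinct primes the correction term is absent, and both sides are the operator of
  index \<open>p * q\<close>.\<close>

lemma hecke_coeff_commute:
  assumes "prime p" "prime q"
  shows "hecke_coeff k p (hecke_coeff k q a) = hecke_coeff k q (hecke_coeff k p a)"
proof (cases "p = q")
  case False
  hence "\<not> p dvd q" "\<not> q dvd p" using assms primes_dvd_imp_eq by blast+
  thus ?thesis using hecke_coeff_prime_mult[of p q k a] hecke_coeff_prime_mult[of q p k a] assms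
    by (auto simp: fun_eq_iff prime_gt_0_nat mult.commute)
qed simp

text \<open>With \<open>n = p * r\<close> the recursion expresses the \<open>n\<close>-th operator
  through those of index \<open>p\<close>, \<open>r\<close> and \<open>r div p\<close>, all handled
  by induction or by assumption.\<close>

lemma hecke_coeff_eigen:
  assumes ev: "\<And>p. prime p \<Longrightarrow> \<exists>c. \<forall>m. hecke_coeff k p a m = c * a m" and n: "n > 0"
  shows "\<exists>c. \<forall>m. hecke_coeff k n a m = c * a m"
  using n
proof (induction n rule: less_induct)
  case (less n)
  show ?case
  proof (cases "n = 1")
    case True thus ?thesis by (intro exI[of _ 1]) simp
  next
    case False
    obtain p where p: "prime p" "p dvd n" using prime_factor_nat[OF False] by blast
    then obtain r where r: "n = p * r" by blast
    have r0: "r > 0" "p > 1" using less.prems r prime_gt_1_nat[OF p(1)] by auto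
    obtain c where c: "\<And>m. hecke_coeff k r a m = c * a m" using less.IH[of r] r r0 by auto
    obtain c' where c': "\<And>m. hecke_coeff k p a m = c' * a m" using ev[OF p(1)] by blast
    have "\<exists>c''. \<forall>m. (if p dvd r then of_nat p powi (k - 1) * hecke_coeff k (r div p) a m else 0) = c'' * a m"
    proof (cases "p dvd r")
      case True
      then obtain r' where r': "r = p * r'" by blast
      have "r div p < n" "r div p > 0"
        using r r' r0 less_1_mult[of p p] by auto
      then obtain c'' where "\<And>m. hecke_coeff k (r div p) a m = c'' * a m" using less.IH[of "r div p"] by auto
      thus ?thesis using True by (intro exI[of _ "of_nat p powi (k - 1) * c''"]) simp
    qed (auto intro!: exI[of _ 0])
    then obtain c'' where c'': "\<And>m. (if p dvd r then of_nat p powi (k - 1) * hecke_coeff k (r div p) a m else 0) = c'' * a m"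
      by blast
    have "hecke_coeff k n a m = (c * c' - c'') * a m" for m
    proof -
      have "hecke_coeff k p (hecke_coeff k r a) m = c * hecke_coeff k p a m"
        unfolding c[abs_def] by (simp add: hecke_coeff_def sum_distrib_left mult_ac)
      thus ?thesis using hecke_coeff_prime_mult[OF p(1) r0(1), of k a m]
        unfolding c'' c' r by (simp add: algebra_simps)
    qed
    thus ?thesis by blast
  qed
qed

section \<open>Integral matrices of determinant \<open>n\<close> modulo SL(2,Z)\<close>

definition hecke_reps :: "nat \<Rightarrow> mat2 set" where
  "hecke_reps n = (\<lambda>(d, b). (int (n div d), int b, 0, int d)) ` Sigma {d. d dvd n} (\<lambda>d. {..<d})"

lemma mem_hecke_reps:
  assumes "n > 0"
  shows "(a, b, c, d) \<in> hecke_reps n \<longleftrightarrow> c = 0 \<and> a > 0 \<and> a * d = int n \<and> 0 \<le> b \<and> b < d"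
proof
  assume "(a, b, c, d) \<in> hecke_reps n"
  thus "c = 0 \<and> a > 0 \<and> a * d = int n \<and> 0 \<le> b \<and> b < d"
    using assms by (auto simp: hecke_reps_def dvd_div_eq_0_iff[symmetric] simp flip: of_nat_mult intro: Nat.gr0I)
next
  assume h: "c = 0 \<and> a > 0 \<and> a * d = int n \<and> 0 \<le> b \<and> b < d"
  define a' d' b' where "a' = nat a" and "d' = nat d" and "b' = nat b"
  have e: "a = int a'" "d = int d'" "b = int b'" using h by (auto simp: a'_def d'_def b'_def)
  have n: "n = a' * d'" using h unfolding e by (metis of_nat_eq_iff of_nat_mult)
  have "d' > 0" using h e by auto
  thus "(a, b, c, d) \<in> hecke_reps n"
    unfolding hecke_reps_def using h e n by (intro image_eqI[of _ _ "(d', b')"]) auto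
qed

lemma finite_hecke_reps [simp]: "n > 0 \<Longrightarrow> finite (hecke_reps n)"
  by (auto simp: hecke_reps_def)

lemma mat_det_hecke_reps: "n > 0 \<Longrightarrow> r \<in> hecke_reps n \<Longrightarrow> mat_det r = int n"
  by (cases r) (auto simp: mem_hecke_reps)

text \<open>Multiplication from the left by \<open>(u, v, - c', a')\<close>, built from the Bezout
  relation of the first column, gives \<open>(h, w, 0, e)\<close>. A further shear reduces
  \<open>w\<close> modulo \<open>e\<close>, and \<open>g\<close> is the inverse of the combined
  matrix.\<close>

lemma hermite_normal_form:
  assumes n: "n > 0" and M: "mat_det M = int n"
  shows "\<exists>g r. mat_det g = 1 \<and> r \<in> hecke_reps n \<and> M = mat_mult g r"
proof -
  obtain a b c d where MM: "M = (a, b, c, d)" by (cases M)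
  have det: "a * d - b * c = int n" using M MM by simp
  define h where "h = gcd a c"
  have "a \<noteq> 0 \<or> c \<noteq> 0" using det n by auto
  hence h: "h > 0" unfolding h_def by (metis gcd_eq_0_iff gcd_ge_0_int order_le_less)
  obtain u v where uv: "u * a + v * c = h" using bezout_int[of a c] unfolding h_def by blast
  obtain a' c' where ac: "a = h * a'" "c = h * c'" unfolding h_def by (metis dvdE gcd_dvd1 gcd_dvd2)
  have "h * (u * a' + v * c') = h * 1" using uv by (simp add: ac algebra_simps)
  hence uv': "u * a' + v * c' = 1" using h by (metis mult_cancel_left less_irrefl)
  define e where "e = a' * d - c' * b"
  have he: "h * e = int n" using det by (simp add: e_def ac algebra_simps)
  have e: "e > 0" using he h n by (metis of_nat_0_less_iff zero_less_mult_pos)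
  define w where "w = u * b + v * d"
  define m where "m = w div e"
  have b: "b = a' * w - v * e"
  proof -
    have "a' * w - v * e = (u * a' + v * c') * b" by (simp add: w_def e_def algebra_simps)
    thus ?thesis by (simp add: uv')
  qed
  have d: "d = c' * w + u * e"
  proof -
    have "c' * w + u * e = (u * a' + v * c') * d" by (simp add: w_def e_def algebra_simps)
    thus ?thesis by (simp add: uv')
  qed
  have w: "w = w mod e + m * e" by (simp add: m_def)
  have "M = mat_mult (a', a' * m - v, c', c' * m + u) (h, w mod e, 0, e)"
  proof -
    have "b = a' * (w mod e + m * e) - v * e" using b w by metis
    moreover have "d = c' * (w mod e + m * e) + u * e" using d w by metis
    ultimately show ?thesis by (simp add: MM ac algebra_simps)
  qed
  moreover have "mat_det (a', a' * m - v, c', c' * m + u) = 1" using uv' by (simp add: algebra_simps)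
  moreover have "(h, w mod e, 0, e) \<in> hecke_reps n" using h e he by (simp add: mem_hecke_reps[OF n])
  ultimately show ?thesis by blast
qed

lemma hermite_normal_form_unique:
  assumes n: "n > 0" and r: "r \<in> hecke_reps n" "r' \<in> hecke_reps n"
    and g: "mat_det g = 1" and eq: "mat_mult g r = r'"
  shows "g = (1, 0, 0, 1) \<and> r = r'"
proof -
  obtain x y z w where gg: "g = (x, y, z, w)" by (cases g)
  obtain a b c d where rr: "r = (a, b, c, d)" by (cases r)
  obtain a' b' c' d' where rr': "r' = (a', b', c', d')" by (cases r')
  have 1: "c = 0" "a > 0" "a * d = int n" "0 \<le> b" "b < d" using r(1) by (auto simp: rr mem_hecke_reps[OF n])
  have 2: "c' = 0" "a' > 0" "a' * d' = int n" "0 \<le> b'" "b' < d'" using r(2) by (auto simp: rr' mem_hecke_reps[OF n])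
  have e: "x * a = a'" "x * b + y * d = b'" "z * a = 0" "z * b + w * d = d'"
    using eq by (auto simp: gg rr rr' 1(1) 2(1))
  have z: "z = 0" using e(3) 1(2) by simp
  have "x > 0" using e(1) 1(2) 2(2) by (metis zero_less_mult_pos2)
  moreover have "x * w = 1" using g by (simp add: gg z)
  ultimately have xw: "x = 1" "w = 1" by (auto simp: zmult_eq_1_iff)
  have dd: "d = d'" using e(4) z xw by simp
  have "y * d = b' - b" using e(2) xw by simp
  hence "\<bar>y * d\<bar> < d" using 1 2 dd by auto
  hence "y = 0" using 1(4,5) by (auto simp: abs_mult mult_less_cancel_right2 zero_less_abs_iff)
  thus ?thesis using e z xw dd by (simp add: gg rr rr' 1(1) 2(1))
qed

lemma hermite_normal_form_unique':
  assumes n: "n > 0" and r: "r \<in> hecke_reps n" "r' \<in> hecke_reps n"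
    and g: "mat_det g = 1" "mat_det g' = 1" and eq: "mat_mult g r = mat_mult g' r'"
  shows "g = g' \<and> r = r'"
proof -
  have "mat_mult (mat_mult (mat_adj g') g) r = mat_mult (mat_mult (mat_adj g') g') r'"
    unfolding mat_mult_assoc eq ..
  hence "mat_mult (mat_mult (mat_adj g') g) r = r'" by (simp add: mat_mult_adj g)
  hence 1: "mat_mult (mat_adj g') g = (1, 0, 0, 1) \<and> r = r'"
    by (intro hermite_normal_form_unique[OF n r]) (auto simp: mat_det_mult g)
  have "g = mat_mult (mat_mult g' (mat_adj g')) g" by (simp add: mat_mult_adj g)
  also have "\<dots> = g'" using 1 by (simp add: mat_mult_assoc)
  finally show ?thesis using 1 by simp
qed

text \<open>The representative with lower right entry \<open>d\<close> multiplies the second basis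
  vector by \<open>d\<close>, and homogeneity then produces the factor \<open>d powi (- k)\<close>
  of the definition.\<close>

lemma lift_hecke_operator:
  assumes n: "n > 0" and w: "area w > 0"
  shows "lift k (hecke_operator k n f) w = of_nat n powi (k - 1) * (\<Sum>r\<in>hecke_reps n. lift k f (act r w))"
proof -
  obtain u v where ww: "w = (u, v)" by (cases w)
  have v: "v \<noteq> 0" using area_pos_nonzero[OF w] ww by simp
  have H: "u / v \<in> upper_half_plane" using quotient_in_upper[OF w] ww by simp
  have term_eq: "lift k f (act (int (n div d), int b, 0, int d) w) =
      v powi (- k) * (of_nat d powi (- k) * f ((of_nat (n div d) * (u / v) + of_nat b) / of_nat d))"
    if "d > 0" for d b
  proof -
    have "(of_nat (n div d) * u + of_nat b * v) / (of_nat d * v) = (of_nat (n div d) * (u / v) + of_nat b) / of_nat d"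
      using v that by (simp add: field_simps)
    thus ?thesis by (simp add: lift_def ww power_int_mult_distrib)
  qed
  have inj: "inj_on (\<lambda>(d, b). (int (n div d), int b, 0 :: int, int d)) (Sigma {d. d dvd n} (\<lambda>d. {..<d}))"
    by (auto simp: inj_on_def)
  have "(\<Sum>r\<in>hecke_reps n. lift k f (act r w)) =
     (\<Sum>(d, b)\<in>Sigma {d. d dvd n} (\<lambda>d. {..<d}). lift k f (act (int (n div d), int b, 0, int d) w))"
    unfolding hecke_reps_def sum.reindex[OF inj] by (simp add: case_prod_unfold)
  also have "\<dots> = (\<Sum>d | d dvd n. \<Sum>b<d. lift k f (act (int (n div d), int b, 0, int d) w))"
    by (rule sum.Sigma[symmetric]) (use n in auto)
  also have "\<dots> = (\<Sum>d | d dvd n. \<Sum>b<d. v powi (- k) * (of_nat d powi (- k) * f ((of_nat (n div d) * (u / v) + of_nat b) / of_nat d)))"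
    by (intro sum.cong refl term_eq) (use n in \<open>auto intro: Nat.gr0I\<close>)
  finally show ?thesis using H
    by (simp add: lift_def ww hecke_operator_def sum_distrib_left mult_ac)
qed

text \<open>Right multiplication by \<open>g\<close> permutes the cosets:
  \<open>r g = g' (s r)\<close> with \<open>g'\<close> in SL(2,Z), to which \<open>lift k f\<close>
  is insensitive, so that only a permutation of the summands remains.\<close>

lemma lift_hecke_operator_invariant:
  assumes f: "f \<in> cusp_forms k" and n: "n > 0" and w: "area w > 0" and g: "mat_det g = 1"
  shows "lift k (hecke_operator k n f) (act g w) = lift k (hecke_operator k n f) w"
proof -
  have ex: "\<exists>r'. r' \<in> hecke_reps n \<and> (\<exists>g'. mat_det g' = 1 \<and> mat_mult r g = mat_mult g' r')"
    if "r \<in> hecke_reps n" for r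
  proof -
    have "mat_det (mat_mult r g) = int n" using mat_det_hecke_reps[OF n that] g by (simp add: mat_det_mult)
    thus ?thesis using hermite_normal_form[OF n] by blast
  qed
  define s where "s r = (SOME r'. r' \<in> hecke_reps n \<and> (\<exists>g'. mat_det g' = 1 \<and> mat_mult r g = mat_mult g' r'))" for r
  have s: "s r \<in> hecke_reps n" "\<exists>g'. mat_det g' = 1 \<and> mat_mult r g = mat_mult g' (s r)"
    if "r \<in> hecke_reps n" for r
    using someI_ex[OF ex[OF that]] unfolding s_def by blast+
  have "inj_on s (hecke_reps n)"
  proof
    fix r1 r2 assume r: "r1 \<in> hecke_reps n" "r2 \<in> hecke_reps n" "s r1 = s r2"
    obtain g1 g2 where g12: "mat_det g1 = 1" "mat_mult r1 g = mat_mult g1 (s r1)"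
      "mat_det g2 = 1" "mat_mult r2 g = mat_mult g2 (s r1)" using s(2)[OF r(1)] s(2)[OF r(2)] r(3) by auto
    have gi: "mat_mult g (mat_adj g) = (1, 0, 0, 1)" by (simp add: mat_mult_adj g)
    have "r1 = mat_mult g1 (mat_mult (s r1) (mat_adj g))"
      by (metis gi g12(2) mat_mult_assoc mat_mult_one(2))
    moreover have "r2 = mat_mult g2 (mat_mult (s r1) (mat_adj g))"
      by (metis gi g12(4) mat_mult_assoc mat_mult_one(2))
    ultimately have "mat_mult (mat_adj g1) r1 = mat_mult (mat_adj g2) r2"
      by (metis mat_mult_adj(1) g12(1,3) mat_mult_assoc mat_mult_one(1))
    thus "r1 = r2"
      using hermite_normal_form_unique'[OF n r(1,2), of "mat_adj g1" "mat_adj g2"] g12 by simp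
  qed
  moreover have "s ` hecke_reps n \<subseteq> hecke_reps n" using s by blast
  ultimately have bij: "bij_betw s (hecke_reps n) (hecke_reps n)"
    using finite_hecke_reps[OF n] by (simp add: bij_betw_def endo_inj_surj)
  have aw: "area (act g w) > 0" using w g by (simp add: area_act)
  have "(\<Sum>r\<in>hecke_reps n. lift k f (act r (act g w))) = (\<Sum>r\<in>hecke_reps n. lift k f (act (s r) w))"
  proof (rule sum.cong[OF refl])
    fix r assume r: "r \<in> hecke_reps n"
    obtain g' where g': "mat_det g' = 1" "mat_mult r g = mat_mult g' (s r)" using s(2)[OF r] by blast
    have "act r (act g w) = act g' (act (s r) w)" by (simp only: act_mat_mult[symmetric] g'(2))
    moreover have "area (act (s r) w) > 0" using w n mat_det_hecke_reps[OF n s(1)[OF r]] by (simp add: area_act)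
    ultimately show "lift k f (act r (act g w)) = lift k f (act (s r) w)" by (simp add: lift_act[OF f g'(1)])
  qed
  also have "\<dots> = (\<Sum>r\<in>hecke_reps n. lift k f (act r w))"
    by (rule sum.reindex_bij_betw[OF bij])
  finally show ?thesis by (simp add: lift_hecke_operator[OF n w] lift_hecke_operator[OF n aw])
qed

lemma open_upper_half_plane: "open upper_half_plane"
  by (simp add: upper_half_plane_def open_halfspace_Im_gt)

lemma hecke_operator_cusp_form:
  assumes f: "f \<in> cusp_forms k" and n: "n > 0"
  shows "hecke_operator k n f \<in> cusp_forms k"
proof -
  define F where "F = hecke_operator k n f"
  have hf: "f holomorphic_on upper_half_plane" using f by (simp add: cusp_forms_def)
  have "(\<lambda>t. of_nat n powi (k - 1) * (\<Sum>d | d dvd n. \<Sum>b<d. of_nat d powi (- k) *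
      f ((of_nat (n div d) * t + of_nat b) / of_nat d))) holomorphic_on upper_half_plane"
  proof (intro holomorphic_intros)
    fix d b assume d: "d \<in> {d. d dvd n}" "b \<in> {..<d}"
    hence pos: "d > 0" "n div d > 0" using n by (auto intro!: Nat.gr0I simp: dvd_div_eq_0_iff)
    show "(\<lambda>t. f ((of_nat (n div d) * t + of_nat b) / of_nat d)) holomorphic_on upper_half_plane"
      by (rule holomorphic_on_compose_gen[OF _ hf, unfolded o_def])
        (use pos hecke_arg_in_upper in \<open>auto intro!: holomorphic_intros\<close>)
  qed
  hence hol: "F holomorphic_on upper_half_plane"
    by (rule holomorphic_transform) (simp add: F_def hecke_operator_def)
  have out: "F t = 0" if "t \<notin> upper_half_plane" for t
    using that by (simp add: F_def hecke_operator_def)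
  have mod: "F ((of_int a * t + of_int b) / (of_int c * t + of_int d)) = (of_int c * t + of_int d) powi k * F t"
    if det: "a * d - b * c = 1" and t: "t \<in> upper_half_plane" for a b c d :: int and t
  proof -
    have w: "area (t, 1) > 0" using t by (simp add: area_def upper_half_plane_def)
    have g: "mat_det (a, b, c, d) = 1" using det by simp
    have "area (act (a, b, c, d) (t, 1)) > 0" using w g by (simp add: area_act del: act.simps mat_det.simps)
    hence nz: "of_int c * t + of_int d \<noteq> 0" using area_pos_nonzero(2) by fastforce
    \<comment> \<open>At the basis \<open>(t, 1)\<close> invariance of the lift is the
      transformation law of weight \<open>k\<close>.\<close>
    have "lift k F (act (a, b, c, d) (t, 1)) = lift k F (t, 1)"
      unfolding F_def by (rule lift_hecke_operator_invariant[OF f n w g])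
    thus ?thesis using nz by (simp add: lift_def power_int_minus field_simps)
  qed
  have "q_expansion F (hecke_coeff k n (fourier_coeff f))"
    unfolding F_def by (rule hecke_q_expansion[OF cusp_form_q_expansion(1)[OF f] n])
  moreover have "hecke_coeff k n (fourier_coeff f) 0 = 0"
    using hecke_coeff_at_0[OF n] cusp_form_q_expansion(2)[OF f] by blast
  ultimately have "\<exists>a. q_expansion F a \<and> a 0 = 0" by blast
  thus ?thesis using hol out mod unfolding F_def[symmetric] cusp_forms_def by blast
qed

lemma fourier_coeff_hecke:
  assumes "f \<in> cusp_forms k" "n > 0"
  shows "fourier_coeff (hecke_operator k n f) = hecke_coeff k n (fourier_coeff f)"
  by (rule fourier_coeff_eq, rule hecke_q_expansion[OF cusp_form_q_expansion(1)[OF assms(1)] assms(2)])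

lemma cusp_form_eqI:
  assumes f: "f \<in> cusp_forms k" and g: "g \<in> cusp_forms k" and eq: "fourier_coeff f = fourier_coeff g"
  shows "f = g"
proof
  fix t
  show "f t = g t"
  proof (cases "t \<in> upper_half_plane")
    case True
    thus ?thesis using cusp_form_q_expansion(1)[OF f] cusp_form_q_expansion(1)[OF g]
      unfolding eq q_expansion_nome by (auto intro: sums_unique2)
  next
    case False
    thus ?thesis using f g by (simp add: cusp_form_outside)
  qed
qed

lemma hecke_operator_commute:
  assumes f: "f \<in> cusp_forms k" and p: "prime p" "prime q"
  shows "hecke_operator k p (hecke_operator k q f) = hecke_operator k q (hecke_operator k p f)"
proof -
  have pq: "p > 0" "q > 0" using p by (auto simp: prime_gt_0_nat)
  show ?thesis
    by (rule cusp_form_eqI[of _ k])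
      (simp_all add: hecke_operator_cusp_form f pq fourier_coeff_hecke hecke_coeff_commute[OF p])
qed

lemma cusp_forms_add:
  assumes f: "f \<in> cusp_forms k" and g: "g \<in> cusp_forms k"
  shows "(\<lambda>t. f t + g t) \<in> cusp_forms k"
proof -
  have "q_expansion (\<lambda>t. f t + g t) (\<lambda>n. fourier_coeff f n + fourier_coeff g n)"
    using cusp_form_q_expansion(1)[OF f] cusp_form_q_expansion(1)[OF g]
    by (auto simp: q_expansion_nome algebra_simps intro!: sums_add)
  moreover have "fourier_coeff f 0 + fourier_coeff g 0 = 0"
    using cusp_form_q_expansion(2)[OF f] cusp_form_q_expansion(2)[OF g] by simp
  ultimately have "\<exists>a. q_expansion (\<lambda>t. f t + g t) a \<and> a 0 = 0" by blast
  thus ?thesis using f g unfolding cusp_forms_def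
    by (auto intro!: holomorphic_intros simp: algebra_simps)
qed

lemma cusp_forms_scale:
  assumes f: "f \<in> cusp_forms k"
  shows "(\<lambda>t. c * f t) \<in> cusp_forms k"
proof -
  have "q_expansion (\<lambda>t. c * f t) (\<lambda>n. c * fourier_coeff f n)"
    using cusp_form_q_expansion(1)[OF f] by (auto simp: q_expansion_nome mult.assoc intro!: sums_mult)
  moreover have "c * fourier_coeff f 0 = 0" using cusp_form_q_expansion(2)[OF f] by simp
  ultimately have "\<exists>a. q_expansion (\<lambda>t. c * f t) a \<and> a 0 = 0" by blast
  thus ?thesis using f unfolding cusp_forms_def
    by (auto intro!: holomorphic_intros simp: algebra_simps)
qed

lemma fourier_coeff_add:
  assumes f: "f \<in> cusp_forms k" and g: "g \<in> cusp_forms k"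
  shows "fourier_coeff (\<lambda>t. f t + g t) = (\<lambda>n. fourier_coeff f n + fourier_coeff g n)"
  using cusp_form_q_expansion(1)[OF f] cusp_form_q_expansion(1)[OF g]
  by (intro fourier_coeff_eq) (auto simp: q_expansion_nome algebra_simps intro!: sums_add)

lemma fourier_coeff_scale:
  assumes f: "f \<in> cusp_forms k"
  shows "fourier_coeff (\<lambda>t. c * f t) = (\<lambda>n. c * fourier_coeff f n)"
  using cusp_form_q_expansion(1)[OF f]
  by (intro fourier_coeff_eq) (auto simp: q_expansion_nome mult.assoc intro!: sums_mult)

lemma zero_cusp_form: "(\<lambda>t. 0) \<in> cusp_forms k"
  by (auto simp: cusp_forms_def q_expansion_def intro!: exI[of _ "\<lambda>n. 0"])

lemma hecke_operator_add:
  "hecke_operator k n (\<lambda>t. f t + g t) = (\<lambda>t. hecke_operator k n f t + hecke_operator k n g t)"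
  by (auto simp: fun_eq_iff hecke_operator_def algebra_simps sum.distrib)

lemma hecke_operator_scale:
  "hecke_operator k n (\<lambda>t. c * f t) = (\<lambda>t. c * hecke_operator k n f t)"
  by (auto simp: fun_eq_iff hecke_operator_def sum_distrib_left mult_ac)

lemma eigenform_if_prime_eigen:
  assumes f: "f \<in> cusp_forms k" and nz: "f \<noteq> (\<lambda>t. 0)"
    and ev: "\<And>p. prime p \<Longrightarrow> \<exists>c. hecke_operator k p f = (\<lambda>t. c * f t)"
  shows "cuspidal_hecke_eigenform k f"
  unfolding cuspidal_hecke_eigenform_def
proof (intro conjI allI impI f nz)
  fix n :: nat assume n: "1 \<le> n"
  hence n0: "n > 0" by simp
  have "\<exists>c. \<forall>m. hecke_coeff k p (fourier_coeff f) m = c * fourier_coeff f m" if p: "prime p" for p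
  proof -
    obtain c where c: "hecke_operator k p f = (\<lambda>t. c * f t)" using ev[OF p] by blast
    have "hecke_coeff k p (fourier_coeff f) = (\<lambda>m. c * fourier_coeff f m)"
      using fourier_coeff_hecke[OF f prime_gt_0_nat[OF p]] unfolding c fourier_coeff_scale[OF f] by simp
    thus ?thesis by metis
  qed
  then obtain c where c: "\<And>m. hecke_coeff k n (fourier_coeff f) m = c * fourier_coeff f m"
    using hecke_coeff_eigen[OF _ n0] by blast
  have "hecke_operator k n f = (\<lambda>t. c * f t)"
    by (rule cusp_form_eqI[of _ k])
      (simp_all add: hecke_operator_cusp_form f n0 cusp_forms_scale fourier_coeff_hecke fourier_coeff_scale[OF f] c[abs_def])
  thus "\<exists>c. hecke_operator k n f = (\<lambda>t. c * f t)" by blast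
qed

subsection \<open>The Petersson product\<close>

fun lin :: "real \<times> real \<times> real \<times> real \<Rightarrow> complex \<times> complex \<Rightarrow> complex \<times> complex" where
  "lin (a, b, c, d) (u, v) = (of_real a * u + of_real b * v, of_real c * u + of_real d * v)"

lemma lin_measurable [measurable]: "lin M \<in> borel_measurable borel"
proof -
  obtain a b c d where M: "M = (a, b, c, d)" by (cases M)
  have "continuous_on UNIV (\<lambda>w. (of_real a * fst w + of_real b * snd w, of_real c * fst w + of_real d * snd w :: complex))"
    by (intro continuous_intros)
  moreover have "lin M = (\<lambda>w. (of_real a * fst w + of_real b * snd w, of_real c * fst w + of_real d * snd w))"
    by (auto simp: M fun_eq_iff)
  ultimately show ?thesis by (simp add: borel_measurable_continuous_onI)
qed

text \<open>Preservation of measure in the form of nonnegative integrals: shears then reduce to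
  Tonelli and a translation in one variable, and compositions are immediate.\<close>

definition lin_preserves :: "real \<times> real \<times> real \<times> real \<Rightarrow> bool" where
  "lin_preserves M \<longleftrightarrow> (\<forall>h\<in>borel_measurable borel. (\<integral>\<^sup>+w. h (lin M w) \<partial>lborel) = (\<integral>\<^sup>+w. (h w :: ennreal) \<partial>lborel))"

lemma nn_integral_lborel_plus:
  fixes h :: "complex \<Rightarrow> ennreal"
  assumes [measurable]: "h \<in> borel_measurable borel"
  shows "(\<integral>\<^sup>+x. h (c + x) \<partial>lborel) = (\<integral>\<^sup>+x. h x \<partial>lborel)"
  by (subst (2) lborel_distr_plus[symmetric, of c]) (simp add: nn_integral_distr)

lemma lin_preserves_upper: "lin_preserves (1, x, 0, 1)"
  unfolding lin_preserves_def
proof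
  fix h :: "complex \<times> complex \<Rightarrow> ennreal" assume "h \<in> borel_measurable borel"
  hence [measurable]: "h \<in> borel_measurable (borel \<Otimes>\<^sub>M borel)" by (simp add: borel_prod)
  have "(\<integral>\<^sup>+w. h (lin (1, x, 0, 1) w) \<partial>lborel) = (\<integral>\<^sup>+w. h (of_real x * snd w + fst w, snd w) \<partial>(lborel \<Otimes>\<^sub>M lborel))"
    unfolding lborel_prod by (intro nn_integral_cong) (auto simp: add.commute split: prod.splits)
  also have "\<dots> = (\<integral>\<^sup>+v. \<integral>\<^sup>+u. h (of_real x * v + u, v) \<partial>lborel \<partial>lborel)"
    by (subst lborel_pair.nn_integral_snd[symmetric]) auto
  also have "\<dots> = (\<integral>\<^sup>+v. \<integral>\<^sup>+u. h (u, v) \<partial>lborel \<partial>lborel)"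
    by (intro nn_integral_cong nn_integral_lborel_plus[of "\<lambda>u. h (u, _)"]) measurable
  also have "\<dots> = (\<integral>\<^sup>+w. h w \<partial>(lborel \<Otimes>\<^sub>M lborel))"
    by (subst lborel_pair.nn_integral_snd) auto
  finally show "(\<integral>\<^sup>+w. h (lin (1, x, 0, 1) w) \<partial>lborel) = (\<integral>\<^sup>+w. h w \<partial>lborel)" by (simp add: lborel_prod)
qed

lemma lin_preserves_lower: "lin_preserves (1, 0, x, 1)"
  unfolding lin_preserves_def
proof
  fix h :: "complex \<times> complex \<Rightarrow> ennreal" assume "h \<in> borel_measurable borel"
  hence [measurable]: "h \<in> borel_measurable (borel \<Otimes>\<^sub>M borel)" by (simp add: borel_prod)
  have "(\<integral>\<^sup>+w. h (lin (1, 0, x, 1) w) \<partial>lborel) = (\<integral>\<^sup>+w. h (fst w, of_real x * fst w + snd w) \<partial>(lborel \<Otimes>\<^sub>M lborel))"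
    unfolding lborel_prod by (intro nn_integral_cong) (auto split: prod.splits)
  also have "\<dots> = (\<integral>\<^sup>+u. \<integral>\<^sup>+v. h (u, of_real x * u + v) \<partial>lborel \<partial>lborel)"
    by (subst lborel.nn_integral_fst[symmetric]) auto
  also have "\<dots> = (\<integral>\<^sup>+u. \<integral>\<^sup>+v. h (u, v) \<partial>lborel \<partial>lborel)"
    by (intro nn_integral_cong nn_integral_lborel_plus[of "\<lambda>v. h (_, v)"]) measurable
  also have "\<dots> = (\<integral>\<^sup>+w. h w \<partial>(lborel \<Otimes>\<^sub>M lborel))"
    by (subst lborel.nn_integral_fst) auto
  finally show "(\<integral>\<^sup>+w. h (lin (1, 0, x, 1) w) \<partial>lborel) = (\<integral>\<^sup>+w. h w \<partial>lborel)" by (simp add: lborel_prod)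
qed

lemma lin_preserves_comp:
  assumes "lin_preserves M" "lin_preserves N" "\<And>w. lin L w = lin M (lin N w)"
  shows "lin_preserves L"
  unfolding lin_preserves_def
proof
  fix h :: "complex \<times> complex \<Rightarrow> ennreal" assume h [measurable]: "h \<in> borel_measurable borel"
  have "(\<lambda>w. h (lin M w)) \<in> borel_measurable borel" by measurable
  hence "(\<integral>\<^sup>+w. h (lin M (lin N w)) \<partial>lborel) = (\<integral>\<^sup>+w. h (lin M w) \<partial>lborel)"
    using bspec[OF assms(2)[unfolded lin_preserves_def], of "\<lambda>w. h (lin M w)"] by simp
  also have "\<dots> = (\<integral>\<^sup>+w. h w \<partial>lborel)" using assms(1) h unfolding lin_preserves_def by blast
  finally show "(\<integral>\<^sup>+w. h (lin L w) \<partial>lborel) = (\<integral>\<^sup>+w. h w \<partial>lborel)" by (simp add: assms(3))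
qed

text \<open>A matrix with \<open>c \<noteq> 0\<close> is a product of an upper, a lower and an upper
  shear; \<open>x\<close> and \<open>y\<close> are read off from the diagonal entries.\<close>

lemma lin_preserves_SL2:
  assumes "a * d - b * c = 1"
  shows "lin_preserves (a, b, c, d)"
proof -
  have *: "lin_preserves (a, b, c, d)" if c: "c \<noteq> 0" and det: "a * d - b * c = 1" for a b c d
  proof -
    define x y where "x = (a - 1) / c" and "y = (d - 1) / c"
    have e: "a = 1 + x * c" "d = c * y + 1" "b = (1 + x * c) * y + x"
      using c det by (auto simp: x_def y_def field_simps)
    have "lin_preserves (1, y, c, c * y + 1)"
      by (rule lin_preserves_comp[OF lin_preserves_lower[of c] lin_preserves_upper[of y]])
        (auto simp: algebra_simps)
    hence "lin_preserves (1 + x * c, (1 + x * c) * y + x, c, c * y + 1)"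
      by (rule lin_preserves_comp[OF lin_preserves_upper[of x]]) (auto simp: algebra_simps)
    thus ?thesis using e by metis
  qed
  show ?thesis
  proof (cases "c = 0")
    case False thus ?thesis using * assms by blast
  next
    case True
    hence "a \<noteq> 0" using assms by auto
    \<comment> \<open>Adding the first row to the second makes the lower left entry nonzero; a lower
      shear undoes it.\<close>
    hence "lin_preserves (a, b, a, b + d)" by (rule *) (use assms True in \<open>simp add: algebra_simps\<close>)
    thus ?thesis
      by (rule lin_preserves_comp[OF lin_preserves_lower[of "-1"]]) (use True in \<open>auto simp: algebra_simps\<close>)
  qed
qed

lemma distr_lin:
  assumes "lin_preserves M"
  shows "distr lborel borel (lin M) = lborel"
proof (rule measure_eqI)
  fix A assume "A \<in> sets (distr lborel borel (lin M))"
  hence A [measurable]: "A \<in> sets borel" by simp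
  have "emeasure (distr lborel borel (lin M)) A = (\<integral>\<^sup>+w. indicator A (lin M w) \<partial>lborel)"
    by (simp add: nn_integral_indicator[symmetric] nn_integral_distr del: nn_integral_indicator)
  also have "\<dots> = (\<integral>\<^sup>+w. indicator A w \<partial>lborel)"
    using assms unfolding lin_preserves_def by (rule bspec) measurable
  finally show "emeasure (distr lborel borel (lin M)) A = emeasure lborel A" by simp
qed simp

text \<open>Division by the square root of the determinant puts \<open>M\<close> into SL(2,R), so
  that it preserves Lebesgue measure and the area of a basis.\<close>

definition normalized :: "mat2 \<Rightarrow> complex \<times> complex \<Rightarrow> complex \<times> complex" where
  "normalized M w = (let s = complex_of_real (inverse (sqrt (of_int (mat_det M)))) in
     (s * fst (act M w), s * snd (act M w)))"

lemma integral_normalized: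
  fixes h :: "complex \<times> complex \<Rightarrow> complex"
  assumes M: "mat_det M > 0" and [measurable]: "h \<in> borel_measurable borel"
  shows "(LINT w|lborel. h (normalized M w)) = (LINT w|lborel. h w)"
proof -
  obtain a b c d where MM: "M = (a, b, c, d)" by (cases M)
  define s where "s = inverse (sqrt (real_of_int (mat_det M)))"
  have "s\<^sup>2 * real_of_int (mat_det M) = 1"
    using M by (simp add: s_def power_inverse)
  hence "lin_preserves (s * a, s * b, s * c, s * d)"
    by (intro lin_preserves_SL2) (simp add: MM power2_eq_square algebra_simps)
  hence d: "distr lborel borel (lin (s * a, s * b, s * c, s * d)) = lborel" by (rule distr_lin)
  have "normalized M = lin (s * a, s * b, s * c, s * d)"
    unfolding normalized_def s_def[symmetric] Let_def fun_eq_iff by (auto simp: MM algebra_simps)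
  hence "(LINT w|lborel. h (normalized M w)) = (LINT w|distr lborel borel (lin (s * a, s * b, s * c, s * d)). h w)"
    by (simp add: integral_distr)
  thus ?thesis by (simp only: d)
qed

section \<open>The weighted fundamental domain and unfolding\<close>

definition unimodular :: "mat2 set" where
  "unimodular = {g. mat_det g = 1}"

definition weight_count :: "complex \<times> complex \<Rightarrow> nat" where
  "weight_count w = card {g. mat_det g = 1 \<and> reduced_pair (act g w)}"

text \<open>A weighted fundamental domain: the weights of the translates of \<open>w\<close> under SL(2,Z) add up to \<open>1\<close>, so that
  unfolding needs no care about boundary points and stabilizers.\<close>

definition fund_weight :: "complex \<times> complex \<Rightarrow> real" where
  "fund_weight w = (if reduced_pair w then inverse (real (weight_count w)) else 0)"

lemma weight_count_act:
  assumes g: "mat_det g = 1"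
  shows "weight_count (act g w) = weight_count w"
  unfolding weight_count_def
proof (rule bij_betw_same_card[of "\<lambda>h. mat_mult h g"], rule bij_betwI[of _ _ _ "\<lambda>h. mat_mult h (mat_adj g)"])
  show "(\<lambda>h. mat_mult h g) \<in> {h. mat_det h = 1 \<and> reduced_pair (act h (act g w))} \<rightarrow> {h. mat_det h = 1 \<and> reduced_pair (act h w)}"
    using g by (auto simp: mat_det_mult act_mat_mult)
  have eq: "act (mat_mult h (mat_adj g)) (act g w) = act h w" for h
    by (simp only: act_mat_mult[symmetric] mat_mult_assoc mat_mult_adj g mat_mult_one)
  show "(\<lambda>h. mat_mult h (mat_adj g)) \<in> {h. mat_det h = 1 \<and> reduced_pair (act h w)} \<rightarrow> {h. mat_det h = 1 \<and> reduced_pair (act h (act g w))}"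
    using g by (auto simp: mat_det_mult eq)
qed (simp_all only: mat_mult_assoc mat_mult_adj g mat_mult_one)

lemma fund_weight_nonneg: "fund_weight w \<ge> 0"
  by (simp add: fund_weight_def)

lemma fund_weight_le_1: "fund_weight w \<le> 1"
proof (cases "weight_count w = 0")
  case False thus ?thesis by (simp add: fund_weight_def inverse_eq_divide)
qed (simp add: fund_weight_def)

lemma sum_fund_weight:
  assumes w: "area w > 0"
  shows "(\<Sum>g | mat_det g = 1 \<and> reduced_pair (act g w). fund_weight (act g w)) = 1"
proof -
  have "weight_count w > 0"
    unfolding weight_count_def using finite_reducing[OF w] exists_reducing[OF w] by (subst card_gt_0_iff) auto
  moreover have "(\<Sum>g | mat_det g = 1 \<and> reduced_pair (act g w). fund_weight (act g w)) =
     (\<Sum>g | mat_det g = 1 \<and> reduced_pair (act g w). inverse (real (weight_count w)))"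
    by (rule sum.cong) (auto simp: fund_weight_def weight_count_act)
  ultimately show ?thesis by (simp add: weight_count_def)
qed

lemma fund_weight_pos: "reduced_pair w \<Longrightarrow> fund_weight w > 0"
proof -
  assume r: "reduced_pair w"
  have w: "area w > 0" using r by (simp add: reduced_pair_def)
  have "weight_count w > 0"
    unfolding weight_count_def using finite_reducing[OF w] exists_reducing[OF w] by (subst card_gt_0_iff) auto
  thus ?thesis using r by (simp add: fund_weight_def)
qed

text \<open>Each matrix of determinant \<open>n\<close> is uniquely \<open>g r\<close> with
  \<open>g\<close> in SL(2,Z) and \<open>r\<close> a representative. For fixed \<open>r\<close> the
  function is constant in \<open>g\<close>, and the weights add up to 1. The general codomain covers
  complex lifts as well as their norms.\<close>

lemma hecke_unfolding:
  fixes F :: "complex \<times> complex \<Rightarrow> 'a :: real_algebra_1"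
  assumes inv: "\<And>g w. mat_det g = 1 \<Longrightarrow> area w > 0 \<Longrightarrow> F (act g w) = F w"
    and n: "n > 0" and w: "area w > 0"
  shows "finite {M. mat_det M = int n \<and> reduced_pair (act M w)}" (is "finite ?D")
    and "(\<Sum>M | mat_det M = int n \<and> reduced_pair (act M w). of_real (fund_weight (act M w)) * F (act M w)) =
      (\<Sum>r\<in>hecke_reps n. F (act r w))"
proof -
  define S where "S r = {g. mat_det g = 1 \<and> reduced_pair (act g (act r w))}" for r
  have aw: "area (act r w) > 0" if "r \<in> hecke_reps n" for r
    using mat_det_hecke_reps[OF n that] w n by (simp add: area_act)
  have fS: "finite (S r)" if "r \<in> hecke_reps n" for r
    unfolding S_def by (rule finite_reducing[OF aw[OF that]])
  have bij: "bij_betw (\<lambda>(r, g). mat_mult g r) (Sigma (hecke_reps n) S) ?D"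
  proof (rule bij_betw_imageI)
    show "inj_on (\<lambda>(r, g). mat_mult g r) (Sigma (hecke_reps n) S)"
    proof (rule inj_onI)
      fix x y assume xy: "x \<in> Sigma (hecke_reps n) S" "y \<in> Sigma (hecke_reps n) S"
        "(\<lambda>(r, g). mat_mult g r) x = (\<lambda>(r, g). mat_mult g r) y"
      obtain r g where x: "x = (r, g)" by (meson surj_pair)
      obtain r' g' where y: "y = (r', g')" by (meson surj_pair)
      have "g = g' \<and> r = r'"
        by (rule hermite_normal_form_unique'[OF n]) (use xy in \<open>simp_all add: x y S_def\<close>)
      thus "x = y" by (simp add: x y)
    qed
    show "(\<lambda>(r, g). mat_mult g r) ` Sigma (hecke_reps n) S = ?D"
    proof
      show "(\<lambda>(r, g). mat_mult g r) ` Sigma (hecke_reps n) S \<subseteq> ?D"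
      proof (rule image_subsetI)
        fix x assume x: "x \<in> Sigma (hecke_reps n) S"
        obtain r g where rg: "x = (r, g)" by (meson surj_pair)
        have "r \<in> hecke_reps n" "mat_det g = 1" "reduced_pair (act g (act r w))" using x by (simp_all add: rg S_def)
        thus "(\<lambda>(r, g). mat_mult g r) x \<in> ?D" by (simp add: rg mat_det_mult act_mat_mult mat_det_hecke_reps[OF n])
      qed
      show "?D \<subseteq> (\<lambda>(r, g). mat_mult g r) ` Sigma (hecke_reps n) S"
      proof
        fix M assume M: "M \<in> ?D"
        hence "mat_det M = int n" by simp
        then obtain g r where gr: "mat_det g = 1" "r \<in> hecke_reps n" "M = mat_mult g r"
          using hermite_normal_form[OF n, of M] by blast
        have "reduced_pair (act g (act r w))" using M unfolding gr(3) by (simp add: act_mat_mult)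
        hence "(r, g) \<in> Sigma (hecke_reps n) S" using gr by (simp add: S_def)
        thus "M \<in> (\<lambda>(r, g). mat_mult g r) ` Sigma (hecke_reps n) S"
          using gr(3) by (intro image_eqI[of _ _ "(r, g)"]) simp_all
      qed
    qed
  qed
  have "finite (Sigma (hecke_reps n) S)" using fS n by auto
  thus "finite ?D" using bij_betw_finite[OF bij] by simp
  define h where "h M = of_real (fund_weight (act M w)) * F (act M w)" for M
  have "(\<Sum>M\<in>?D. h M) = (\<Sum>(r, g)\<in>Sigma (hecke_reps n) S. h (mat_mult g r))"
    using sum.reindex_bij_betw[OF bij, of h] by (simp add: case_prod_unfold)
  also have "\<dots> = (\<Sum>r\<in>hecke_reps n. \<Sum>g\<in>S r. h (mat_mult g r))"
    using finite_hecke_reps[OF n] fS by (intro sum.Sigma[symmetric]) blast+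
  also have "\<dots> = (\<Sum>r\<in>hecke_reps n. F (act r w))"
  proof (rule sum.cong[OF refl])
    fix r assume r: "r \<in> hecke_reps n"
    have "(\<Sum>g\<in>S r. h (mat_mult g r)) = (\<Sum>g\<in>S r. of_real (fund_weight (act g (act r w))) * F (act r w))"
    proof (rule sum.cong[OF refl])
      fix g assume "g \<in> S r"
      hence "F (act g (act r w)) = F (act r w)" by (intro inv[OF _ aw[OF r]]) (simp add: S_def)
      thus "h (mat_mult g r) = of_real (fund_weight (act g (act r w))) * F (act r w)"
        by (simp only: h_def act_mat_mult)
    qed
    also have "\<dots> = of_real (\<Sum>g\<in>S r. fund_weight (act g (act r w))) * F (act r w)"
      by (simp add: sum_distrib_right)
    also have "(\<Sum>g\<in>S r. fund_weight (act g (act r w))) = 1"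
      unfolding S_def by (rule sum_fund_weight[OF aw[OF r]])
    finally show "(\<Sum>g\<in>S r. h (mat_mult g r)) = F (act r w)" by simp
  qed
  finally show "(\<Sum>M\<in>?D. of_real (fund_weight (act M w)) * F (act M w)) = (\<Sum>r\<in>hecke_reps n. F (act r w))"
    by (simp add: h_def)
qed

lemma area_measurable [measurable]: "area \<in> borel_measurable borel"
  unfolding area_def[abs_def] by (intro borel_measurable_continuous_onI continuous_intros)

lemma act_measurable [measurable]: "act M \<in> borel_measurable borel"
proof -
  obtain a b c d where M: "M = (a, b, c, d)" by (cases M)
  have "continuous_on UNIV (\<lambda>w. (of_int a * fst w + of_int b * snd w, of_int c * fst w + of_int d * snd w :: complex))"
    by (intro continuous_intros)
  moreover have "act M = (\<lambda>w. (of_int a * fst w + of_int b * snd w, of_int c * fst w + of_int d * snd w))"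
    by (auto simp: M fun_eq_iff)
  ultimately show ?thesis by (simp add: borel_measurable_continuous_onI)
qed

lemma reduced_measurable [measurable]: "Measurable.pred borel reduced_pair"
proof -
  have [measurable]: "(\<lambda>w. Re (fst w * cnj (snd w))) \<in> borel_measurable (borel :: (complex \<times> complex) measure)"
    "(\<lambda>w. cmod (fst w)) \<in> borel_measurable (borel :: (complex \<times> complex) measure)"
    "(\<lambda>w. cmod (snd w)) \<in> borel_measurable (borel :: (complex \<times> complex) measure)"
    by (intro borel_measurable_continuous_onI continuous_intros)+
  show ?thesis unfolding reduced_pair_def[abs_def] by measurable
qed

lemma count_measurable_aux:
  assumes "\<And>M. (\<lambda>w. h M w) \<in> borel_measurable borel"
  shows "(\<lambda>(M :: mat2, w :: complex \<times> complex). h M w :: 'a :: topological_space) \<in> borel_measurable (count_space A \<Otimes>\<^sub>M lborel)"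
  using assms by (intro measurable_pair_measure_countable1) (auto intro: countable_subset[of _ UNIV])

text \<open>The number of reducing matrices is an integral of measurable indicators against counting
  measure on a countable set, hence measurable in \<open>w\<close>. On reduced bases, the only place
  where it enters, it is finite.\<close>

lemma fund_weight_measurable [measurable]: "fund_weight \<in> borel_measurable borel"
proof -
  interpret cs: sigma_finite_measure "count_space unimodular"
    by (rule sigma_finite_measure_count_space_countable) (auto intro: countable_subset[of _ UNIV])
  define h :: "mat2 \<Rightarrow> complex \<times> complex \<Rightarrow> ennreal" where "h M w = indicator (Collect reduced_pair) (act M w)" for M w
  have red: "Collect reduced_pair \<in> sets borel" using reduced_measurable by simp
  have "(\<lambda>(M, w). h M w) \<in> borel_measurable (count_space unimodular \<Otimes>\<^sub>M lborel)"
    unfolding h_def by (intro count_measurable_aux) (use red in measurable)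
  hence "(\<lambda>(w, M). h M w) \<in> borel_measurable (lborel \<Otimes>\<^sub>M count_space unimodular)"
    by (rule measurable_pair_swap[unfolded case_prod_unfold, THEN back_subst[of "\<lambda>f. f \<in> _"]]) auto
  hence N: "(\<lambda>w. \<integral>\<^sup>+M. h M w \<partial>count_space unimodular) \<in> borel_measurable borel"
    using cs.borel_measurable_nn_integral[of "\<lambda>w M. h M w" lborel] by simp
  have "fund_weight w = (if reduced_pair w then inverse (enn2real (\<integral>\<^sup>+M. h M w \<partial>count_space unimodular)) else 0)" for w
  proof (cases "reduced_pair w")
    case True
    hence w: "area w > 0" by (simp add: reduced_pair_def)
    have fin: "finite {M \<in> unimodular. reduced_pair (act M w)}" using finite_reducing[OF w] by (simp add: unimodular_def)
    have "(\<integral>\<^sup>+M. h M w \<partial>count_space unimodular) = (\<integral>\<^sup>+M. indicator {M \<in> unimodular. reduced_pair (act M w)} M \<partial>count_space unimodular)"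
      by (intro nn_integral_cong) (auto simp: h_def indicator_def)
    also have "\<dots> = emeasure (count_space unimodular) {M \<in> unimodular. reduced_pair (act M w)}"
      by (rule nn_integral_indicator) auto
    also have "\<dots> = of_nat (weight_count w)"
    proof -
      have "emeasure (count_space unimodular) {M \<in> unimodular. reduced_pair (act M w)} =
          of_nat (card {M \<in> unimodular. reduced_pair (act M w)})"
        by (rule emeasure_count_space_finite[OF _ fin]) auto
      thus ?thesis by (simp add: weight_count_def unimodular_def)
    qed
    finally show ?thesis using True by (simp add: fund_weight_def)
  qed (simp add: fund_weight_def)
  hence eq: "fund_weight = (\<lambda>w. if reduced_pair w then inverse (enn2real (\<integral>\<^sup>+M. h M w \<partial>count_space unimodular)) else 0)" by auto
  note [measurable] = N
  show ?thesis unfolding eq by measurable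
qed

lemma lift_measurable:
  assumes f: "f \<in> cusp_forms k"
  shows "lift k f \<in> borel_measurable borel"
proof -
  have "continuous_on upper_half_plane f"
    using f by (auto simp: cusp_forms_def intro: holomorphic_on_imp_continuous_on)
  hence "(\<lambda>t. indicator upper_half_plane t *\<^sub>R f t) \<in> borel_measurable borel"
    by (intro borel_measurable_continuous_on_indicator) (auto simp: open_upper_half_plane)
  moreover have "(\<lambda>t. indicator upper_half_plane t *\<^sub>R f t) = f"
    using cusp_form_outside[OF f] by (auto simp: fun_eq_iff indicator_def)
  ultimately have [measurable]: "f \<in> borel_measurable borel" by simp
  have [measurable]: "(\<lambda>v. v powi j) \<in> borel_measurable (borel :: complex measure)" for j
    by (cases "j \<ge> 0") (auto simp: power_int_def)
  have [measurable]: "fst \<in> borel_measurable (borel :: (complex \<times> complex) measure)"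
    "snd \<in> borel_measurable (borel :: (complex \<times> complex) measure)"
    by (intro borel_measurable_continuous_onI continuous_intros)+
  show ?thesis unfolding lift_def[abs_def] by measurable
qed

text \<open>Over all covolumes the integral of a nonzero homogeneous norm would diverge. A band of
  covolumes cuts the scale out, and SL(2,R) preserves it.\<close>

definition area_band :: "(complex \<times> complex) set" where
  "area_band = {w. 1 \<le> area w \<and> area w \<le> 2}"

text \<open>Integrating out the scale and phase of the second vector gives the usual product with
  measure \<open>y powi (k - 2)\<close> on the half-plane, up to a positive factor depending only on
  \<open>k\<close>.\<close>

definition petersson :: "int \<Rightarrow> (complex \<Rightarrow> complex) \<Rightarrow> (complex \<Rightarrow> complex) \<Rightarrow> complex" where
  "petersson k f g = (LINT w|lborel. indicator area_band w *\<^sub>R (of_real (fund_weight w) * (lift k f w * cnj (lift k g w))))"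

lemma area_band_measurable [measurable]: "area_band \<in> sets borel"
  unfolding area_band_def by measurable

section \<open>Convergence and definiteness of the Petersson product\<close>

lemma norm_lift_sq:
  assumes w: "area w > 0"
  shows "(cmod (lift k f w))\<^sup>2 = inv_norm k f (fst w / snd w) * area w powi (- k)"
  using inv_norm_lift[OF w, of k f] w by (simp add: power_int_minus field_simps)

lemma power_int_le_max:
  fixes x :: real
  assumes "0 < lo" "lo \<le> x" "x \<le> hi"
  shows "x powi j \<le> max (lo powi j) (hi powi j)"
proof (cases "j \<ge> 0")
  case True
  hence "x powi j \<le> hi powi j" using assms by (simp add: power_int_def power_mono)
  thus ?thesis by simp
next
  case False
  hence "x powi j \<le> lo powi j" using assms by (simp add: power_int_def power_mono power_inverse le_imp_inverse_le)
  thus ?thesis by simp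
qed

text \<open>The bound covers unreduced bases as well, since \<open>inv_norm\<close> is bounded on
  the whole half-plane. The bands in use are \<open>[1, 2]\<close> and its image
  \<open>[n, 2 n]\<close> under matrices of determinant \<open>n\<close>.\<close>

lemma lift_bounded:
  assumes f: "f \<in> cusp_forms k" and lo: "0 < lo"
  shows "\<exists>C. \<forall>w. lo \<le> area w \<longrightarrow> area w \<le> hi \<longrightarrow> cmod (lift k f w) \<le> C"
proof -
  obtain t0 where t0: "\<And>t. t \<in> upper_half_plane \<Longrightarrow> inv_norm k f t \<le> inv_norm k f t0" "Im t0 > 0"
    using cusp_form_max[OF f] by blast
  define N where "N = inv_norm k f t0"
  have N: "N \<ge> 0" using t0(2) by (simp add: N_def inv_norm_def zero_le_power_int)
  define P where "P = max (lo powi (- k)) (hi powi (- k))"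
  have "cmod (lift k f w) \<le> sqrt (N * P)" if h: "lo \<le> area w" "area w \<le> hi" for w
  proof -
    have w: "area w > 0" using h lo by linarith
    have "(cmod (lift k f w))\<^sup>2 \<le> N * P"
      unfolding norm_lift_sq[OF w] P_def N_def
      using N w by (intro mult_mono t0(1) quotient_in_upper power_int_le_max[OF lo] h) (auto simp: N_def zero_le_power_int)
    thus ?thesis by (rule real_le_rsqrt)
  qed
  thus ?thesis by blast
qed

lemma powr_exp_bounded: "\<exists>B. \<forall>y\<ge>1 / 2. y powr r * exp (- 2 * pi * y) \<le> (B :: real)"
proof -
  define h where "h y = y powr r * exp (- 2 * pi * y)" for y :: real
  have "(h \<longlongrightarrow> 0) at_top" unfolding h_def by real_asymp
  hence "eventually (\<lambda>y. h y < 1) at_top" by (rule order_tendstoD) simp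
  then obtain Y where Y: "\<And>y. y \<ge> Y \<Longrightarrow> h y < 1" by (auto simp: eventually_at_top_linorder)
  have "continuous_on {1 / 2..Y} h" unfolding h_def by (intro continuous_intros) auto
  hence "bounded (h ` {1 / 2..Y})" by (intro compact_imp_bounded compact_continuous_image) auto
  then obtain B where "\<forall>x\<in>h ` {1 / 2..Y}. norm x \<le> B" unfolding bounded_iff by blast
  hence B: "\<bar>h y\<bar> \<le> B" if "y \<in> {1 / 2..Y}" for y using that by auto
  have "h y \<le> max 1 B" if "y \<ge> 1 / 2" for y
  proof (cases "y \<ge> Y")
    case True thus ?thesis using Y[OF True] by simp
  next
    case False thus ?thesis using B[of y] that by auto
  qed
  thus ?thesis unfolding h_def by blast
qed

text \<open>In a reduced basis a short second vector \<open>v\<close> means a large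
  \<open>y = area / (cmod v)^2\<close>, where the form decays exponentially. A single factor
  \<open>1 / y\<close>, at most \<open>(cmod v)^2\<close> in the band, is retained, and with it a
  crude estimate of the integral suffices.\<close>

lemma lift_decay:
  assumes f: "f \<in> cusp_forms k"
  shows "\<exists>C\<ge>0. \<forall>w. w \<in> area_band \<longrightarrow> reduced_pair w \<longrightarrow> cmod (lift k f w) \<le> C * (cmod (snd w))\<^sup>2"
proof -
  obtain C where C: "C > 0" "\<And>t. Im t \<ge> 1 / 2 \<Longrightarrow> cmod (f t) \<le> C * exp (- 2 * pi * Im t)"
    using cusp_form_decay[OF f, of "1 / 2"] by auto
  \<comment> \<open>The part \<open>k / 2\<close> of the exponent comes from the root of
    \<open>inv_norm\<close>; the extra 1 pays for the factor \<open>1 / y\<close>.\<close>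
  obtain B where B: "\<And>y. y \<ge> 1 / 2 \<Longrightarrow> y powr (of_int k / 2 + 1) * exp (- 2 * pi * y) \<le> B"
    using powr_exp_bounded by blast
  have "0 \<le> 1 powr (of_int k / 2 + 1) * exp (- 2 * pi * (1::real))" by simp
  also have "\<dots> \<le> B" by (rule B) simp
  finally have B0: "B \<ge> 0" .
  define P where "P = max (1 powi (- k)) (2 powi (- k) :: real)"
  have P: "P \<ge> 0" by (simp add: P_def)
  have "cmod (lift k f w) \<le> (C * B * sqrt P) * (cmod (snd w))\<^sup>2" if w: "w \<in> area_band" "reduced_pair w" for w
  proof -
    obtain u v where ww: "w = (u, v)" by (cases w)
    have a: "area w \<ge> 1" "area w \<le> 2" using w by (auto simp: area_band_def)
    have a0: "area w > 0" using a by simp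
    define y where "y = Im (u / v)"
    have y: "y > 0" "3 / 4 \<le> y\<^sup>2" using reduced_Im[of u v] w(2) unfolding ww y_def by blast+
    have y2: "y \<ge> 1 / 2"
    proof (rule ccontr)
      assume "\<not> y \<ge> 1 / 2"
      hence "y\<^sup>2 \<le> (1 / 2)\<^sup>2" using y by (intro power_mono) auto
      thus False using y by (simp add: power2_eq_square)
    qed
    have v: "cmod v > 0" using area_pos_nonzero[OF a0] by (simp add: ww)
    have yq: "y = area w / (cmod v)\<^sup>2" using Im_quotient[of w] unfolding y_def ww by simp
    have "1 / y = (cmod v)\<^sup>2 / area w" unfolding yq by simp
    also have "\<dots> \<le> (cmod v)\<^sup>2 / 1" using a by (intro divide_left_mono) auto
    finally have yv: "1 / y \<le> (cmod v)\<^sup>2" by simp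
    have "sqrt (inv_norm k f (u / v)) = cmod (f (u / v)) * y powr (of_int k / 2)"
    proof -
      have "(y powr (of_int k / 2))\<^sup>2 = y powi k"
        using y by (simp add: powr_real_of_int' [symmetric] powr_power)
      hence "inv_norm k f (u / v) = (cmod (f (u / v)) * y powr (of_int k / 2))\<^sup>2"
        by (simp add: inv_norm_def y_def power_mult_distrib)
      thus ?thesis by simp
    qed
    also have "\<dots> \<le> (C * exp (- 2 * pi * y)) * y powr (of_int k / 2)"
      using C(2)[of "u / v"] y2 by (intro mult_right_mono) (auto simp: y_def)
    also have "\<dots> = C * (y powr (of_int k / 2 + 1) * exp (- 2 * pi * y)) * (1 / y)"
      using y by (simp add: powr_add)
    also have "\<dots> \<le> C * B * (cmod v)\<^sup>2"
      using C(1) B[OF y2] B0 yv y by (intro mult_mono) auto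
    finally have s: "sqrt (inv_norm k f (u / v)) \<le> C * B * (cmod v)\<^sup>2" .
    have "cmod (lift k f w) = sqrt ((cmod (lift k f w))\<^sup>2)" by simp
    also have "\<dots> = sqrt (inv_norm k f (u / v)) * sqrt (area w powi (- k))"
      unfolding norm_lift_sq[OF a0] real_sqrt_mult by (simp add: ww)
    also have "\<dots> \<le> C * B * (cmod v)\<^sup>2 * sqrt P"
    proof (intro mult_mono s)
      show "sqrt (area w powi (- k)) \<le> sqrt P"
        unfolding P_def using power_int_le_max[of 1 "area w" 2 "- k"] a by simp
    qed (use C(1) B0 a0 in \<open>auto simp: zero_le_power_int\<close>)
    finally show ?thesis by (simp add: ww mult_ac)
  qed
  thus ?thesis using C(1) B0 P by (intro exI[of _ "C * B * sqrt P"]) auto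
qed

text \<open>For fixed \<open>v\<close> the first vector lies in a disc of radius
  \<open>3 / cmod v\<close>; its area \<open>9 * pi / (cmod v)^2\<close> is balanced by the factor
  \<open>(cmod v)^2\<close>, and \<open>v\<close> itself ranges over a bounded disc.\<close>

lemma reduced_band_integrable:
  "integrable lborel (\<lambda>w. indicator area_band w * fund_weight w * (cmod (snd w))\<^sup>2)"
proof (rule integrableI_bounded)
  have [measurable]: "(\<lambda>w. cmod (snd w)) \<in> borel_measurable (borel :: (complex \<times> complex) measure)"
    by (intro borel_measurable_continuous_onI continuous_intros)
  show "(\<lambda>w. indicator area_band w * fund_weight w * (cmod (snd w))\<^sup>2) \<in> borel_measurable lborel" by measurable
  define R :: "complex \<Rightarrow> complex set" where "R v = cball 0 (3 / cmod v)" for v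
  define Q :: "(complex \<times> complex) set" where "Q = {(u, v). cmod u * cmod v \<le> 3 \<and> cmod v \<le> 2}"
  have "closed {w :: complex \<times> complex. cmod (fst w) * cmod (snd w) \<le> 3 \<and> cmod (snd w) \<le> 2}"
    by (intro closed_Collect_conj closed_Collect_le continuous_intros)
  hence Q [measurable]: "Q \<in> sets borel" unfolding Q_def by (simp add: case_prod_unfold)
  define h where "h w = ennreal ((cmod (snd w))\<^sup>2) * indicator Q w" for w :: "complex \<times> complex"
  have h [measurable]: "h \<in> borel_measurable (borel \<Otimes>\<^sub>M borel)"
    unfolding borel_prod h_def by measurable
  have le: "ennreal (norm (indicator area_band w * fund_weight w * (cmod (snd w))\<^sup>2)) \<le> h w" for w
  proof (cases "w \<in> area_band \<and> reduced_pair w")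
    case True
    obtain u v where ww: "w = (u, v)" by (cases w)
    have a: "area (u, v) \<le> 2" "area (u, v) \<ge> 1" using True by (auto simp: area_band_def ww)
    have r: "reduced_pair (u, v)" using True ww by simp
    have v: "(cmod v)\<^sup>2 \<le> 4" using reduced_snd_bound[OF r] a by simp
    hence v2: "cmod v \<le> 2" using power2_le_imp_le[of "cmod v" 2] by simp
    have "((cmod v)\<^sup>2)\<^sup>2 \<le> 4\<^sup>2" using v by (intro power_mono) auto
    moreover have "(area (u, v))\<^sup>2 \<le> 2\<^sup>2" using a by (intro power_mono) auto
    ultimately have "4 * ((cmod u)\<^sup>2 * (cmod v)\<^sup>2) \<le> 32" using reduced_bounds(2)[OF r] by simp
    \<comment> \<open>The preceding bound gives at most 8 for this square, which is rounded up to
      9.\<close>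
    hence "(cmod u * cmod v)\<^sup>2 \<le> 3\<^sup>2" unfolding power_mult_distrib by simp
    hence "cmod u * cmod v \<le> 3" by (rule power2_le_imp_le) simp
    hence "w \<in> Q" using v2 by (simp add: Q_def ww)
    moreover have "fund_weight w * (cmod v)\<^sup>2 \<le> 1 * (cmod v)\<^sup>2"
      by (intro mult_right_mono fund_weight_le_1) auto
    ultimately show ?thesis using True fund_weight_nonneg[of w] by (simp add: h_def ww ennreal_leI)
  next
    case False
    hence z: "indicator area_band w * fund_weight w = 0" by (auto simp: fund_weight_def indicator_def)
    show ?thesis unfolding z by simp
  qed
  have "(\<integral>\<^sup>+w. ennreal (norm (indicator area_band w * fund_weight w * (cmod (snd w))\<^sup>2)) \<partial>lborel) \<le> (\<integral>\<^sup>+w. h w \<partial>lborel)"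
    by (intro nn_integral_mono le)
  also have "(\<integral>\<^sup>+w. h w \<partial>lborel) = (\<integral>\<^sup>+v. \<integral>\<^sup>+u. h (u, v) \<partial>lborel \<partial>lborel)"
    using h by (subst lborel_pair.nn_integral_snd) (simp_all add: lborel_prod borel_prod)
  also have "\<dots> \<le> (\<integral>\<^sup>+v. ennreal (9 * pi) * indicator (cball 0 2) v \<partial>(lborel :: complex measure))"
  proof (rule nn_integral_mono)
    fix v :: complex
    show "(\<integral>\<^sup>+u. h (u, v) \<partial>lborel) \<le> ennreal (9 * pi) * indicator (cball 0 2) v"
    proof (cases "v \<noteq> 0 \<and> cmod v \<le> 2")
      case True
      have "(\<integral>\<^sup>+u. h (u, v) \<partial>lborel) \<le> (\<integral>\<^sup>+u. ennreal ((cmod v)\<^sup>2) * indicator (cball 0 (3 / cmod v)) u \<partial>(lborel :: complex measure))"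
        using True by (intro nn_integral_mono) (auto simp: h_def Q_def indicator_def field_simps)
      also have "\<dots> = ennreal ((cmod v)\<^sup>2) * emeasure lborel (cball (0::complex) (3 / cmod v))"
        by (subst nn_integral_cmult_indicator) auto
      also have "emeasure lborel (cball (0::complex) (3 / cmod v)) = ennreal (pi * (3 / cmod v)\<^sup>2)"
        by (subst emeasure_cball) (auto simp: unit_ball_vol_2 eval_unit_ball_vol)
      also have "ennreal ((cmod v)\<^sup>2) * \<dots> = ennreal ((cmod v)\<^sup>2 * (pi * (3 / cmod v)\<^sup>2))"
        by (simp add: ennreal_mult)
      also have "(cmod v)\<^sup>2 * (pi * (3 / cmod v)\<^sup>2) = 9 * pi"
        using True by (simp add: power_divide)
      finally show ?thesis using True by simp
    next
      case False
      hence "h (u, v) = 0" for u by (auto simp: h_def Q_def indicator_def)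
      thus ?thesis by simp
    qed
  qed
  also have "\<dots> = ennreal (9 * pi) * emeasure lborel (cball (0::complex) 2)"
    by (subst nn_integral_cmult_indicator) auto
  also have "\<dots> < \<infinity>"
    by (simp add: emeasure_cball ennreal_mult_less_top)
  finally show "(\<integral>\<^sup>+w. ennreal (norm (indicator area_band w * fund_weight w * (cmod (snd w))\<^sup>2)) \<partial>lborel) < \<infinity>" .
qed

text \<open>Decay of one factor is enough, the other need only be bounded in the band. The free
  function \<open>b\<close> stands for a lift in \<open>petersson_integrable\<close> and for a sum
  of norms in the unfolding.\<close>

lemma weighted_lift_integrable:
  assumes g: "g \<in> cusp_forms k" and b [measurable]: "b \<in> borel_measurable borel"
    and C: "\<And>w. w \<in> area_band \<Longrightarrow> norm (b w :: complex) \<le> C"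
  shows "integrable lborel (\<lambda>w. indicator area_band w *\<^sub>R (of_real (fund_weight w) * (b w * cnj (lift k g w))))"
proof -
  note [measurable] = lift_measurable[OF g]
  obtain D where D: "D \<ge> 0" "\<And>w. w \<in> area_band \<Longrightarrow> reduced_pair w \<Longrightarrow> cmod (lift k g w) \<le> D * (cmod (snd w))\<^sup>2"
    using lift_decay[OF g] by blast
  have [measurable]: "cnj \<in> borel_measurable borel" by (intro borel_measurable_continuous_onI continuous_intros)
  have "integrable lborel (\<lambda>w. \<bar>C\<bar> * D * (indicator area_band w * fund_weight w * (cmod (snd w))\<^sup>2))"
    by (intro integrable_mult_right reduced_band_integrable)
  thus ?thesis
  proof (rule Bochner_Integration.integrable_bound)
    show "AE w in lborel. norm (indicator area_band w *\<^sub>R (of_real (fund_weight w) * (b w * cnj (lift k g w)))) \<le>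
       norm (\<bar>C\<bar> * D * (indicator area_band w * fund_weight w * (cmod (snd w))\<^sup>2))"
    proof (intro AE_I2)
      fix w
      show "norm (indicator area_band w *\<^sub>R (of_real (fund_weight w) * (b w * cnj (lift k g w)))) \<le>
        norm (\<bar>C\<bar> * D * (indicator area_band w * fund_weight w * (cmod (snd w))\<^sup>2))"
      proof (cases "w \<in> area_band \<and> reduced_pair w")
        case True
        have "norm (b w) * cmod (lift k g w) \<le> \<bar>C\<bar> * (D * (cmod (snd w))\<^sup>2)"
          using True C[of w] D by (intro mult_mono) auto
        hence "fund_weight w * (norm (b w) * cmod (lift k g w)) \<le> fund_weight w * (\<bar>C\<bar> * (D * (cmod (snd w))\<^sup>2))"
          by (rule mult_left_mono) (rule fund_weight_nonneg)
        thus ?thesis using True D(1) fund_weight_nonneg[of w] by (simp add: norm_mult abs_mult mult_ac)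
      next
        case False
        hence "w \<notin> area_band \<or> fund_weight w = 0" by (auto simp: fund_weight_def)
        thus ?thesis by auto
      qed
    qed
  qed measurable
qed

lemma petersson_integrable:
  assumes f: "f \<in> cusp_forms k" and g: "g \<in> cusp_forms k"
  shows "integrable lborel (\<lambda>w. indicator area_band w *\<^sub>R (of_real (fund_weight w) * (lift k f w * cnj (lift k g w))))"
proof -
  obtain C where "\<And>w. w \<in> area_band \<Longrightarrow> cmod (lift k f w) \<le> C"
    using lift_bounded[OF f, of 1 2] by (auto simp: area_band_def)
  thus ?thesis by (intro weighted_lift_integrable[OF g lift_measurable[OF f]])
qed

lemma lift_add: "lift k (\<lambda>t. f t + g t) w = lift k f w + lift k g w"
  by (simp add: lift_def algebra_simps)

lemma lift_scale: "lift k (\<lambda>t. c * f t) w = c * lift k f w"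
  by (simp add: lift_def)

lemma petersson_add_left:
  assumes f: "f \<in> cusp_forms k" and g: "g \<in> cusp_forms k" and h: "h \<in> cusp_forms k"
  shows "petersson k (\<lambda>t. f t + g t) h = petersson k f h + petersson k g h"
  unfolding petersson_def Bochner_Integration.integral_add[OF petersson_integrable[OF f h] petersson_integrable[OF g h], symmetric]
  by (intro Bochner_Integration.integral_cong refl) (simp add: lift_add algebra_simps)

lemma petersson_scale_left: "petersson k (\<lambda>t. c * f t) g = c * petersson k f g"
  unfolding petersson_def integral_mult_right_zero[symmetric]
  by (intro Bochner_Integration.integral_cong refl) (simp add: lift_scale mult_ac)

lemma petersson_commute:
  assumes f: "f \<in> cusp_forms k" and g: "g \<in> cusp_forms k"
  shows "petersson k g f = cnj (petersson k f g)"
  unfolding petersson_def integral_bounded_linear[OF bounded_linear_cnj petersson_integrable[OF f g], symmetric]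
  by (intro Bochner_Integration.integral_cong refl) (simp add: mult_ac)

text \<open>By the identity theorem a nonzero form is nonzero somewhere in the interior of the
  fundamental domain. Near a corresponding basis of area strictly between 1 and 2 the integrand is
  positive on an open set, which is not negligible.\<close>

lemma petersson_definite:
  assumes f: "f \<in> cusp_forms k" and z: "petersson k f f = 0"
  shows "f = (\<lambda>t. 0)"
proof (rule ccontr)
  assume nz: "f \<noteq> (\<lambda>t. 0)"
  then obtain t1 where t1: "t1 \<in> upper_half_plane" "f t1 \<noteq> 0" using cusp_form_outside[OF f] by blast
  have hol: "f holomorphic_on upper_half_plane" using f by (simp add: cusp_forms_def)
  define R where "R = {t. Im t > 1 \<and> \<bar>Re t\<bar> < 1 / 2}"
  have RH: "R \<subseteq> upper_half_plane" by (auto simp: R_def upper_half_plane_def)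
  have "\<exists>t\<in>R. f t \<noteq> 0"
  proof (rule ccontr)
    assume no: "\<not> (\<exists>t\<in>R. f t \<noteq> 0)"
    have "f t1 = 0"
    proof (rule analytic_continuation_open[where f = f and g = "\<lambda>t. 0" and s = R and s' = upper_half_plane])
      show "open R" unfolding R_def by (intro open_Collect_conj open_Collect_less continuous_intros)
      have "2 * \<i> \<in> R" by (simp add: R_def)
      thus "R \<noteq> {}" by blast
      show "connected upper_half_plane"
        unfolding upper_half_plane_def by (intro convex_connected convex_halfspace_Im_gt)
    qed (use no hol RH t1 open_upper_half_plane in auto)
    thus False using t1 by simp
  qed
  then obtain t where t: "t \<in> R" "f t \<noteq> 0" by blast
  have y: "Im t > 1" "\<bar>Re t\<bar> < 1 / 2" using t by (auto simp: R_def)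
  define W where "W = {w. 0 < area w}"
  define U0 where "U0 = {w. 1 < area w \<and> area w < 2 \<and> 2 * \<bar>Re (fst w * cnj (snd w))\<bar> < (cmod (snd w))\<^sup>2 \<and> cmod (snd w) < cmod (fst w)}"
  define U where "U = W \<inter> (\<lambda>w. f (fst w / snd w)) -` (- {0}) \<inter> U0"
  have ac: "continuous_on A area" for A unfolding area_def[abs_def] by (intro continuous_intros)
  have oW: "open W" unfolding W_def by (intro open_Collect_less ac continuous_intros)
  have "continuous_on W (\<lambda>w. f (fst w / snd w))"
  proof (rule continuous_on_compose2[of upper_half_plane f])
    show "continuous_on upper_half_plane f" using hol by (rule holomorphic_on_imp_continuous_on)
    show "continuous_on W (\<lambda>w. fst w / snd w)"
      using area_pos_nonzero by (intro continuous_intros) (auto simp: W_def)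
    show "(\<lambda>w. fst w / snd w) ` W \<subseteq> upper_half_plane" using quotient_in_upper by (auto simp: W_def)
  qed
  hence "open (W \<inter> (\<lambda>w. f (fst w / snd w)) -` (- {0}))"
    using oW by (intro continuous_open_preimage) auto
  moreover have "open U0" unfolding U0_def by (intro open_Collect_conj open_Collect_less ac continuous_intros)
  ultimately have oU: "open U" unfolding U_def by (rule open_Int)
  \<comment> \<open>This length of the second vector gives the basis area 3/2, in the interior of
    the band.\<close>
  define s where "s = sqrt (3 / 2 / Im t)"
  have s: "s > 0" "s\<^sup>2 * Im t = 3 / 2" using y by (auto simp: s_def)
  have a: "area (t * of_real s, of_real s) = 3 / 2" using s(2) by (simp add: area_def power2_eq_square mult_ac)
  have "cmod t > 1" using y(1) abs_Im_le_cmod[of t] by linarith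
  hence "(t * of_real s, of_real s) \<in> U"
    using s(1) y t a by (auto simp: U_def W_def U0_def norm_mult power2_eq_square abs_mult)
  hence "\<not> negligible U" using oU open_not_negligible by blast
  define p where "p w = indicator area_band w * (fund_weight w * (cmod (lift k f w))\<^sup>2)" for w
  have pe: "indicator area_band w *\<^sub>R (of_real (fund_weight w) * (lift k f w * cnj (lift k f w))) = of_real (p w)" for w
    by (simp add: p_def complex_norm_square[symmetric] scaleR_conv_of_real del: of_real_power)
  have ip: "integrable lborel p"
    using integrable_bounded_linear[OF bounded_linear_Re petersson_integrable[OF f f]] unfolding pe by simp
  have "petersson k f f = complex_of_real (LINT w|lborel. p w)"
    unfolding petersson_def pe by (rule integral_complex_of_real)
  hence "(LINT w|lborel. p w) = 0" using z by simp
  moreover have "AE w in lborel. 0 \<le> p w" by (simp add: p_def fund_weight_nonneg)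
  ultimately have p0: "AE w in lborel. p w = 0" using integral_nonneg_eq_0_iff_AE[OF ip] by blast
  have pU: "p w > 0" if "w \<in> U" for w
  proof -
    have w: "area w > 0" "f (fst w / snd w) \<noteq> 0" "reduced_pair w" "w \<in> area_band"
      using that by (auto simp: U_def W_def U0_def reduced_pair_def area_band_def)
    have "lift k f w \<noteq> 0" using w area_pos_nonzero[OF w(1)] by (simp add: lift_def)
    thus ?thesis using w fund_weight_pos[OF w(3)] by (simp add: p_def)
  qed
  from p0 have "AE w in lborel. w \<notin> U" by eventually_elim (use pU in force)
  hence "U \<in> null_sets lborel" using oU by (subst AE_iff_null_sets) auto
  hence "negligible U" by (simp add: negligible_iff_null_sets null_sets_completionI)
  thus False using \<open>\<not> negligible U\<close> by blast
qed

section \<open>Self-adjointness of the Hecke operators\<close>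

definition scale_pair :: "real \<Rightarrow> complex \<times> complex \<Rightarrow> complex \<times> complex" where
  "scale_pair r w = (of_real r * fst w, of_real r * snd w)"

lemma act_scale_pair: "act M (scale_pair r w) = scale_pair r (act M w)"
  by (cases M; cases w) (simp add: scale_pair_def algebra_simps)

lemma area_scale_pair: "area (scale_pair r w) = r\<^sup>2 * area w"
  by (simp add: area_def scale_pair_def power2_eq_square algebra_simps)

lemma reduced_scale_pair:
  assumes "r > 0"
  shows "reduced_pair (scale_pair r w) \<longleftrightarrow> reduced_pair w"
proof -
  have "Re (of_real r * u * cnj (of_real r * v)) = r\<^sup>2 * Re (u * cnj v)" for u v
    by (simp add: power2_eq_square algebra_simps)
  hence "2 * \<bar>Re (fst (scale_pair r w) * cnj (snd (scale_pair r w)))\<bar> = r\<^sup>2 * (2 * \<bar>Re (fst w * cnj (snd w))\<bar>)"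
    by (simp add: scale_pair_def abs_mult)
  moreover have "(cmod (snd (scale_pair r w)))\<^sup>2 = r\<^sup>2 * (cmod (snd w))\<^sup>2"
    "cmod (snd (scale_pair r w)) = r * cmod (snd w)" "cmod (fst (scale_pair r w)) = r * cmod (fst w)"
    using assms by (simp_all add: scale_pair_def norm_mult power_mult_distrib)
  ultimately show ?thesis
    using assms by (simp only: reduced_pair_def area_scale_pair) (simp add: zero_less_mult_iff)
qed

lemma fund_weight_scale_pair:
  assumes "r > 0"
  shows "fund_weight (scale_pair r w) = fund_weight w"
  by (simp add: fund_weight_def weight_count_def act_scale_pair reduced_scale_pair[OF assms])

lemma lift_scale_pair:
  assumes "r > 0"
  shows "lift k f (scale_pair r w) = of_real r powi (- k) * lift k f w"
  using assms by (simp add: lift_def scale_pair_def power_int_mult_distrib)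

lemma act_scalar: "act (n, 0, 0, n) w = scale_pair (of_int n) w"
  by (cases w) (simp add: scale_pair_def)

lemma normalized_scale_pair:
  "normalized M w = scale_pair (inverse (sqrt (of_int (mat_det M)))) (act M w)"
  by (simp add: normalized_def scale_pair_def Let_def)

text \<open>One matrix's share of the unfolded product of a Hecke image with \<open>g\<close>. The
  weight at \<open>w\<close> belongs to the Petersson product, the weight at \<open>act M w\<close>
  arises from unfolding; together they make the kernel symmetric.\<close>

definition hecke_kernel :: "int \<Rightarrow> (complex \<Rightarrow> complex) \<Rightarrow> (complex \<Rightarrow> complex) \<Rightarrow> mat2 \<Rightarrow> complex \<times> complex \<Rightarrow> complex" where
  "hecke_kernel k f g M w = indicator area_band w *\<^sub>R
     (of_real (fund_weight w) * (of_real (fund_weight (act M w)) * lift k f (act M w) * cnj (lift k g w)))"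

lemma hecke_kernel_measurable:
  assumes f: "f \<in> cusp_forms k" and g: "g \<in> cusp_forms k"
  shows "hecke_kernel k f g M \<in> borel_measurable borel"
proof -
  note [measurable] = lift_measurable[OF f] lift_measurable[OF g]
  have [measurable]: "cnj \<in> borel_measurable borel" by (intro borel_measurable_continuous_onI continuous_intros)
  show ?thesis unfolding hecke_kernel_def[abs_def] by measurable
qed

text \<open>Substituting \<open>w = normalized (mat_adj M) w'\<close>, so that \<open>act M w\<close> is a real multiple of \<open>w'\<close>,
  exchanges the two arguments of the kernel.\<close>

lemma hecke_kernel_adjoint:
  assumes f: "f \<in> cusp_forms k" and g: "g \<in> cusp_forms k" and M: "mat_det M > 0"
  shows "(LINT w|lborel. hecke_kernel k f g M w) = (LINT w|lborel. cnj (hecke_kernel k g f (mat_adj M) w))"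
proof -
  define n where "n = real_of_int (mat_det M)"
  have n: "n > 0" using M by (simp add: n_def)
  have r: "inverse (sqrt n) > 0" "sqrt n > 0" using n by auto
  have "hecke_kernel k f g M (normalized (mat_adj M) w) = cnj (hecke_kernel k g f (mat_adj M) w)" for w
  proof -
    define w' where "w' = normalized (mat_adj M) w"
    have w': "w' = scale_pair (inverse (sqrt n)) (act (mat_adj M) w)"
      by (simp add: w'_def normalized_scale_pair n_def)
    have "act M w' = scale_pair (inverse (sqrt n)) (act (mat_det M, 0, 0, mat_det M) w)"
      by (simp only: w' act_scale_pair act_mat_mult[symmetric] mat_mult_adj)
    also have "\<dots> = scale_pair (inverse (sqrt n) * n) w"
      unfolding act_scalar n_def by (simp add: scale_pair_def)
    also have "inverse (sqrt n) * n = sqrt n" using n by (simp add: field_simps)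
    finally have Mw: "act M w' = scale_pair (sqrt n) w" .
    have "area w' = area w"
      using n by (simp add: w' area_scale_pair area_act n_def[symmetric] power_inverse)
    hence ind: "indicator area_band w' = (indicator area_band w :: real)" by (simp add: area_band_def indicator_def)
    have "(complex_of_real (sqrt n)) powi (- k) * (complex_of_real (inverse (sqrt n))) powi (- k) = 1"
      using n by (simp add: power_int_mult_distrib[symmetric])
    thus ?thesis unfolding w'_def[symmetric] hecke_kernel_def ind Mw
      by (simp add: w' fund_weight_scale_pair[OF r(1)] fund_weight_scale_pair[OF r(2)] lift_scale_pair[OF r(1)]
          lift_scale_pair[OF r(2)] mult_ac)
  qed
  thus ?thesis using integral_normalized[OF _ hecke_kernel_measurable[OF f g], of "mat_adj M" M] M by simp
qed

text \<open>For fixed \<open>w\<close> only finitely many matrices contribute, and their sum unfolds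
  to the Hecke operator. The norms unfold in the same way to \<open>b\<close>, bounded on the band,
  and this is the absolute convergence needed to exchange sum and integral.\<close>

lemma petersson_hecke_unfold:
  assumes f: "f \<in> cusp_forms k" and g: "g \<in> cusp_forms k" and n: "n > 0"
  shows "petersson k (hecke_operator k n f) g = of_nat n powi (k - 1) *
    (LINT M|count_space {M. mat_det M = int n}. LINT w|lborel. hecke_kernel k f g M w)"
proof -
  define D where "D = {M. mat_det M = int n}"
  have cD: "countable D" by (rule countable_subset[of _ UNIV]) auto
  interpret cs: sigma_finite_measure "count_space D"
    by (rule sigma_finite_measure_count_space_countable[OF cD])
  interpret P: pair_sigma_finite lborel "count_space D" ..
  define b where "b w = (\<Sum>r\<in>hecke_reps n. cmod (lift k f (act r w)))" for w
  note [measurable] = lift_measurable[OF f]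
  have bm: "(\<lambda>w. complex_of_real (b w)) \<in> borel_measurable borel" unfolding b_def by measurable
  \<comment> \<open>Representatives multiply the area by \<open>n\<close> and so carry the band
    \<open>[1, 2]\<close> to \<open>[n, 2 n]\<close>.\<close>
  obtain C where C: "\<And>w. real n \<le> area w \<Longrightarrow> area w \<le> 2 * real n \<Longrightarrow> cmod (lift k f w) \<le> C"
    using lift_bounded[OF f, of "real n" "2 * real n"] n by auto
  have bC: "norm (complex_of_real (b w)) \<le> of_nat (card (hecke_reps n)) * C" if w: "w \<in> area_band" for w
  proof -
    have "b w \<le> of_nat (card (hecke_reps n)) * C" unfolding b_def
    proof (rule sum_bounded_above)
      fix r assume r: "r \<in> hecke_reps n"
      show "cmod (lift k f (act r w)) \<le> C"
        by (rule C) (use w mat_det_hecke_reps[OF n r] mult_left_mono[of 1 "area w" "real n"] in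
          \<open>auto simp: area_act area_band_def mult.commute mult_left_mono\<close>)
    qed
    moreover have "b w \<ge> 0" unfolding b_def by (intro sum_nonneg) auto
    ultimately show ?thesis by simp
  qed
  have fin: "finite {M \<in> D. hecke_kernel k f g M w \<noteq> 0}" for w
  proof (cases "area w > 0")
    case True
    have "finite {M. mat_det M = int n \<and> reduced_pair (act M w)}"
      by (rule hecke_unfolding(1)[OF lift_act[OF f] n True])
    thus ?thesis
      by (rule finite_subset[rotated]) (auto simp: D_def hecke_kernel_def fund_weight_def split: if_splits)
  next
    case False
    hence "hecke_kernel k f g M w = 0" for M by (simp add: hecke_kernel_def area_band_def indicator_def)
    thus ?thesis by simp
  qed
  have inner: "(LINT M|count_space D. hecke_kernel k f g M w) =
     indicator area_band w *\<^sub>R (of_real (fund_weight w) * ((\<Sum>r\<in>hecke_reps n. lift k f (act r w)) * cnj (lift k g w)))"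
    and inner_norm: "(LINT M|count_space D. norm (hecke_kernel k f g M w)) =
     norm (indicator area_band w *\<^sub>R (of_real (fund_weight w) * (of_real (b w) * cnj (lift k g w))))" for w
  proof -
    have "(LINT M|count_space D. hecke_kernel k f g M w) =
     indicator area_band w *\<^sub>R (of_real (fund_weight w) * ((\<Sum>r\<in>hecke_reps n. lift k f (act r w)) * cnj (lift k g w))) \<and>
     (LINT M|count_space D. norm (hecke_kernel k f g M w)) =
     norm (indicator area_band w *\<^sub>R (of_real (fund_weight w) * (of_real (b w) * cnj (lift k g w))))"
    proof (cases "w \<in> area_band")
      case True
      hence w: "area w > 0" by (simp add: area_band_def)
      define E where "E = {M. mat_det M = int n \<and> reduced_pair (act M w)}"
      have E: "finite E" unfolding E_def by (rule hecke_unfolding(1)[OF lift_act[OF f] n w])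
      have sub: "{M \<in> D. hecke_kernel k f g M w \<noteq> 0} \<subseteq> E"
        by (auto simp: D_def E_def hecke_kernel_def fund_weight_def split: if_splits)
      have ED: "E \<subseteq> D" by (auto simp: E_def D_def)
      have "(LINT M|count_space D. hecke_kernel k f g M w) = (\<Sum>M | M \<in> D \<and> hecke_kernel k f g M w \<noteq> 0. hecke_kernel k f g M w)"
        by (rule lebesgue_integral_count_space_finite_support[OF fin])
      also have "\<dots> = (\<Sum>M\<in>E. hecke_kernel k f g M w)"
        by (rule sum.mono_neutral_left[OF E]) (use sub ED in auto)
      also have "\<dots> = of_real (fund_weight w) * ((\<Sum>M\<in>E. of_real (fund_weight (act M w)) * lift k f (act M w)) * cnj (lift k g w))"
        using True by (simp add: hecke_kernel_def sum_distrib_left sum_distrib_right)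
      also have "(\<Sum>M\<in>E. of_real (fund_weight (act M w)) * lift k f (act M w)) = (\<Sum>r\<in>hecke_reps n. lift k f (act r w))"
        unfolding E_def by (rule hecke_unfolding(2)[OF lift_act[OF f] n w])
      finally have 1: "(LINT M|count_space D. hecke_kernel k f g M w) =
        of_real (fund_weight w) * ((\<Sum>r\<in>hecke_reps n. lift k f (act r w)) * cnj (lift k g w))" .
      have "(LINT M|count_space D. norm (hecke_kernel k f g M w)) = (\<Sum>M | M \<in> D \<and> norm (hecke_kernel k f g M w) \<noteq> 0. norm (hecke_kernel k f g M w))"
        by (rule lebesgue_integral_count_space_finite_support) (use fin in simp)
      also have "\<dots> = (\<Sum>M\<in>E. norm (hecke_kernel k f g M w))"
        by (rule sum.mono_neutral_left[OF E]) (use sub ED in auto)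
      also have "\<dots> = fund_weight w * ((\<Sum>M\<in>E. of_real (fund_weight (act M w)) * cmod (lift k f (act M w))) * cmod (lift k g w))"
        using True fund_weight_nonneg by (simp add: hecke_kernel_def sum_distrib_left sum_distrib_right norm_mult)
      also have "(\<Sum>M\<in>E. of_real (fund_weight (act M w)) * cmod (lift k f (act M w))) = b w"
        unfolding E_def b_def by (rule hecke_unfolding(2)[OF _ n w]) (simp add: lift_act[OF f])
      finally have 2: "(LINT M|count_space D. norm (hecke_kernel k f g M w)) = fund_weight w * (b w * cmod (lift k g w))" .
      have "b w \<ge> 0" unfolding b_def by (intro sum_nonneg) auto
      thus ?thesis using True 1 2 fund_weight_nonneg[of w] by (simp add: norm_mult)
    qed (simp add: hecke_kernel_def)
    thus "(LINT M|count_space D. hecke_kernel k f g M w) =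
     indicator area_band w *\<^sub>R (of_real (fund_weight w) * ((\<Sum>r\<in>hecke_reps n. lift k f (act r w)) * cnj (lift k g w)))"
     "(LINT M|count_space D. norm (hecke_kernel k f g M w)) =
     norm (indicator area_band w *\<^sub>R (of_real (fund_weight w) * (of_real (b w) * cnj (lift k g w))))" by blast+
  qed
  have "integrable (lborel \<Otimes>\<^sub>M count_space D) (\<lambda>(w, M). hecke_kernel k f g M w)"
  proof (rule P.Fubini_integrable)
    have "(\<lambda>(M, w). hecke_kernel k f g M w) \<in> borel_measurable (count_space D \<Otimes>\<^sub>M lborel)"
      by (rule count_measurable_aux, rule hecke_kernel_measurable[OF f g])
    thus "(\<lambda>(w, M). hecke_kernel k f g M w) \<in> borel_measurable (lborel \<Otimes>\<^sub>M count_space D)"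
      by (rule measurable_pair_swap[unfolded case_prod_unfold, THEN back_subst[of "\<lambda>f. f \<in> _"]]) auto
    have "integrable lborel (\<lambda>w. norm (indicator area_band w *\<^sub>R (of_real (fund_weight w) * (of_real (b w) * cnj (lift k g w)))))"
      by (intro integrable_norm weighted_lift_integrable[OF g bm bC])
    thus "integrable lborel (\<lambda>w. LINT M|count_space D. norm (case (w, M) of (w, M) \<Rightarrow> hecke_kernel k f g M w))"
      by (simp add: inner_norm)
    have "integrable (count_space D) (\<lambda>M. hecke_kernel k f g M w)" for w
    proof (rule integrableI_bounded)
      have "finite {M \<in> D. 0 < ennreal (norm (hecke_kernel k f g M w))}" using fin[of w] by simp
      thus "(\<integral>\<^sup>+M. ennreal (norm (hecke_kernel k f g M w)) \<partial>count_space D) < \<infinity>"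
        by (simp add: nn_integral_count_space)
    qed simp
    thus "AE w in lborel. integrable (count_space D) (\<lambda>M. case (w, M) of (w, M) \<Rightarrow> hecke_kernel k f g M w)" by simp
  qed
  hence "(LINT M|count_space D. LINT w|lborel. hecke_kernel k f g M w) = (LINT w|lborel. LINT M|count_space D. hecke_kernel k f g M w)"
    by (rule P.Fubini_integral)
  also have "of_nat n powi (k - 1) * \<dots> = petersson k (hecke_operator k n f) g"
    unfolding petersson_def integral_mult_right_zero[symmetric] inner
  proof (intro Bochner_Integration.integral_cong refl)
    fix w
    show "of_nat n powi (k - 1) * (indicat_real area_band w *\<^sub>R (of_real (fund_weight w) * ((\<Sum>r\<in>hecke_reps n. lift k f (act r w)) * cnj (lift k g w))))
      = indicat_real area_band w *\<^sub>R (of_real (fund_weight w) * (lift k (hecke_operator k n f) w * cnj (lift k g w)))"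
      by (cases "w \<in> area_band") (auto simp: lift_hecke_operator[OF n] area_band_def)
  qed
  finally show ?thesis by (simp add: D_def)
qed

lemma hecke_operator_selfadjoint:
  assumes f: "f \<in> cusp_forms k" and g: "g \<in> cusp_forms k" and n: "n > 0"
  shows "petersson k (hecke_operator k n f) g = petersson k f (hecke_operator k n g)"
proof -
  define D where "D = {M. mat_det M = int n}"
  define J where "J M = (LINT w|lborel. hecke_kernel k g f M w)" for M
  have c: "cnj (of_nat n powi (k - 1)) = of_nat n powi (k - 1)" by simp
  have bij: "bij_betw mat_adj D D"
    by (rule bij_betwI[of _ _ _ mat_adj]) (auto simp: D_def simp del: mat_adj.simps mat_det.simps)
  have "petersson k (hecke_operator k n f) g = of_nat n powi (k - 1) *
    (LINT M|count_space D. LINT w|lborel. hecke_kernel k f g M w)"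
    unfolding D_def by (rule petersson_hecke_unfold[OF f g n])
  also have "(LINT M|count_space D. LINT w|lborel. hecke_kernel k f g M w) = (LINT M|count_space D. cnj (J (mat_adj M)))"
  proof (intro Bochner_Integration.integral_cong refl)
    fix M assume "M \<in> space (count_space D)"
    hence "mat_det M > 0" using n by (simp add: D_def)
    from hecke_kernel_adjoint[OF f g this]
    show "(LINT w|lborel. hecke_kernel k f g M w) = cnj (J (mat_adj M))" by (simp add: J_def)
  qed
  also have "\<dots> = cnj (LINT M|count_space D. J (mat_adj M))" by simp
  also have "(LINT M|count_space D. J (mat_adj M)) = (LINT M|count_space D. J M)"
    by (rule integral_bij_count_space[OF bij])
  also have "of_nat n powi (k - 1) * cnj (LINT M|count_space D. J M) =
     cnj (of_nat n powi (k - 1) * (LINT M|count_space D. J M))" by simp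
  also have "of_nat n powi (k - 1) * (LINT M|count_space D. J M) = petersson k (hecke_operator k n g) f"
    unfolding D_def J_def by (rule petersson_hecke_unfold[OF g f n, symmetric])
  also have "cnj (petersson k (hecke_operator k n g) f) = petersson k f (hecke_operator k n g)"
    by (rule petersson_commute[OF hecke_operator_cusp_form[OF g n] f, symmetric])
  finally show ?thesis .
qed

subsection \<open>Existence of eigenforms\<close>

text \<open>Gaussian elimination for a homogeneous system with fewer equations than unknowns: the
  pivot \<open>r\<close> eliminates the equation \<open>i0\<close>, and induction treats the
  rest.\<close>

lemma nontrivial_relation:
  fixes v :: "'b \<Rightarrow> 'c \<Rightarrow> complex"
  assumes "finite I" "finite J" "card I < card J"
  shows "\<exists>c. (\<exists>j\<in>J. c j \<noteq> 0) \<and> (\<forall>i\<in>I. (\<Sum>j\<in>J. c j * v j i) = 0)"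
  using assms
proof (induction I arbitrary: J v rule: finite_induct)
  case empty
  then obtain j where "j \<in> J" by fastforce
  thus ?case by (intro exI[of _ "\<lambda>j. 1"]) auto
next
  case (insert i0 I)
  show ?case
  proof (cases "\<forall>j\<in>J. v j i0 = 0")
    case True
    have "card I < card J" using insert by simp
    from insert.IH[OF insert.prems(1) this, of v] obtain c
      where c: "\<exists>j\<in>J. c j \<noteq> 0" "\<forall>i\<in>I. (\<Sum>j\<in>J. c j * v j i) = 0" by blast
    have "(\<Sum>j\<in>J. c j * v j i0) = 0" by (rule sum.neutral) (use True in simp)
    thus ?thesis using c by (intro exI[of _ c]) simp
  next
    case False
    then obtain r where r: "r \<in> J" "v r i0 \<noteq> 0" by blast
    define w where "w j i = v j i - v j i0 / v r i0 * v r i" for j i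
    have "finite (J - {r})" "card I < card (J - {r})" using insert r by auto
    from insert.IH[OF this, of w] obtain c where c: "\<exists>j\<in>J - {r}. c j \<noteq> 0"
      "\<And>i. i \<in> I \<Longrightarrow> (\<Sum>j\<in>J - {r}. c j * w j i) = 0" by blast
    \<comment> \<open>The coefficient of the pivot is determined by the equation
      \<open>i0\<close>.\<close>
    define s where "s = (\<Sum>j\<in>J - {r}. c j * v j i0) / v r i0"
    define d where "d = c(r := - s)"
    have sum: "(\<Sum>j\<in>J. d j * v j i) = (\<Sum>j\<in>J - {r}. c j * v j i) - s * v r i" for i
    proof -
      have "(\<Sum>j\<in>J. d j * v j i) = d r * v r i + (\<Sum>j\<in>J - {r}. d j * v j i)"
        using r(1) insert.prems(1) by (simp add: sum.remove)
      also have "(\<Sum>j\<in>J - {r}. d j * v j i) = (\<Sum>j\<in>J - {r}. c j * v j i)"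
        by (rule sum.cong) (auto simp: d_def)
      finally show ?thesis by (simp add: d_def)
    qed
    have "(\<Sum>j\<in>J. d j * v j i) = 0" if i: "i \<in> insert i0 I" for i
    proof (cases "i = i0")
      case True thus ?thesis unfolding sum using r(2) by (simp add: s_def)
    next
      case False
      have "(\<Sum>j\<in>J - {r}. c j * w j i) = (\<Sum>j\<in>J - {r}. c j * v j i) - s * v r i"
        by (simp add: w_def s_def right_diff_distrib sum_subtractf sum_distrib_right sum_divide_distrib mult.assoc)
      thus ?thesis unfolding sum using c(2)[of i] i False by simp
    qed
    moreover have "\<exists>j\<in>J. d j \<noteq> 0" using c(1) by (auto simp: d_def)
    ultimately show ?thesis by blast
  qed
qed

section \<open>Diagonalization of one Hecke operator\<close>

definition poly_hecke :: "int \<Rightarrow> nat \<Rightarrow> complex poly \<Rightarrow> (complex \<Rightarrow> complex) \<Rightarrow> complex \<Rightarrow> complex" where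
  "poly_hecke k p P f t = (\<Sum>i\<le>degree P. coeff P i * (hecke_operator k p ^^ i) f t)"

lemma poly_hecke_bound:
  assumes "degree P \<le> N"
  shows "poly_hecke k p P f t = (\<Sum>i\<le>N. coeff P i * (hecke_operator k p ^^ i) f t)"
  unfolding poly_hecke_def
  by (rule sum.mono_neutral_left) (use assms in \<open>auto simp: coeff_eq_0\<close>)

lemma hecke_operator_diff_scale:
  "hecke_operator k p (\<lambda>t. f t - c * g t) = (\<lambda>t. hecke_operator k p f t - c * hecke_operator k p g t)"
  using hecke_operator_add[of k p f "\<lambda>t. (- c) * g t"] hecke_operator_scale[of k p "- c" g] by simp

lemma hecke_power_diff_scale:
  "(hecke_operator k p ^^ i) (\<lambda>t. f t - c * g t) = (\<lambda>t. (hecke_operator k p ^^ i) f t - c * (hecke_operator k p ^^ i) g t)"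
  by (induction i) (simp_all add: hecke_operator_diff_scale)

lemma poly_hecke_linear_factor:
  "poly_hecke k p ([:- r, 1:] * Q) f = poly_hecke k p Q (\<lambda>t. hecke_operator k p f t - r * f t)"
proof
  fix t
  define T where "T = hecke_operator k p"
  define N where "N = Suc (degree Q)"
  have "degree ([:- r, 1:] * Q) \<le> degree [:- r, 1:] + degree Q" by (rule degree_mult_le)
  hence "degree ([:- r, 1:] * Q) \<le> N" by (simp add: N_def)
  hence "poly_hecke k p ([:- r, 1:] * Q) f t = (\<Sum>i\<le>N. coeff ([:- r, 1:] * Q) i * (T ^^ i) f t)"
    unfolding T_def by (rule poly_hecke_bound)
  also have "\<dots> = (\<Sum>i\<le>N. coeff (pCons 0 Q) i * (T ^^ i) f t) - r * (\<Sum>i\<le>N. coeff Q i * (T ^^ i) f t)"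
    by (simp add: sum_distrib_left sum_subtractf[symmetric] algebra_simps)
  also have "(\<Sum>i\<le>N. coeff (pCons 0 Q) i * (T ^^ i) f t) = (\<Sum>i\<le>degree Q. coeff Q i * (T ^^ Suc i) f t)"
    unfolding N_def sum.atMost_Suc_shift by simp
  also have "(\<Sum>i\<le>N. coeff Q i * (T ^^ i) f t) = (\<Sum>i\<le>degree Q. coeff Q i * (T ^^ i) f t)"
    unfolding N_def by (simp add: coeff_eq_0)
  also have "(\<Sum>i\<le>degree Q. coeff Q i * (T ^^ Suc i) f t) - r * (\<Sum>i\<le>degree Q. coeff Q i * (T ^^ i) f t) =
      poly_hecke k p Q (\<lambda>t. T f t - r * f t) t"
    unfolding poly_hecke_def T_def hecke_power_diff_scale
    by (simp add: sum_distrib_left sum_subtractf[symmetric] algebra_simps funpow_swap1)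
  finally show "poly_hecke k p ([:- r, 1:] * Q) f t = poly_hecke k p Q (\<lambda>t. hecke_operator k p f t - r * f t) t"
    by (simp add: T_def)
qed

lemma hecke_power_cusp_form:
  assumes "f \<in> cusp_forms k" "n > 0"
  shows "(hecke_operator k n ^^ i) f \<in> cusp_forms k"
  by (induction i) (use assms hecke_operator_cusp_form in auto)

lemma cusp_forms_sum:
  assumes "finite A" "\<And>i. i \<in> A \<Longrightarrow> F i \<in> cusp_forms k"
  shows "(\<lambda>t. \<Sum>i\<in>A. c i * F i t) \<in> cusp_forms k \<and>
    fourier_coeff (\<lambda>t. \<Sum>i\<in>A. c i * F i t) = (\<lambda>n. \<Sum>i\<in>A. c i * fourier_coeff (F i) n)"
  using assms
proof (induction A rule: finite_induct)
  case empty
  have "fourier_coeff (\<lambda>t. 0) = (\<lambda>n. 0)"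
    by (rule fourier_coeff_eq) (simp add: q_expansion_def)
  thus ?case by (simp add: zero_cusp_form)
next
  case (insert a A)
  have 1: "(\<lambda>t. c a * F a t) \<in> cusp_forms k" using insert by (intro cusp_forms_scale) auto
  have 2: "(\<lambda>t. \<Sum>i\<in>A. c i * F i t) \<in> cusp_forms k"
    "fourier_coeff (\<lambda>t. \<Sum>i\<in>A. c i * F i t) = (\<lambda>n. \<Sum>i\<in>A. c i * fourier_coeff (F i) n)"
    using insert by auto
  show ?case using insert.hyps cusp_forms_add[OF 1 2(1)] fourier_coeff_add[OF 1 2(1)]
      fourier_coeff_scale[of "F a" k "c a"] insert.prems 2(2) by simp
qed

text \<open>The \<open>m + 1\<close> iterates \<open>f, T f, ..., T^m f\<close> satisfy a linear
  relation in their first \<open>m\<close> Fourier coefficients, and a form of this weight whose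
  first \<open>m\<close> coefficients vanish is zero.\<close>

lemma annihilating_polynomial:
  assumes f: "f \<in> cusp_forms k" and n: "n > 0"
  shows "\<exists>P. P \<noteq> 0 \<and> poly_hecke k n P f = (\<lambda>t. 0)"
proof -
  \<comment> \<open>Positive, and with \<open>k \<le> 10 * int m\<close> also when \<open>k\<close>
    is not positive.\<close>
  define m where "m = nat k + 1"
  define T where "T = hecke_operator k n"
  define v where "v j i = fourier_coeff ((T ^^ j) f) i" for j i
  obtain c where c: "\<exists>j\<in>{..m}. c j \<noteq> 0" "\<And>i. i \<in> {..<m} \<Longrightarrow> (\<Sum>j\<le>m. c j * v j i) = 0"
    using nontrivial_relation[of "{..<m}" "{..m}" v] by auto
  define P where "P = (\<Sum>j\<le>m. monom (c j) j)"
  have cP: "coeff P i = (if i \<le> m then c i else 0)" for i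
    by (auto simp: P_def coeff_sum coeff_monom)
  have "P \<noteq> 0" using c(1) cP by (metis atMost_iff coeff_0)
  have "degree P \<le> m" by (rule degree_le) (simp add: cP)
  hence Pf: "poly_hecke k n P f = (\<lambda>t. \<Sum>i\<le>m. c i * (T ^^ i) f t)"
    by (simp add: fun_eq_iff poly_hecke_bound cP T_def)
  have cs: "(\<lambda>t. \<Sum>i\<in>{..m}. c i * (T ^^ i) f t) \<in> cusp_forms k \<and>
    fourier_coeff (\<lambda>t. \<Sum>i\<in>{..m}. c i * (T ^^ i) f t) = (\<lambda>n. \<Sum>i\<in>{..m}. c i * fourier_coeff ((T ^^ i) f) n)"
    by (rule cusp_forms_sum) (auto simp: T_def hecke_power_cusp_form[OF f n])
  have "(\<lambda>t. \<Sum>i\<le>m. c i * (T ^^ i) f t) = (\<lambda>t. 0)"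
    by (rule cusp_form_eq_0_if_high_order[of _ k m])
      (use cs c(2) in \<open>auto simp: v_def m_def\<close>)
  thus ?thesis using Pf \<open>P \<noteq> 0\<close> by auto
qed

definition hecke_stable :: "int \<Rightarrow> (complex \<Rightarrow> complex) set \<Rightarrow> bool" where
  "hecke_stable k W \<longleftrightarrow> W \<subseteq> cusp_forms k \<and> (\<lambda>t. 0) \<in> W \<and>
     (\<forall>f\<in>W. \<forall>g\<in>W. (\<lambda>t. f t + g t) \<in> W) \<and> (\<forall>c. \<forall>f\<in>W. (\<lambda>t. c * f t) \<in> W) \<and>
     (\<forall>p. prime p \<longrightarrow> (\<forall>f\<in>W. hecke_operator k p f \<in> W))"

lemma hecke_stableD:
  assumes "hecke_stable k W"
  shows "f \<in> W \<Longrightarrow> f \<in> cusp_forms k" "(\<lambda>t. 0) \<in> W"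
    "f \<in> W \<Longrightarrow> g \<in> W \<Longrightarrow> (\<lambda>t. f t + g t) \<in> W" "f \<in> W \<Longrightarrow> (\<lambda>t. c * f t) \<in> W"
    "prime p \<Longrightarrow> f \<in> W \<Longrightarrow> hecke_operator k p f \<in> W"
  using assms by (simp_all add: hecke_stable_def subset_iff)

lemma hecke_stable_diff_scale:
  assumes "hecke_stable k W" "f \<in> W" "g \<in> W"
  shows "(\<lambda>t. f t - c * g t) \<in> W"
  using hecke_stableD(3)[OF assms(1,2) hecke_stableD(4)[OF assms(1,3), of "- c"]] by simp

lemma hecke_stable_cusp_forms: "hecke_stable k (cusp_forms k)"
  by (simp add: hecke_stable_def zero_cusp_form cusp_forms_add cusp_forms_scale hecke_operator_cusp_form prime_gt_0_nat)

text \<open>Diagonalizability without a choice of basis: an additive functional that is nonzero on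
  such a sum is nonzero on one of the eigenvectors, which is what the search for an eigenform
  uses.\<close>

inductive eigen_sum :: "int \<Rightarrow> nat \<Rightarrow> (complex \<Rightarrow> complex) set \<Rightarrow> (complex \<Rightarrow> complex) \<Rightarrow> bool"
  for k p W where
  eigen: "f \<in> W \<Longrightarrow> hecke_operator k p f = (\<lambda>t. c * f t) \<Longrightarrow> eigen_sum k p W f"
| add: "eigen_sum k p W f \<Longrightarrow> eigen_sum k p W g \<Longrightarrow> eigen_sum k p W (\<lambda>t. f t + g t)"

lemma hecke_operator_0: "hecke_operator k n (\<lambda>t. 0) = (\<lambda>t. 0)"
  by (simp add: hecke_operator_def fun_eq_iff)

lemma eigen_sum_zero: "hecke_stable k W \<Longrightarrow> eigen_sum k p W (\<lambda>t. 0)"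
  by (rule eigen_sum.eigen[of _ _ _ _ 0]) (simp_all add: hecke_stableD hecke_operator_0)

lemma eigen_sum_in:
  assumes "hecke_stable k W" "eigen_sum k p W f"
  shows "f \<in> W"
  using assms(2) by induction (auto intro: hecke_stableD(3)[OF assms(1)])

text \<open>On an eigenvector with eigenvalue \<open>c \<noteq> r\<close> the operator
  \<open>T - r\<close> is multiplication by \<open>c - r\<close> and can be inverted; eigenvectors
  with eigenvalue \<open>r\<close> are collected in \<open>g0\<close>.\<close>

lemma eigen_sum_preimage:
  assumes W: "hecke_stable k W" and g: "eigen_sum k p W g"
  shows "\<exists>h g0. eigen_sum k p W h \<and> g0 \<in> W \<and> hecke_operator k p g0 = (\<lambda>t. r * g0 t) \<and>
    g = (\<lambda>t. hecke_operator k p h t - r * h t + g0 t)"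
  using g
proof (induction rule: eigen_sum.induct)
  case (eigen f c)
  show ?case
  proof (cases "c = r")
    case True
    show ?thesis
      by (rule exI[of _ "\<lambda>t. 0"], rule exI[of _ f])
        (use eigen True eigen_sum_zero[OF W] in \<open>simp add: hecke_operator_0\<close>)
  next
    case False
    define h where "h = (\<lambda>t. (1 / (c - r)) * f t)"
    have Th: "hecke_operator k p h = (\<lambda>t. c * h t)"
      unfolding h_def hecke_operator_scale eigen(2) by (simp add: fun_eq_iff)
    have "h \<in> W" unfolding h_def by (rule hecke_stableD(4)[OF W eigen(1)])
    hence "eigen_sum k p W h" using Th by (rule eigen_sum.eigen)
    moreover have "f = (\<lambda>t. hecke_operator k p h t - r * h t + 0)"
    proof
      fix t
      have "f t = (c - r) * h t" using False by (simp add: h_def)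
      thus "f t = hecke_operator k p h t - r * h t + 0" by (simp add: Th left_diff_distrib)
    qed
    ultimately show ?thesis
      by (intro exI[of _ h] exI[of _ "\<lambda>t. 0"]) (use hecke_stableD(2)[OF W] in \<open>simp add: hecke_operator_0\<close>)
  qed
next
  case (add f g)
  obtain h1 g1 where 1: "eigen_sum k p W h1" "g1 \<in> W" "hecke_operator k p g1 = (\<lambda>t. r * g1 t)"
    "f = (\<lambda>t. hecke_operator k p h1 t - r * h1 t + g1 t)" using add.IH(1) by blast
  obtain h2 g2 where 2: "eigen_sum k p W h2" "g2 \<in> W" "hecke_operator k p g2 = (\<lambda>t. r * g2 t)"
    "g = (\<lambda>t. hecke_operator k p h2 t - r * h2 t + g2 t)" using add.IH(2) by blast
  show ?case
  proof (intro exI conjI)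
    show "eigen_sum k p W (\<lambda>t. h1 t + h2 t)" by (rule eigen_sum.add[OF 1(1) 2(1)])
    show "(\<lambda>t. g1 t + g2 t) \<in> W" by (rule hecke_stableD(3)[OF W 1(2) 2(2)])
    show "hecke_operator k p (\<lambda>t. g1 t + g2 t) = (\<lambda>t. r * (g1 t + g2 t))"
      unfolding hecke_operator_add 1(3) 2(3) by (simp add: algebra_simps)
    show "(\<lambda>t. f t + g t) = (\<lambda>t. hecke_operator k p (\<lambda>t. h1 t + h2 t) t - r * (h1 t + h2 t) + (g1 t + g2 t))"
    proof
      fix t
      have "f t + g t = (hecke_operator k p h1 t - r * h1 t + g1 t) + (hecke_operator k p h2 t - r * h2 t + g2 t)"
        by (simp only: fun_cong[OF 1(4), of t] fun_cong[OF 2(4), of t])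
      thus "f t + g t = hecke_operator k p (\<lambda>t. h1 t + h2 t) t - r * (h1 t + h2 t) + (g1 t + g2 t)"
        unfolding hecke_operator_add by (simp only: algebra_simps)
    qed
  qed
qed

text \<open>The number of leading orders is the dimension of \<open>W\<close>.\<close>

definition leading_orders :: "(complex \<Rightarrow> complex) set \<Rightarrow> nat set" where
  "leading_orders W = {n. \<exists>f\<in>W. fourier_coeff f n \<noteq> 0 \<and> (\<forall>i<n. fourier_coeff f i = 0)}"

lemma leading_orders_bound:
  assumes "hecke_stable k W"
  shows "leading_orders W \<subseteq> {..<nat k + 1}"
proof
  fix n assume "n \<in> leading_orders W"
  then obtain f where f: "f \<in> W" "fourier_coeff f n \<noteq> 0" "\<And>i. i < n \<Longrightarrow> fourier_coeff f i = 0"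
    by (auto simp: leading_orders_def)
  show "n \<in> {..<nat k + 1}"
  proof (rule ccontr)
    assume "n \<notin> {..<nat k + 1}"
    hence "f = (\<lambda>t. 0)"
      using hecke_stableD(1)[OF assms f(1)] f(3) by (intro cusp_form_eq_0_if_high_order[of f k n]) auto
    moreover have "fourier_coeff (\<lambda>t. 0) = (\<lambda>n. 0)" by (rule fourier_coeff_eq) (simp add: q_expansion_def)
    ultimately show False using f(2) by simp
  qed
qed

text \<open>Equal cardinality means equal sets of leading orders. As in an echelon form, any member
  of \<open>W\<close> is then reduced to zero by subtracting multiples of members of
  \<open>W'\<close> with the same leading order.\<close>

lemma stable_subset_eq:
  assumes W: "hecke_stable k W" and W': "hecke_stable k W'" and sub: "W' \<subseteq> W"
    and le: "card (leading_orders W) \<le> card (leading_orders W')"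
  shows "W' = W"
proof -
  define m where "m = nat k + 1"
  have "leading_orders W' \<subseteq> leading_orders W" using sub by (auto simp: leading_orders_def)
  hence eq: "leading_orders W' = leading_orders W"
    using leading_orders_bound[OF W] le by (intro card_seteq) (auto intro: finite_subset)
  \<comment> \<open>Induction on how far the vanishing order falls short of \<open>m\<close>:
    \<open>d = 0\<close> forces the form to be zero, \<open>d = m\<close> imposes nothing.\<close>
  have "f \<in> W'" if "f \<in> W" "\<forall>i<m - d. fourier_coeff f i = 0" for d f
    using that
  proof (induction d arbitrary: f)
    case 0
    have "f = (\<lambda>t. 0)"
      using hecke_stableD(1)[OF W 0(1)] 0(2) by (intro cusp_form_eq_0_if_high_order[of f k m]) (auto simp: m_def)
    thus ?case using hecke_stableD(2)[OF W'] by simp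
  next
    case (Suc d)
    define n where "n = m - Suc d"
    show ?case
    \<comment> \<open>For \<open>d \<ge> m\<close> the truncated difference is already 0, and the
      claim for \<open>Suc d\<close> is the claim for \<open>d\<close>.\<close>
    proof (cases "d < m \<and> fourier_coeff f n \<noteq> 0")
      case False
      have "\<forall>i<m - d. fourier_coeff f i = 0"
      proof (intro allI impI)
        fix i assume "i < m - d"
        hence "i < n \<or> (i = n \<and> d < m)" by (auto simp: n_def)
        thus "fourier_coeff f i = 0" using Suc.prems(2) False by (auto simp: n_def)
      qed
      thus ?thesis by (rule Suc.IH[OF Suc.prems(1)])
    next
      case True
      hence "n \<in> leading_orders W" using Suc.prems by (auto simp: leading_orders_def n_def)
      then obtain g where g: "g \<in> W'" "fourier_coeff g n \<noteq> 0" "\<And>i. i < n \<Longrightarrow> fourier_coeff g i = 0"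
        unfolding eq[symmetric] by (auto simp: leading_orders_def)
      define c where "c = fourier_coeff f n / fourier_coeff g n"
      define h where "h = (\<lambda>t. f t - c * g t)"
      have gW: "g \<in> W" using g sub by blast
      have hW: "h \<in> W" unfolding h_def by (rule hecke_stable_diff_scale[OF W Suc.prems(1) gW])
      have "h = (\<lambda>t. f t + (- c) * g t)" by (simp add: h_def)
      hence ch: "fourier_coeff h = (\<lambda>i. fourier_coeff f i - c * fourier_coeff g i)"
        using fourier_coeff_add[OF hecke_stableD(1)[OF W Suc.prems(1)] cusp_forms_scale[OF hecke_stableD(1)[OF W gW], of "- c"]]
          fourier_coeff_scale[OF hecke_stableD(1)[OF W gW], of "- c"] by simp
      have "\<forall>i<m - d. fourier_coeff h i = 0"
      proof (intro allI impI)
        fix i assume "i < m - d"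
        hence "i < n \<or> i = n" by (auto simp: n_def)
        thus "fourier_coeff h i = 0" using Suc.prems(2) g by (auto simp: ch c_def n_def)
      qed
      hence "h \<in> W'" by (rule Suc.IH[OF hW])
      hence "(\<lambda>t. h t - (- c) * g t) \<in> W'" using g(1) by (rule hecke_stable_diff_scale[OF W'])
      thus ?thesis by (simp add: h_def)
    qed
  qed
  from this[of _ m] have "W \<subseteq> W'" by auto
  thus ?thesis using sub by blast
qed

text \<open>Let \<open>r\<close> be a root of \<open>P\<close>. By induction
  \<open>(T - r) f\<close> is a sum of eigenvectors, hence equals \<open>(T - r) h + g0\<close> with
  \<open>T g0 = r g0\<close>. Then \<open>u = f - h\<close> satisfies \<open>(T - r) u = g0\<close>,
  a Jordan block unless \<open>g0 = 0\<close>. Self-adjointness excludes it: the product of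
  \<open>(T - r) u\<close> with \<open>g0\<close> equals that of \<open>u\<close> with
  \<open>(T - r) g0 = 0\<close>.\<close>

lemma poly_hecke_imp_eigen_sum:
  assumes W: "hecke_stable k W" and p: "prime p"
  shows "P \<noteq> 0 \<Longrightarrow> f \<in> W \<Longrightarrow> poly_hecke k p P f = (\<lambda>t. 0) \<Longrightarrow> eigen_sum k p W f"
proof (induction "degree P" arbitrary: P f)
  case 0
  have "coeff P 0 \<noteq> 0" using 0 by (metis leading_coeff_0_iff)
  moreover have "coeff P 0 * f t = 0" for t
    using fun_cong[OF 0(4), of t] 0(1) by (simp add: poly_hecke_def)
  ultimately have "f = (\<lambda>t. 0)" by (simp add: fun_eq_iff)
  thus ?case using eigen_sum_zero[OF W] by simp
next
  case (Suc d)
  have p0: "p > 0" using p by (rule prime_gt_0_nat)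
  define T where "T = hecke_operator k p"
  have "\<not> constant (poly P)" using Suc.hyps(2) by (simp add: constant_degree)
  then obtain r where "poly P r = 0" using fundamental_theorem_of_algebra by blast
  then obtain Q where Q: "P = [:- r, 1:] * Q" by (auto simp: poly_eq_0_iff_dvd)
  have Q0: "Q \<noteq> 0" using Suc.prems(1) Q by auto
  have "degree P = degree [:- r, 1:] + degree Q" unfolding Q by (rule degree_mult_eq) (use Q0 in auto)
  hence d: "d = degree Q" using Suc.hyps(2) by simp
  define g where "g = (\<lambda>t. T f t - r * f t)"
  have fW: "f \<in> W" by fact
  have gW: "g \<in> W" unfolding g_def T_def
    by (rule hecke_stable_diff_scale[OF W hecke_stableD(5)[OF W p fW] fW])
  have "poly_hecke k p Q g = (\<lambda>t. 0)"
    using Suc.prems(3) unfolding Q poly_hecke_linear_factor g_def T_def .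
  hence "eigen_sum k p W g" by (rule Suc.hyps(1)[OF d Q0 gW])
  then obtain h g0 where h: "eigen_sum k p W h" "g0 \<in> W" "T g0 = (\<lambda>t. r * g0 t)"
    "g = (\<lambda>t. T h t - r * h t + g0 t)" unfolding T_def using eigen_sum_preimage[OF W, of p g r] by blast
  have hW: "h \<in> W" by (rule eigen_sum_in[OF W h(1)])
  define u where "u = (\<lambda>t. f t - 1 * h t)"
  have uW: "u \<in> W" unfolding u_def by (rule hecke_stable_diff_scale[OF W fW hW])
  have Tu: "T u = (\<lambda>t. r * u t + g0 t)"
  proof
    fix t
    have "T u t = T f t - T h t"
      using fun_cong[OF hecke_operator_diff_scale[of k p f 1 h], of t] by (simp add: u_def T_def)
    moreover have "T f t - r * f t = T h t - r * h t + g0 t" using fun_cong[OF h(4), of t] by (simp add: g_def)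
    ultimately have "T u t = r * (f t - h t) + g0 t" by algebra
    thus "T u t = r * u t + g0 t" by (simp add: u_def)
  qed
  note cW = hecke_stableD(1)[OF W]
  have "g0 = (\<lambda>t. 0)"
  proof (rule petersson_definite[OF cW[OF h(2)]], rule ccontr)
    assume nz: "petersson k g0 g0 \<noteq> 0"
    have sa: "petersson k (T x) y = petersson k x (T y)" if "x \<in> W" "y \<in> W" for x y
      unfolding T_def by (rule hecke_operator_selfadjoint[OF cW[OF that(1)] cW[OF that(2)] p0])
    have right: "petersson k x (\<lambda>t. r * g0 t) = cnj r * petersson k x g0" if "x \<in> W" for x
      using petersson_commute[OF cusp_forms_scale[OF cW[OF h(2)], of r] cW[OF that]]
        petersson_commute[OF cW[OF h(2)] cW[OF that]]
      by (simp add: petersson_scale_left)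
    \<comment> \<open>The eigenvalue is real, by moving the operator from one argument to the other;
      without this \<open>T - r\<close> would not be self-adjoint.\<close>
    have "r * petersson k g0 g0 = cnj r * petersson k g0 g0"
      using sa[OF h(2) h(2)] unfolding h(3) petersson_scale_left right[OF h(2)] .
    hence r: "cnj r = r" using nz by simp
    have "petersson k (T u) g0 = r * petersson k u g0 + petersson k g0 g0"
      unfolding Tu petersson_add_left[OF cusp_forms_scale[OF cW[OF uW]] cW[OF h(2)] cW[OF h(2)]] petersson_scale_left ..
    moreover have "petersson k (T u) g0 = r * petersson k u g0"
      unfolding sa[OF uW h(2)] h(3) right[OF uW] r ..
    ultimately show False using nz by simp
  qed
  hence "T u = (\<lambda>t. r * u t)" using Tu by simp
  hence "eigen_sum k p W u" unfolding T_def by (rule eigen_sum.eigen[OF uW])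
  from eigen_sum.add[OF h(1) this] show ?case by (simp add: u_def)
qed

lemma hecke_diagonalizable:
  assumes "hecke_stable k W" "prime p" "f \<in> W"
  shows "eigen_sum k p W f"
  using annihilating_polynomial[OF hecke_stableD(1)[OF assms(1,3)] prime_gt_0_nat[OF assms(2)]]
    poly_hecke_imp_eigen_sum[OF assms(1,2) _ assms(3)] by blast

text \<open>Decomposing \<open>f\<close> under one operator gives an eigenvector in \<open>W\<close>
  outside the kernel. The eigenspace \<open>W'\<close> containing it is stable because the Hecke
  operators commute, so minimality forces \<open>W' = W\<close>, and the operator is a scalar on
  \<open>W\<close>.\<close>

lemma exists_eigenform_not_in_kernel:
  fixes L :: "(complex \<Rightarrow> complex) \<Rightarrow> complex"
  assumes add: "\<And>f g. f \<in> cusp_forms k \<Longrightarrow> g \<in> cusp_forms k \<Longrightarrow> L (\<lambda>t. f t + g t) = L f + L g"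
    and scale: "\<And>c f. f \<in> cusp_forms k \<Longrightarrow> L (\<lambda>t. c * f t) = c * L f"
    and f0: "f0 \<in> cusp_forms k" "L f0 \<noteq> 0"
  shows "\<exists>f. cuspidal_hecke_eigenform k f \<and> L f \<noteq> 0"
proof -
  define Q where "Q W \<longleftrightarrow> hecke_stable k W \<and> (\<exists>f\<in>W. L f \<noteq> 0)" for W
  have "Q (cusp_forms k)" using f0 hecke_stable_cusp_forms by (auto simp: Q_def)
  then obtain W where W: "Q W" "\<And>W'. Q W' \<Longrightarrow> card (leading_orders W) \<le> card (leading_orders W')"
    using ex_has_least_nat[of Q "cusp_forms k" "\<lambda>W. card (leading_orders W)"] by blast
  have stable: "hecke_stable k W" using W(1) by (simp add: Q_def)
  obtain f where f: "f \<in> W" "L f \<noteq> 0" using W(1) by (auto simp: Q_def)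
  note cW = hecke_stableD(1)[OF stable]
  have scalar: "\<exists>c. hecke_operator k p f = (\<lambda>t. c * f t)" if p: "prime p" for p
  proof -
    have "\<exists>g\<in>W. L g \<noteq> 0 \<and> (\<exists>c. hecke_operator k p g = (\<lambda>t. c * g t))"
      if "eigen_sum k p W h" "L h \<noteq> 0" for h
      using that
    proof (induction rule: eigen_sum.induct)
      case (eigen h c) thus ?case by blast
    next
      case (add h1 h2)
      have "h1 \<in> cusp_forms k" "h2 \<in> cusp_forms k"
        using add.hyps eigen_sum_in[OF stable] cW by blast+
      hence "L (\<lambda>t. h1 t + h2 t) = L h1 + L h2" by (rule assms(1))
      hence "L h1 \<noteq> 0 \<or> L h2 \<noteq> 0" using add.prems by auto
      thus ?case using add.IH by blast
    qed
    from this[OF hecke_diagonalizable[OF stable p f(1)] f(2)]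
    obtain g c where g: "g \<in> W" "L g \<noteq> 0" "hecke_operator k p g = (\<lambda>t. c * g t)" by blast
    define W' where "W' = {h \<in> W. hecke_operator k p h = (\<lambda>t. c * h t)}"
    have W': "hecke_stable k W'" unfolding hecke_stable_def
    proof (intro conjI allI impI ballI)
      show "W' \<subseteq> cusp_forms k" using cW by (auto simp: W'_def)
      show "(\<lambda>t. 0) \<in> W'" using hecke_stableD(2)[OF stable] by (simp add: W'_def hecke_operator_0)
      show "(\<lambda>t. h1 t + h2 t) \<in> W'" if "h1 \<in> W'" "h2 \<in> W'" for h1 h2
        using that hecke_stableD(3)[OF stable] by (simp add: W'_def hecke_operator_add distrib_left)
      show "(\<lambda>t. b * h t) \<in> W'" if "h \<in> W'" for b h
        using that hecke_stableD(4)[OF stable] by (simp add: W'_def hecke_operator_scale mult.left_commute)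
      show "hecke_operator k q h \<in> W'" if q: "prime q" and h: "h \<in> W'" for q h
      proof -
        have hW: "h \<in> W" "hecke_operator k p h = (\<lambda>t. c * h t)" using h by (auto simp: W'_def)
        have "hecke_operator k p (hecke_operator k q h) = hecke_operator k q (\<lambda>t. c * h t)"
          unfolding hecke_operator_commute[OF cW[OF hW(1)] p q] hW(2) ..
        thus ?thesis using hecke_stableD(5)[OF stable q hW(1)] by (simp add: W'_def hecke_operator_scale)
      qed
    qed
    have "g \<in> W'" using g by (simp add: W'_def)
    hence "Q W'" using W' g(2) by (auto simp: Q_def)
    hence "W' = W" using W(2) by (intro stable_subset_eq[OF stable W']) (auto simp: W'_def)
    thus ?thesis using f(1) by (auto simp: W'_def)
  qed
  have "L (\<lambda>t. 0 * f t) = 0 * L f" by (rule scale[OF cW[OF f(1)]])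
  hence "L (\<lambda>t. 0) = 0" by simp
  hence "f \<noteq> (\<lambda>t. 0)" using f(2) by auto
  hence "cuspidal_hecke_eigenform k f" by (rule eigenform_if_prime_eigen[OF cW[OF f(1)] _ scalar])
  thus ?thesis using f(2) by blast
qed

subsection \<open>The Lipschitz formula\<close>

text \<open>A function of period 1 descends to the punctured disc in the variable \<open>q\<close>.
  It is holomorphic there through local branches of the logarithm, and the limit 0 at the cusp makes
  the singularity removable with value 0.\<close>

lemma q_expansion_exists:
  assumes hol: "f holomorphic_on upper_half_plane"
    and per: "\<And>t (n::int). t \<in> upper_half_plane \<Longrightarrow> f (t + of_int n) = f t"
    and lim: "\<And>e. e > 0 \<Longrightarrow> \<exists>Y>0. \<forall>t. Im t \<ge> Y \<longrightarrow> cmod (f t) < e"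
  shows "\<exists>a. q_expansion f a \<and> a 0 = 0"
proof -
  define br where "br z = Ln z / (2 * of_real pi * \<i>)" for z
  define g where "g z = (if z = 0 then 0 else f (br z))" for z
  have fn: "f t = f t'" if t: "t \<in> upper_half_plane" "nome t = nome t'" for t t'
  proof -
    obtain n :: int where n: "2 * of_real pi * \<i> * t' = 2 * of_real pi * \<i> * t + (of_int (2 * n) * pi) * \<i>"
      using t(2) exp_eq[of "2 * of_real pi * \<i> * t'" "2 * of_real pi * \<i> * t"] by (auto simp: nome_def)
    have "2 * of_real pi * \<i> * t' = 2 * of_real pi * \<i> * (t + of_int n)" unfolding n by (simp add: algebra_simps)
    hence "t' = t + of_int n" by simp
    thus ?thesis using per[OF t(1)] by simp
  qed
  have br: "nome (br z) = z" "Im (br z) = - ln (cmod z) / (2 * pi)" if "z \<noteq> 0" for z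
  proof -
    show "nome (br z) = z" using that by (simp add: nome_def br_def)
    have "br z = - \<i> * Ln z / of_real (2 * pi)" by (simp add: br_def field_simps)
    hence "Im (br z) = Im (- \<i> * Ln z) / (2 * pi)" by (simp only: Im_divide_of_real)
    thus "Im (br z) = - ln (cmod z) / (2 * pi)" using that by simp
  qed
  have brH: "br z \<in> upper_half_plane" if "z \<noteq> 0" "cmod z < 1" for z
  proof -
    have "ln (cmod z) < 0" using that by simp
    hence "ln (cmod z) / (2 * pi) < 0" by (simp add: divide_neg_pos)
    thus ?thesis using br(2)[OF that(1)] by (simp add: upper_half_plane_def)
  qed
  have fg: "f t = g (nome t)" if t: "t \<in> upper_half_plane" for t
    using fn[OF t, of "br (nome t)"] br(1)[of "nome t"] by (simp add: g_def)
  define A where "A = ball (0::complex) 1 - \<real>\<^sub>\<le>\<^sub>0"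
  define B where "B = ball (0::complex) 1 \<inter> {z. - z \<notin> \<real>\<^sub>\<le>\<^sub>0}"
  have oA: "open A" unfolding A_def by (intro open_Diff closed_nonpos_Reals_complex) auto
  have "open ((\<lambda>z::complex. - z) -` (- \<real>\<^sub>\<le>\<^sub>0))" by (intro open_vimage continuous_intros open_Compl closed_nonpos_Reals_complex)
  hence oB: "open B" unfolding B_def by (intro open_Int) (auto simp: vimage_def)
  have A: "z \<noteq> 0" "cmod z < 1" "z \<notin> \<real>\<^sub>\<le>\<^sub>0" if "z \<in> A" for z using that by (auto simp: A_def)
  have B: "z \<noteq> 0" "cmod z < 1" "- z \<notin> \<real>\<^sub>\<le>\<^sub>0" if "z \<in> B" for z using that by (auto simp: B_def)
  have gA: "g holomorphic_on A"
  proof (rule holomorphic_transform)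
    have "br holomorphic_on A" unfolding br_def by (intro holomorphic_intros) (use A in auto)
    thus "(\<lambda>z. f (br z)) holomorphic_on A"
      by (rule holomorphic_on_compose_gen[OF _ hol, unfolded o_def]) (use A brH in auto)
  qed (use A in \<open>auto simp: g_def\<close>)
  \<comment> \<open>A second branch, cut along the positive axis: the shift by 1/2 undoes the sign
    of the argument. The two branches together cover the punctured disc.\<close>
  define br' where "br' z = br (- z) + 1 / 2" for z
  have br': "nome (br' z) = z" if "z \<noteq> 0" for z
  proof -
    have "nome (br' z) = nome (br (- z)) * exp (\<i> * of_real pi)"
      unfolding nome_def br'_def exp_add[symmetric] by (simp add: algebra_simps)
    thus ?thesis using br(1)[of "- z"] that exp_pi_i' by simp
  qed
  have br'H: "br' z \<in> upper_half_plane" if "z \<noteq> 0" "cmod z < 1" for z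
    using brH[of "- z"] that by (simp add: br'_def upper_half_plane_def)
  have gB: "g holomorphic_on B"
  proof (rule holomorphic_transform)
    have "br' holomorphic_on B" unfolding br'_def br_def by (intro holomorphic_intros) (use B in auto)
    thus "(\<lambda>z. f (br' z)) holomorphic_on B"
      by (rule holomorphic_on_compose_gen[OF _ hol, unfolded o_def]) (use B br'H in auto)
    show "f (br' z) = g z" if "z \<in> B" for z
      using fg[OF br'H[OF B(1,2)[OF that]]] br'[OF B(1)[OF that]] by simp
  qed
  have "g holomorphic_on (A \<union> B)" by (rule holomorphic_on_Un[OF gA gB oA oB])
  moreover have "A \<union> B = ball 0 1 - {0}"
  proof
    show "ball 0 1 - {0} \<subseteq> A \<union> B"
    proof
      fix z :: complex assume z: "z \<in> ball 0 1 - {0}"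
      have "\<not> (z \<in> \<real>\<^sub>\<le>\<^sub>0 \<and> - z \<in> \<real>\<^sub>\<le>\<^sub>0)" using z by (auto simp: complex_nonpos_Reals_iff complex_eq_iff)
      thus "z \<in> A \<union> B" using z by (auto simp: A_def B_def)
    qed
  qed (use A B in auto)
  ultimately have gp: "g holomorphic_on (ball 0 1 - {0})" by simp
  have "(g \<longlongrightarrow> 0) (at 0)"
  proof (rule tendstoI)
    fix e :: real assume "e > 0"
    then obtain Y where Y: "Y > 0" "\<And>t. Im t \<ge> Y \<Longrightarrow> cmod (f t) < e" using lim by blast
    have "eventually (\<lambda>z. z \<in> ball 0 (exp (- 2 * pi * Y))) (at (0::complex))"
      by (intro eventually_at_in_open') auto
    moreover have "eventually (\<lambda>z. z \<noteq> 0) (at (0::complex))" by (simp add: eventually_at_filter)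
    ultimately show "\<forall>\<^sub>F z in at 0. dist (g z) 0 < e"
    proof eventually_elim
      case (elim z)
      hence z: "z \<noteq> 0" "cmod z < exp (- 2 * pi * Y)" by auto
      hence "ln (cmod z) < - 2 * pi * Y" by (metis exp_less_cancel_iff exp_ln zero_less_norm_iff)
      hence "Y \<le> - ln (cmod z) / (2 * pi)" by (simp add: field_simps)
      hence "cmod (f (br z)) < e" using Y(2)[of "br z"] br(2)[OF z(1)] by simp
      thus ?case using z by (simp add: g_def)
    qed
  qed
  hence c0: "isCont g 0" by (simp add: isCont_def g_def)
  have "continuous_on (ball 0 1) g"
  proof -
    have "isCont g z" if "z \<in> ball 0 1" for z
    proof (cases "z = 0")
      case False
      have "continuous_on (ball 0 1 - {0}) g" by (rule holomorphic_on_imp_continuous_on[OF gp])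
      moreover have "open (ball 0 1 - {0::complex})" by (intro open_Diff) auto
      ultimately show ?thesis using that False continuous_on_eq_continuous_at by blast
    qed (use c0 in simp)
    thus ?thesis by (simp add: continuous_at_imp_continuous_on)
  qed
  hence gh: "g holomorphic_on ball 0 1" using gp by (intro no_isolated_singularity[of "ball 0 1" g "{0}"]) auto
  have "q_expansion f (\<lambda>n. (deriv ^^ n) g 0 / fact n)"
    unfolding q_expansion_nome
  proof
    fix t assume t: "t \<in> upper_half_plane"
    have "(\<lambda>n. (deriv ^^ n) g 0 / fact n * (nome t - 0) ^ n) sums g (nome t)"
      by (rule holomorphic_power_series[OF gh]) (use norm_nome_less_1[OF t] in simp)
    thus "(\<lambda>n. (deriv ^^ n) g 0 / fact n * nome t ^ n) sums f t" by (simp add: fg[OF t])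
  qed
  moreover have "(deriv ^^ 0) g 0 / fact 0 = 0" by (simp add: g_def)
  ultimately show ?thesis by blast
qed

lemma deriv_eq_on_upper:
  assumes "\<And>z. z \<in> upper_half_plane \<Longrightarrow> f z = g z" "z \<in> upper_half_plane"
    "(f has_field_derivative f') (at z)" "(g has_field_derivative g') (at z)"
  shows "f' = g'"
proof -
  have "(g has_field_derivative f') (at z)"
    using has_field_derivative_transform_within_open[OF assms(3) open_upper_half_plane assms(2,1)] by blast
  thus ?thesis using assms(4) by (rule DERIV_unique)
qed

lemma nome_derivative: "(nome has_field_derivative 2 * of_real pi * \<i> * nome z) (at z)"
  unfolding nome_def[abs_def] by (auto intro!: derivative_eq_intros)

lemma upper_not_nonpos_Int:
  assumes "z \<in> upper_half_plane"
  shows "z \<notin> \<int>\<^sub>\<le>\<^sub>0" "1 - z \<notin> \<int>\<^sub>\<le>\<^sub>0"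
proof -
  have *: "Im w = 0" if "w \<in> \<int>\<^sub>\<le>\<^sub>0" for w :: complex using that by (auto elim!: nonpos_Ints_cases)
  show "z \<notin> \<int>\<^sub>\<le>\<^sub>0" "1 - z \<notin> \<int>\<^sub>\<le>\<^sub>0" using *[of z] *[of "1 - z"] assms by (auto simp: upper_half_plane_def)
qed

text \<open>Differentiating the reflection formula of the Gamma function gives
  \<open>pi * cot (pi * z)\<close>, here written in terms of the nome.\<close>

lemma Digamma_reflection:
  assumes z: "z \<in> upper_half_plane"
  shows "Digamma (1 - z) - Digamma z = - (of_real pi * \<i>) * (1 + nome z) / (1 - nome z)"
proof -
  note nz = upper_not_nonpos_Int[OF z]
  have n1: "1 - nome z \<noteq> 0" using norm_nome_less_1[OF z] by auto
  \<comment> \<open>A square root of the nome, in which sine and cosine of \<open>pi * z\<close> are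
    rational.\<close>
  define E where "E = exp (\<i> * of_real pi * z)"
  have E: "E \<noteq> 0" by (simp add: E_def)
  have E2: "nome z = E\<^sup>2"
    unfolding nome_def E_def power2_eq_square exp_add[symmetric] by (rule arg_cong[of _ _ exp]) simp
  have Ei: "exp (- (\<i> * of_real pi * z)) = inverse E" by (simp add: E_def exp_minus)
  have s: "sin (of_real pi * z) = (E - inverse E) / (2 * \<i>)"
    unfolding sin_exp_eq E_def by (simp add: exp_minus mult_ac)
  have c: "cos (of_real pi * z) = (E + inverse E) / 2"
    unfolding cos_exp_eq E_def by (simp add: exp_minus mult_ac)
  have "((\<lambda>z. rGamma z * rGamma (1 - z)) has_field_derivative
      - (rGamma z * Digamma z) * rGamma (1 - z) + rGamma z * (rGamma (1 - z) * Digamma (1 - z))) (at z)"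
    using nz by (auto intro!: derivative_eq_intros)
  moreover have "((\<lambda>z. sin (of_real pi * z) / of_real pi) has_field_derivative cos (of_real pi * z)) (at z)"
    by (auto intro!: derivative_eq_intros)
  ultimately have "- (rGamma z * Digamma z) * rGamma (1 - z) + rGamma z * (rGamma (1 - z) * Digamma (1 - z)) = cos (of_real pi * z)"
    by (rule deriv_eq_on_upper[OF rGamma_reflection_complex z])
  hence "(rGamma z * rGamma (1 - z)) * (Digamma (1 - z) - Digamma z) = cos (of_real pi * z)"
    by (simp add: algebra_simps)
  hence *: "sin (of_real pi * z) * (Digamma (1 - z) - Digamma z) = of_real pi * cos (of_real pi * z)"
    unfolding rGamma_reflection_complex by (simp add: field_simps)
  have "(E - inverse E) * (Digamma (1 - z) - Digamma z) = 2 * \<i> * (sin (of_real pi * z) * (Digamma (1 - z) - Digamma z))"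
    unfolding s by simp
  also have "\<dots> = of_real pi * \<i> * (E + inverse E)" unfolding * c by simp
  finally have "(E - inverse E) * (Digamma (1 - z) - Digamma z) = of_real pi * \<i> * (E + inverse E)" .
  hence "E * (E - inverse E) * (Digamma (1 - z) - Digamma z) = of_real pi * \<i> * (E * (E + inverse E))"
    by (simp only: mult_ac)
  moreover have "E * (E - inverse E) = E\<^sup>2 - 1" "E * (E + inverse E) = E\<^sup>2 + 1"
    using E by (simp_all add: power2_eq_square right_diff_distrib distrib_left)
  ultimately have "(E\<^sup>2 - 1) * (Digamma (1 - z) - Digamma z) = of_real pi * \<i> * (E\<^sup>2 + 1)" by simp
  hence "(1 - nome z) * (Digamma (1 - z) - Digamma z) = - (of_real pi * \<i>) * (1 + nome z)"
    unfolding E2 by (simp add: algebra_simps)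
  thus ?thesis using n1 by (simp add: field_simps)
qed

text \<open>The generating function of the cubes: the sum of \<open>n^3 * x^n\<close> over
  \<open>n \<ge> 1\<close>.\<close>

definition cubes_gf :: "complex \<Rightarrow> complex" where
  "cubes_gf x = x * (1 + 4 * x + x\<^sup>2) / (1 - x) ^ 4"

lemma rational_derivatives:
  fixes x :: complex
  assumes "x \<noteq> 1"
  shows "((\<lambda>x. (1 + x) / (1 - x)) has_field_derivative 2 / (1 - x)\<^sup>2) (at x)"
    and "((\<lambda>x. x / (1 - x)\<^sup>2) has_field_derivative (1 + x) / (1 - x) ^ 3) (at x)"
    and "((\<lambda>x. x * (1 + x) / (1 - x) ^ 3) has_field_derivative (1 + 4 * x + x\<^sup>2) / (1 - x) ^ 4) (at x)"
proof -
  \<comment> \<open>All three derivatives become polynomial identities modulo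
    \<open>(1 - x) * u = 1\<close>.\<close>
  define u where "u = inverse (1 - x)"
  have u: "(1 - x) * u = 1" using assms by (simp add: u_def)
  have du: "((\<lambda>x. inverse (1 - x)) has_field_derivative u\<^sup>2) (at x)"
    using assms by (auto intro!: derivative_eq_intros simp: u_def power2_eq_square)
  have "((\<lambda>x. (1 + x) * inverse (1 - x)) has_field_derivative 1 * u + u\<^sup>2 * (1 + x)) (at x)"
    by (rule DERIV_cong[OF DERIV_mult[OF _ du]]) (auto intro!: derivative_eq_intros simp: u_def)
  moreover have "1 * u + u\<^sup>2 * (1 + x) = 2 * u\<^sup>2" using u by algebra
  ultimately show "((\<lambda>x. (1 + x) / (1 - x)) has_field_derivative 2 / (1 - x)\<^sup>2) (at x)"
    by (simp add: divide_inverse u_def power_inverse)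
  have du2: "((\<lambda>x. inverse (1 - x) ^ 2) has_field_derivative 2 * u ^ 3) (at x)"
    by (rule DERIV_cong[OF DERIV_power[OF du]]) (simp add: u_def[symmetric] power2_eq_square power3_eq_cube)
  have "((\<lambda>x. x * inverse (1 - x) ^ 2) has_field_derivative 1 * u\<^sup>2 + 2 * u ^ 3 * x) (at x)"
    by (rule DERIV_cong[OF DERIV_mult[OF DERIV_ident du2]]) (simp add: u_def)
  moreover have "1 * u\<^sup>2 + 2 * u ^ 3 * x = (1 + x) * u ^ 3" using u by algebra
  ultimately show "((\<lambda>x. x / (1 - x)\<^sup>2) has_field_derivative (1 + x) / (1 - x) ^ 3) (at x)"
    by (simp add: divide_inverse u_def power_inverse)
  have du3: "((\<lambda>x. inverse (1 - x) ^ 3) has_field_derivative 3 * u ^ 4) (at x)"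
    by (rule DERIV_cong[OF DERIV_power[OF du]]) (simp add: u_def[symmetric] power2_eq_square power4_eq_xxxx)
  have "((\<lambda>x. (x * (1 + x)) * inverse (1 - x) ^ 3) has_field_derivative (1 + 2 * x) * u ^ 3 + 3 * u ^ 4 * (x * (1 + x))) (at x)"
    by (rule DERIV_cong[OF DERIV_mult[OF _ du3]]) (auto intro!: derivative_eq_intros simp: u_def)
  moreover have "(1 + 2 * x) * u ^ 3 + 3 * u ^ 4 * (x * (1 + x)) = (1 + 4 * x + x\<^sup>2) * u ^ 4" using u by algebra
  ultimately show "((\<lambda>x. x * (1 + x) / (1 - x) ^ 3) has_field_derivative (1 + 4 * x + x\<^sup>2) / (1 - x) ^ 4) (at x)"
    by (simp add: divide_inverse u_def power_inverse)
qed

text \<open>Three derivatives of the Digamma reflection. In the variable \<open>q\<close> each is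
  \<open>2 * pi * \<i>\<close> times \<open>q d/dq\<close>, which turns
  \<open>(1 + q) / (1 - q)\<close>, that is 1 plus twice the geometric series, into twice the
  generating function of the cubes.\<close>

lemma Polygamma_3_reflection:
  assumes z: "z \<in> upper_half_plane"
  shows "Polygamma 3 z + Polygamma 3 (1 - z) = 16 * of_real pi ^ 4 * cubes_gf (nome z)"
proof -
  define P :: complex where "P = of_real pi"
  have q1: "nome z \<noteq> 1" if "z \<in> upper_half_plane" for z using norm_nome_less_1[OF that] by auto
  have dP: "((\<lambda>z. Polygamma n z) has_field_derivative Polygamma (Suc n) z) (at z)"
    "((\<lambda>z. Polygamma n (1 - z)) has_field_derivative - Polygamma (Suc n) (1 - z)) (at z)"
    if "z \<in> upper_half_plane" for n z
    using upper_not_nonpos_Int[OF that] by (auto intro!: derivative_eq_intros)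
  have 1: "- Polygamma 1 (1 - z) - Polygamma 1 z = 4 * P\<^sup>2 * nome z / (1 - nome z)\<^sup>2" if z: "z \<in> upper_half_plane" for z
  proof (rule deriv_eq_on_upper[OF _ z])
    show "((\<lambda>z. Digamma (1 - z) - Digamma z) has_field_derivative - Polygamma 1 (1 - z) - Polygamma 1 z) (at z)"
      using DERIV_diff[OF dP(2)[OF z, of 0] dP(1)[OF z, of 0]] by simp
    show "((\<lambda>z. - (P * \<i>) * (1 + nome z) / (1 - nome z)) has_field_derivative 4 * P\<^sup>2 * nome z / (1 - nome z)\<^sup>2) (at z)"
      using DERIV_cmult[OF DERIV_chain2[OF rational_derivatives(1)[OF q1[OF z]] nome_derivative], of "- (P * \<i>)"]
      by (simp add: P_def[symmetric] power2_eq_square mult_ac)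
  qed (simp add: Digamma_reflection P_def)
  have 2: "Polygamma 2 (1 - z) - Polygamma 2 z = 8 * P ^ 3 * \<i> * (nome z * (1 + nome z)) / (1 - nome z) ^ 3"
    if z: "z \<in> upper_half_plane" for z
  proof (rule deriv_eq_on_upper[OF _ z])
    show "((\<lambda>z. - Polygamma 1 (1 - z) - Polygamma 1 z) has_field_derivative Polygamma 2 (1 - z) - Polygamma 2 z) (at z)"
      using DERIV_diff[OF DERIV_minus[OF dP(2)[OF z, of 1]] dP(1)[OF z, of 1]] by (simp add: numeral_2_eq_2)
    show "((\<lambda>z. 4 * P\<^sup>2 * nome z / (1 - nome z)\<^sup>2) has_field_derivative 8 * P ^ 3 * \<i> * (nome z * (1 + nome z)) / (1 - nome z) ^ 3) (at z)"
      using DERIV_cmult[OF DERIV_chain2[OF rational_derivatives(2)[OF q1[OF z]] nome_derivative], of "4 * P\<^sup>2"]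
      by (simp add: P_def[symmetric] power2_eq_square power3_eq_cube mult_ac)
  qed (rule 1)
  have "- Polygamma 3 (1 - z) - Polygamma 3 z = - (16 * P ^ 4) * cubes_gf (nome z)"
  proof (rule deriv_eq_on_upper[OF _ z])
    show "((\<lambda>z. Polygamma 2 (1 - z) - Polygamma 2 z) has_field_derivative - Polygamma 3 (1 - z) - Polygamma 3 z) (at z)"
      using DERIV_diff[OF dP(2)[OF z, of 2] dP(1)[OF z, of 2]] by (simp add: numeral_3_eq_3 numeral_2_eq_2)
    show "((\<lambda>z. 8 * P ^ 3 * \<i> * (nome z * (1 + nome z)) / (1 - nome z) ^ 3) has_field_derivative - (16 * P ^ 4) * cubes_gf (nome z)) (at z)"
      unfolding cubes_gf_def
      using DERIV_cmult[OF DERIV_chain2[OF rational_derivatives(3)[OF q1[OF z]] nome_derivative], of "8 * P ^ 3 * \<i>"]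
      by (simp add: P_def[symmetric] power2_eq_square power3_eq_cube power4_eq_xxxx mult_ac)
  qed (rule 2)
  thus ?thesis by (simp add: P_def algebra_simps)
qed

subsection \<open>Eisenstein series of level 2\<close>

text \<open>Negative integers are written as \<open>- 1 - k\<close> because
  \<open>z - 1 - k = - (1 - z + k)\<close>: the negative half of a sum over all integers then
  becomes a Polygamma value at \<open>1 - z\<close>.\<close>

lemma int_UNIV_split: "(UNIV :: int set) = range int \<union> range (\<lambda>k. - 1 - int k)"
proof -
  have "x \<in> range int \<union> range (\<lambda>k. - 1 - int k)" for x
  proof (cases "x \<ge> 0")
    case True thus ?thesis by (intro UnI1 image_eqI[of _ _ "nat x"]) auto
  next
    case False thus ?thesis by (intro UnI2 image_eqI[of _ _ "nat (- 1 - x)"]) auto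
  qed
  thus ?thesis by blast
qed

text \<open>A majorant for the terms of the Eisenstein series. The product form reduces its
  summability to one dimension.\<close>

definition z2_weight :: "int \<times> int \<Rightarrow> real" where
  "z2_weight p = inverse ((1 + (of_int (fst p))\<^sup>2) * (1 + (of_int (snd p))\<^sup>2))"

lemma summable_inverse_square_int: "(\<lambda>n::int. inverse (1 + (real_of_int n)\<^sup>2)) summable_on UNIV"
proof -
  have nn: "norm (inverse (1 + x\<^sup>2)) = inverse (1 + x\<^sup>2)" for x :: real
    unfolding real_norm_def by (rule abs_of_nonneg) simp
  have nat: "summable (\<lambda>n. inverse (1 + (real n)\<^sup>2))"
  proof (rule summable_comparison_test'[OF inverse_power_summable[of 2]])
    fix n :: nat assume "n \<ge> 1"
    moreover have "0 < 1 + (real n)\<^sup>2" by (simp add: add_pos_nonneg)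
    ultimately show "norm (inverse (1 + (real n)\<^sup>2)) \<le> inverse (real n ^ 2)"
      by (auto intro!: le_imp_inverse_le)
  qed simp
  have 1: "(\<lambda>n::nat. inverse (1 + (real n)\<^sup>2)) summable_on UNIV"
    using nat by (intro norm_summable_imp_summable_on) (simp only: nn)
  have "summable (\<lambda>n. inverse (1 + (real (Suc n))\<^sup>2))" using nat by (subst summable_Suc_iff)
  hence 2: "(\<lambda>n::nat. inverse (1 + (real (Suc n))\<^sup>2)) summable_on UNIV"
    by (intro norm_summable_imp_summable_on) (simp only: nn)
  have "(\<lambda>n::int. inverse (1 + (real_of_int n)\<^sup>2)) summable_on range int"
    by (subst summable_on_reindex) (use 1 in \<open>auto simp: o_def inj_on_def\<close>)
  moreover have "(\<lambda>n::int. inverse (1 + (real_of_int n)\<^sup>2)) summable_on range (\<lambda>k. - 1 - int k)"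
  proof (subst summable_on_reindex)
    have "(real_of_int (- 1 - int n))\<^sup>2 = (real (Suc n))\<^sup>2" for n
      by (simp add: power2_eq_square algebra_simps)
    thus "(\<lambda>n::int. inverse (1 + (real_of_int n)\<^sup>2)) \<circ> (\<lambda>k. - 1 - int k) summable_on UNIV"
      using 2 by (simp only: o_def)
  qed (auto simp: inj_on_def)
  ultimately show ?thesis unfolding int_UNIV_split by (rule summable_on_union)
qed

lemma summable_z2_weight: "z2_weight summable_on UNIV"
proof -
  define h where "h n = inverse (1 + (real_of_int n)\<^sup>2)" for n :: int
  have h: "h summable_on UNIV" unfolding h_def by (rule summable_inverse_square_int)
  have h0: "h n \<ge> 0" for n by (simp add: h_def)
  have "(\<lambda>p. h (fst p) * h (snd p)) summable_on (Sigma UNIV (\<lambda>_. UNIV))"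
  proof (rule summable_on_SigmaI[where g = "\<lambda>m. h m * infsum h UNIV"])
    show "((\<lambda>n. h (fst (m, n)) * h (snd (m, n))) has_sum h m * infsum h UNIV) UNIV" for m
      using has_sum_cmult_right[OF has_sum_infsum[OF h], of "h m"] by simp
    show "(\<lambda>m. h m * infsum h UNIV) summable_on UNIV" using h by (rule summable_on_cmult_left)
    show "0 \<le> h (fst (m, n)) * h (snd (m, n))" for m n using h0 by simp
  qed
  moreover have "(\<lambda>p. h (fst p) * h (snd p)) = z2_weight"
    by (simp add: fun_eq_iff z2_weight_def h_def)
  ultimately show ?thesis by simp
qed

definition parity_class :: "bool \<times> bool \<Rightarrow> (int \<times> int) set" where
  "parity_class v = {(m, n). odd m = fst v \<and> odd n = snd v}"

text \<open>For \<open>v \<noteq> (False, False)\<close> these are the three Eisenstein series of weight 4 and level 2; SL(2,Z)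
  permutes them as it permutes the nonzero vectors modulo 2.\<close>

definition eis :: "bool \<times> bool \<Rightarrow> complex \<Rightarrow> complex" where
  "eis v t = (\<Sum>\<^sub>\<infinity>(m, n)\<in>parity_class v. inverse ((of_int m * t + of_int n) ^ 4))"

text \<open>Put \<open>s = m^2 + n^2\<close>, which is at least 1 on nonzero vectors. Both
  \<open>1 + m^2\<close> and \<open>1 + n^2\<close> are at most \<open>2 * s\<close>, whence the
  factor 4, and the fourth power of the norm is at least \<open>(e * s)^2\<close>.\<close>

lemma inverse_fourth_bound:
  fixes m n :: int
  assumes e: "e > 0" and mn: "(m, n) \<noteq> (0, 0)"
    and le: "e * of_int (m\<^sup>2 + n\<^sup>2) \<le> (cmod z)\<^sup>2"
  shows "cmod (inverse (z ^ 4)) \<le> 4 / e\<^sup>2 * z2_weight (m, n)"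
proof -
  have "m\<^sup>2 + n\<^sup>2 \<noteq> 0" using mn by (simp add: sum_power2_eq_zero_iff)
  moreover have "m\<^sup>2 + n\<^sup>2 \<ge> 0" by simp
  ultimately have "m\<^sup>2 + n\<^sup>2 \<ge> 1" by linarith
  hence s1: "real_of_int (m\<^sup>2 + n\<^sup>2) \<ge> 1" by (metis of_int_1 of_int_le_iff)
  define s where "s = real_of_int (m\<^sup>2 + n\<^sup>2)"
  define a b where "a = (real_of_int m)\<^sup>2" and "b = (real_of_int n)\<^sup>2"
  have ab: "a \<ge> 0" "b \<ge> 0" "s = a + b" by (auto simp: a_def b_def s_def)
  have s: "s \<ge> 1" using s1 by (simp add: s_def)
  have "(1 + a) * (1 + b) \<le> (2 * s) * (2 * s)"
    using ab s by (intro mult_mono) auto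
  hence 1: "e\<^sup>2 / 4 * ((1 + a) * (1 + b)) \<le> (e * s)\<^sup>2"
    using e mult_left_mono[of "(1 + a) * (1 + b)" "(2 * s) * (2 * s)" "e\<^sup>2 / 4"] by (simp add: power2_eq_square mult_ac)
  have "(e * s)\<^sup>2 \<le> ((cmod z)\<^sup>2)\<^sup>2" using le e s unfolding s_def by (intro power_mono) auto
  hence "e\<^sup>2 / 4 * ((1 + a) * (1 + b)) \<le> cmod (z ^ 4)" using 1 by (simp add: norm_power)
  moreover have pos: "e\<^sup>2 / 4 * ((1 + a) * (1 + b)) > 0" using e ab by (simp add: add_pos_nonneg)
  ultimately have "inverse (cmod (z ^ 4)) \<le> inverse (e\<^sup>2 / 4 * ((1 + a) * (1 + b)))"
    by (rule le_imp_inverse_le)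
  also have "\<dots> = 4 / e\<^sup>2 * z2_weight (m, n)" 
    by (simp only: z2_weight_def a_def b_def fst_conv snd_conv inverse_mult_distrib divide_inverse inverse_inverse_eq mult_ac)
  finally show ?thesis by (simp add: norm_inverse)
qed

lemma parity_class_nonzero: "v \<noteq> (False, False) \<Longrightarrow> (m, n) \<in> parity_class v \<Longrightarrow> (m, n) \<noteq> (0, 0)"
  by (cases v) (auto simp: parity_class_def)

lemma upper_quadratic_bound:
  fixes m n :: int
  shows "(Im t)\<^sup>2 / ((cmod t)\<^sup>2 + 1) * of_int (m\<^sup>2 + n\<^sup>2) \<le> (cmod (of_int m * t + of_int n))\<^sup>2"
proof -
  have "(cmod t)\<^sup>2 + 1 > 0" by (simp add: add_nonneg_pos)
  thus ?thesis using quadratic_form_bound_int[of t 1 m n] by (simp add: area_def field_simps)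
qed

lemma eis_term_bound:
  assumes v: "v \<noteq> (False, False)" and mn: "(m, n) \<in> parity_class v"
    and y: "0 < y" "y \<le> Im t" and R: "cmod t \<le> R"
  shows "cmod (inverse ((of_int m * t + of_int n) ^ 4)) \<le> 4 / (y\<^sup>2 / (R\<^sup>2 + 1))\<^sup>2 * z2_weight (m, n)"
proof (rule inverse_fourth_bound)
  show "(m, n) \<noteq> (0, 0)" by (rule parity_class_nonzero[OF v mn])
  have R1: "R\<^sup>2 + 1 > 0" "(cmod t)\<^sup>2 + 1 > 0" by (auto simp: add_nonneg_pos)
  show "0 < y\<^sup>2 / (R\<^sup>2 + 1)" using y R1 by simp
  have "(cmod t)\<^sup>2 \<le> R\<^sup>2" "y\<^sup>2 \<le> (Im t)\<^sup>2" using R y by (auto intro!: power_mono)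
  hence "y\<^sup>2 / (R\<^sup>2 + 1) \<le> (Im t)\<^sup>2 / ((cmod t)\<^sup>2 + 1)" using R1 by (intro frac_le) auto
  hence "y\<^sup>2 / (R\<^sup>2 + 1) * real_of_int (m\<^sup>2 + n\<^sup>2) \<le> (Im t)\<^sup>2 / ((cmod t)\<^sup>2 + 1) * of_int (m\<^sup>2 + n\<^sup>2)"
    by (intro mult_right_mono) (auto simp: simp flip: of_int_power of_int_add)
  thus "y\<^sup>2 / (R\<^sup>2 + 1) * real_of_int (m\<^sup>2 + n\<^sup>2) \<le> (cmod (of_int m * t + of_int n))\<^sup>2"
    using upper_quadratic_bound[of t m n] by linarith
qed

lemma summable_z2_weight_scaled: "(\<lambda>p. c * z2_weight p) summable_on A"
  by (rule summable_on_cmult_right, rule summable_on_subset_banach[OF summable_z2_weight]) simp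

lemma eis_summable:
  assumes v: "v \<noteq> (False, False)" and t: "t \<in> upper_half_plane"
  shows "(\<lambda>p. cmod (inverse ((of_int (fst p) * t + of_int (snd p)) ^ 4))) summable_on parity_class v"
proof (rule summable_on_comparison_test[OF summable_z2_weight_scaled])
  fix p assume p: "p \<in> parity_class v"
  have "Im t > 0" using t by (simp add: upper_half_plane_def)
  thus "cmod (inverse ((of_int (fst p) * t + of_int (snd p)) ^ 4)) \<le> 4 / ((Im t)\<^sup>2 / ((cmod t)\<^sup>2 + 1))\<^sup>2 * z2_weight p"
    using eis_term_bound[OF v, of "fst p" "snd p" "Im t" t "cmod t"] p by simp
qed simp

lemma eis_holomorphic:
  assumes v: "v \<noteq> (False, False)"
  shows "eis v holomorphic_on upper_half_plane"
proof -
  have "eis v field_differentiable (at t0)" if t0: "t0 \<in> upper_half_plane" for t0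
  proof -
    define y where "y = Im t0 / 2"
    have y: "y > 0" using t0 by (simp add: y_def upper_half_plane_def)
    define R where "R = cmod t0 + y"
    define f where "f p t = inverse ((of_int (fst p) * t + of_int (snd p)) ^ 4)" for p :: "int \<times> int" and t :: complex
    have ball: "y \<le> Im t" "cmod t \<le> R" if "t \<in> cball t0 y" for t
    proof -
      have d: "cmod (t - t0) \<le> y" using that by (simp add: dist_norm norm_minus_commute)
      show "cmod t \<le> R" using norm_triangle_ineq2[of t t0] d by (simp add: R_def)
      show "y \<le> Im t" using abs_Im_le_cmod[of "t - t0"] d by (simp add: y_def)
    qed
    have H: "t \<in> upper_half_plane" if "t \<in> cball t0 y" for t using ball[OF that] y by (simp add: upper_half_plane_def)
    have nz: "of_int (fst p) * t + of_int (snd p) \<noteq> 0" if "p \<in> parity_class v" "t \<in> cball t0 y" for p t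
    proof
      assume z: "of_int (fst p) * t + of_int (snd p) = 0"
      have "(fst p, snd p) \<noteq> (0, 0)" by (rule parity_class_nonzero[OF v]) (use that in simp)
      moreover have "of_int (fst p) * Im t = 0" using arg_cong[OF z, of Im] by simp
      hence "fst p = 0" using H[OF that(2)] by (simp add: upper_half_plane_def)
      ultimately show False using z by simp
    qed
    have "uniform_limit (cball t0 y) (\<lambda>X t. \<Sum>p\<in>X. f p t) (\<lambda>t. \<Sum>\<^sub>\<infinity>p\<in>parity_class v. f p t) (finite_subsets_at_top (parity_class v))"
    proof (rule Weierstrass_m_test_general)
      show "cmod (f p t) \<le> 4 / (y\<^sup>2 / (R\<^sup>2 + 1))\<^sup>2 * z2_weight p" if "p \<in> parity_class v" "t \<in> cball t0 y" for p t
        using eis_term_bound[OF v, of "fst p" "snd p" y t R] that ball[OF that(2)] y by (simp add: f_def)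
    qed (rule summable_z2_weight_scaled)
    moreover have "(\<lambda>t. \<Sum>\<^sub>\<infinity>p\<in>parity_class v. f p t) = eis v"
      by (simp add: fun_eq_iff eis_def f_def case_prod_unfold)
    ultimately have ul: "uniform_limit (cball t0 y) (\<lambda>X t. \<Sum>p\<in>X. f p t) (eis v) (finite_subsets_at_top (parity_class v))" by simp
    have ev: "\<forall>\<^sub>F X in finite_subsets_at_top (parity_class v). continuous_on (cball t0 y) (\<lambda>t. \<Sum>p\<in>X. f p t) \<and> (\<lambda>t. \<Sum>p\<in>X. f p t) holomorphic_on ball t0 y"
    proof (rule eventually_finite_subsets_at_top_weakI)
        fix X assume X: "finite X" "X \<subseteq> parity_class v"
        have "(\<lambda>t. \<Sum>p\<in>X. f p t) holomorphic_on cball t0 y"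
          unfolding f_def using X nz by (intro holomorphic_intros) auto
        thus "continuous_on (cball t0 y) (\<lambda>t. \<Sum>p\<in>X. f p t) \<and> (\<lambda>t. \<Sum>p\<in>X. f p t) holomorphic_on ball t0 y"
          using holomorphic_on_imp_continuous_on holomorphic_on_subset ball_subset_cball by blast
    qed
    have "eis v holomorphic_on ball t0 y" by (rule holomorphic_uniform_limit[OF ev ul]) simp_all
    thus ?thesis using y by (simp add: holomorphic_on_imp_differentiable_at)
  qed
  thus ?thesis by (simp add: holomorphic_on_def field_differentiable_at_within)
qed

text \<open>Multiplying row vectors by the matrix permutes the integral vectors and acts on their
  classes modulo 2; the denominator contributes the same factor to every term.\<close>

lemma eis_moebius:
  assumes det: "a * d - b * c = 1" and t: "t \<in> upper_half_plane"
  shows "eis v ((of_int a * t + of_int b) / (of_int c * t + of_int d)) = (of_int c * t + of_int d) ^ 4 *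
     eis (odd (of_bool (fst v) * a + of_bool (snd v) * c), odd (of_bool (fst v) * b + of_bool (snd v) * d)) t"
proof -
  define v' where "v' = (odd (of_bool (fst v) * a + of_bool (snd v) * c), odd (of_bool (fst v) * b + of_bool (snd v) * d))"
  define \<phi> where "\<phi> = (\<lambda>(m, n). (m * a + n * c, m * b + n * d))"
  define j where "j = of_int c * t + of_int d"
  have j: "j \<noteq> 0"
  proof -
    have w: "area (t, 1) > 0" using t by (simp add: area_def upper_half_plane_def)
    have "area (act (a, b, c, d) (t, 1)) > 0" using w det by (simp add: area_act del: act.simps)
    thus ?thesis using area_pos_nonzero(2)[of "act (a, b, c, d) (t, 1)"] by (simp add: j_def)
  qed
  have bij: "bij_betw \<phi> (parity_class v) (parity_class v')"
  proof (rule bij_betwI[of _ _ _ "\<lambda>(m, n). (m * d - n * c, n * a - m * b)"])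
    have even_of_bool: "odd (of_bool P :: int) = P" for P by simp
    show "\<phi> \<in> parity_class v \<rightarrow> parity_class v'"
      by (auto simp: \<phi>_def parity_class_def v'_def even_of_bool)
    have ad: "odd (a * d - b * c)" using det by simp
    show "(\<lambda>(m, n). (m * d - n * c, n * a - m * b)) \<in> parity_class v' \<rightarrow> parity_class v"
      using ad by (cases v; cases "fst v"; cases "snd v") (auto simp: parity_class_def v'_def)
    have 1: "(m * a + n * c) * d - (m * b + n * d) * c = m * (a * d - b * c)"
      "(m * b + n * d) * a - (m * a + n * c) * b = n * (a * d - b * c)" for m n :: int
      by (simp_all add: algebra_simps)
    show "(case \<phi> x of (m, n) \<Rightarrow> (m * d - n * c, n * a - m * b)) = x" for x
      by (cases x) (simp add: \<phi>_def 1 det)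
    have 2: "(m * d - n * c) * a + (n * a - m * b) * c = m * (a * d - b * c)"
      "(m * d - n * c) * b + (n * a - m * b) * d = n * (a * d - b * c)" for m n :: int
      by (simp_all add: algebra_simps)
    show "\<phi> (case x of (m, n) \<Rightarrow> (m * d - n * c, n * a - m * b)) = x" for x
      by (cases x) (simp add: \<phi>_def 2 det)
  qed
  have term_eq: "inverse ((of_int (fst p) * ((of_int a * t + of_int b) / j) + of_int (snd p)) ^ 4) =
     j ^ 4 * inverse ((of_int (fst (\<phi> p)) * t + of_int (snd (\<phi> p))) ^ 4)" for p
  proof -
    have "of_int (fst p) * ((of_int a * t + of_int b) / j) + of_int (snd p) = (of_int (fst (\<phi> p)) * t + of_int (snd (\<phi> p))) / j"
      using j by (cases p) (simp add: \<phi>_def j_def field_simps)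
    thus ?thesis using j by (simp add: power_divide inverse_eq_divide)
  qed
  have "eis v ((of_int a * t + of_int b) / j) = (\<Sum>\<^sub>\<infinity>p\<in>parity_class v. j ^ 4 * inverse ((of_int (fst (\<phi> p)) * t + of_int (snd (\<phi> p))) ^ 4))"
    unfolding eis_def case_prod_unfold term_eq ..
  also have "\<dots> = j ^ 4 * (\<Sum>\<^sub>\<infinity>p\<in>parity_class v. inverse ((of_int (fst (\<phi> p)) * t + of_int (snd (\<phi> p))) ^ 4))"
    by (rule infsum_cmult_right')
  also have "(\<Sum>\<^sub>\<infinity>p\<in>parity_class v. inverse ((of_int (fst (\<phi> p)) * t + of_int (snd (\<phi> p))) ^ 4)) = eis v' t"
    unfolding eis_def case_prod_unfold
    by (rule infsum_reindex_bij_betw[OF bij, of "\<lambda>p. inverse ((of_int (fst p) * t + of_int (snd p)) ^ 4)"])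
  finally show ?thesis by (simp add: j_def v'_def)
qed

text \<open>The square \<open>(2 M X + N)^2 \<ge> 0\<close> saves half of \<open>N^2\<close> from
  the cross term at the cost of \<open>M^2 X^2\<close>, which is at most \<open>M^2 / 4\<close> in
  the strip.\<close>

lemma strip_quadratic_bound:
  fixes m n :: int
  assumes x: "\<bar>Re t\<bar> \<le> 1 / 2" and y: "Im t \<ge> 1"
  shows "of_int (m\<^sup>2) * ((Im t)\<^sup>2 - 1 / 4) + of_int (n\<^sup>2) / 2 \<le> (cmod (of_int m * t + of_int n))\<^sup>2"
proof -
  define M N X Y where "M = real_of_int m" and "N = real_of_int n" and "X = Re t" and "Y = Im t"
  have "(cmod (of_int m * t + of_int n))\<^sup>2 = (M * X + N)\<^sup>2 + M\<^sup>2 * Y\<^sup>2"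
    unfolding cmod_power2 by (simp add: M_def N_def X_def Y_def power_mult_distrib)
  moreover have "X\<^sup>2 \<le> (1 / 2)\<^sup>2" using x unfolding X_def by (metis abs_ge_zero power2_abs power_mono)
  hence "M\<^sup>2 * X\<^sup>2 \<le> M\<^sup>2 * (1 / 4)" by (intro mult_left_mono) (auto simp: power2_eq_square)
  moreover have "0 \<le> (2 * (M * X) + N)\<^sup>2" by simp
  hence "N\<^sup>2 / 2 \<le> (M * X + N)\<^sup>2 + M\<^sup>2 * X\<^sup>2" by (simp add: power2_eq_square algebra_simps)
  ultimately have "M\<^sup>2 * (Y\<^sup>2 - 1 / 4) + N\<^sup>2 / 2 \<le> (cmod (of_int m * t + of_int n))\<^sup>2"
    by (simp add: algebra_simps)
  thus ?thesis by (simp add: M_def N_def Y_def)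
qed

lemma eis_norm_le:
  assumes v: "v \<noteq> (False, False)" and t: "t \<in> upper_half_plane" and c: "c \<ge> 0"
    and le: "\<And>m n. (m, n) \<in> parity_class v \<Longrightarrow> cmod (inverse ((of_int m * t + of_int n) ^ 4)) \<le> c * z2_weight (m, n)"
  shows "cmod (eis v t) \<le> c * infsum z2_weight UNIV"
proof -
  have s: "(\<lambda>p. c * z2_weight p) summable_on parity_class v" by (rule summable_z2_weight_scaled)
  have "cmod (eis v t) \<le> (\<Sum>\<^sub>\<infinity>p\<in>parity_class v. c * z2_weight p)"
    unfolding eis_def case_prod_unfold
    by (rule norm_infsum_le[OF has_sum_infsum[OF abs_summable_summable[OF eis_summable[OF v t]]] has_sum_infsum[OF s]])
      (use le in auto)
  also have "\<dots> \<le> (\<Sum>\<^sub>\<infinity>p\<in>UNIV. c * z2_weight p)"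
    by (rule infsum_mono_neutral[OF s summable_z2_weight_scaled]) (use c in \<open>auto simp: z2_weight_def\<close>)
  also have "\<dots> = c * infsum z2_weight UNIV" by (rule infsum_cmult_right')
  finally show ?thesis .
qed

text \<open>When \<open>m\<close> is odd no term with \<open>m = 0\<close> occurs, and every term
  tends to 0 at the cusp. The rate \<open>1 / Im t\<close> is all that the cusp condition asks
  for.\<close>

lemma eis_strip_bounds:
  assumes x: "\<bar>Re t\<bar> \<le> 1 / 2" and y: "Im t \<ge> 1"
  shows "v \<noteq> (False, False) \<Longrightarrow> cmod (eis v t) \<le> 16 * infsum z2_weight UNIV"
    and "cmod (eis (True, b) t) \<le> 8 / Im t * infsum z2_weight UNIV"
proof -
  have H: "t \<in> upper_half_plane" using y by (simp add: upper_half_plane_def)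
  have Y: "(Im t)\<^sup>2 \<ge> 1" using y power_mono[of 1 "Im t" 2] by simp
  show "cmod (eis v t) \<le> 16 * infsum z2_weight UNIV" if v: "v \<noteq> (False, False)"
  proof (rule eis_norm_le[OF v H])
    fix m n assume mn: "(m, n) \<in> parity_class v"
    have "real_of_int (m\<^sup>2) * (1 / 2) \<le> real_of_int (m\<^sup>2) * ((Im t)\<^sup>2 - 1 / 4)" using Y by (intro mult_left_mono) auto
    hence "1 / 2 * real_of_int (m\<^sup>2 + n\<^sup>2) \<le> (cmod (of_int m * t + of_int n))\<^sup>2"
      using strip_quadratic_bound[OF x y, of m n] by simp
    from inverse_fourth_bound[OF _ parity_class_nonzero[OF v mn] this]
    show "cmod (inverse ((of_int m * t + of_int n) ^ 4)) \<le> 16 * z2_weight (m, n)" by (simp add: power2_eq_square)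
  qed simp
  show "cmod (eis (True, b) t) \<le> 8 / Im t * infsum z2_weight UNIV"
  proof (rule eis_norm_le[OF _ H])
    fix m n assume mn: "(m, n) \<in> parity_class (True, b)"
    define M N where "M = (real_of_int m)\<^sup>2" and "N = (real_of_int n)\<^sup>2"
    define u where "u = (cmod (of_int m * t + of_int n))\<^sup>2"
    have "m \<noteq> 0" using mn by (auto simp: parity_class_def)
    hence "m\<^sup>2 \<ge> 1" by (smt (verit) zero_less_power2)
    hence M: "M \<ge> 1" unfolding M_def by (metis of_int_1_le_iff of_int_power)
    have N: "N \<ge> 0" by (simp add: N_def)
    have u: "M * ((Im t)\<^sup>2 - 1 / 4) + N / 2 \<le> u" using strip_quadratic_bound[OF x y, of m n] by (simp add: M_def N_def u_def)
    have "Im t * 1 \<le> Im t * Im t" using y by (intro mult_left_mono) auto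
    hence Yq: "Im t \<le> (Im t)\<^sup>2" by (simp add: power2_eq_square)
    have "M * (Im t / 2) \<le> M * ((Im t)\<^sup>2 - 1 / 4)" using Yq y M by (intro mult_left_mono) auto
    hence 1: "M * (Im t / 2) \<le> u" using u N by linarith
    have "M * (1 / 2) \<le> M * ((Im t)\<^sup>2 - 1 / 4)" using Y M by (intro mult_left_mono) auto
    moreover have "(M + N) / 2 = M * (1 / 2) + N / 2" by (simp add: add_divide_distrib)
    ultimately have 2: "(M + N) / 2 \<le> u" using u by linarith
    \<comment> \<open>The quantity \<open>u\<close> is bounded below in two ways:
      \<open>M * (Im t / 2)\<close> supplies the decay and \<open>(M + N) / 2\<close> the
      summability, and \<open>u^2\<close> is estimated by their product.\<close>
    have "Im t / 4 * ((1 + M) * (1 + N)) \<le> (M * (Im t / 2)) * (1 + N)"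
    proof -
      have "Im t / 4 * (1 + M) \<le> Im t / 4 * (2 * M)" using M y by (intro mult_left_mono) auto
      hence "Im t / 4 * (1 + M) * (1 + N) \<le> Im t / 4 * (2 * M) * (1 + N)" using N by (intro mult_right_mono) auto
      thus ?thesis by (simp add: mult_ac)
    qed
    also have "\<dots> \<le> u * (2 * u)" using 1 2 M N y by (intro mult_mono) auto
    finally have 3: "Im t / 4 * ((1 + M) * (1 + N)) \<le> 2 * u\<^sup>2" by (simp add: power2_eq_square)
    have u2: "u\<^sup>2 = cmod ((of_int m * t + of_int n) ^ 4)" by (simp add: u_def norm_power)
    have pos: "Im t / 8 * ((1 + M) * (1 + N)) > 0" using y M N by (simp add: add_pos_nonneg)
    have "inverse (u\<^sup>2) \<le> inverse (Im t / 8 * ((1 + M) * (1 + N)))"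
      by (rule le_imp_inverse_le[OF _ pos]) (use 3 in simp)
    also have "\<dots> = 8 / Im t * z2_weight (m, n)" 
      by (simp only: z2_weight_def M_def N_def fst_conv snd_conv inverse_mult_distrib divide_inverse inverse_inverse_eq mult_ac)
    finally show "cmod (inverse ((of_int m * t + of_int n) ^ 4)) \<le> 8 / Im t * z2_weight (m, n)"
      by (simp add: u2 norm_inverse)
  qed (use y in auto)
qed

subsection \<open>A form with positive central value\<close>

definition int_sum4 :: "complex \<Rightarrow> complex" where
  "int_sum4 z = (\<Sum>\<^sub>\<infinity>n::int. inverse ((z + of_int n) ^ 4))"

lemma int_sum4_summable:
  assumes z: "z \<in> upper_half_plane"
  shows "(\<lambda>n::int. cmod (inverse ((z + of_int n) ^ 4))) summable_on A"
proof -
  define e where "e = (Im z)\<^sup>2 / ((cmod z)\<^sup>2 + 1)"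
  have "(cmod z)\<^sup>2 + 1 > 0" by (simp add: add_nonneg_pos)
  hence e: "e > 0" using z by (simp add: e_def upper_half_plane_def)
  have "(\<lambda>n::int. 4 / e\<^sup>2 * (1 / 2) * inverse (1 + (real_of_int n)\<^sup>2)) summable_on UNIV"
    by (intro summable_on_cmult_right summable_inverse_square_int)
  hence "(\<lambda>n::int. cmod (inverse ((z + of_int n) ^ 4))) summable_on UNIV"
  proof (rule summable_on_comparison_test)
    fix n :: int
    have "cmod (inverse ((z + of_int n) ^ 4)) \<le> 4 / e\<^sup>2 * z2_weight (1, n)"
      by (rule inverse_fourth_bound[OF e]) (use upper_quadratic_bound[of z 1 n] in \<open>simp_all add: e_def\<close>)
    also have "z2_weight (1, n) = 1 / 2 * inverse (1 + (real_of_int n)\<^sup>2)"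
      unfolding z2_weight_def inverse_mult_distrib by simp
    finally show "cmod (inverse ((z + of_int n) ^ 4)) \<le> 4 / e\<^sup>2 * (1 / 2) * inverse (1 + (real_of_int n)\<^sup>2)"
      by (simp only: mult.assoc)
  qed simp
  thus ?thesis by (rule summable_on_subset_banach) simp
qed

lemma int_sum4_minus: "int_sum4 (- z) = int_sum4 z"
proof -
  have bij: "bij_betw uminus (UNIV :: int set) UNIV" by (rule bij_betwI[of _ _ _ uminus]) auto
  have "inverse ((- z + of_int n) ^ 4) = inverse ((z + of_int (- n)) ^ 4)" for n :: int
  proof -
    have "- z + of_int n = - (z + of_int (- n))" by simp
    thus ?thesis by (simp only: power_minus_even even_numeral)
  qed
  thus ?thesis unfolding int_sum4_def
    using infsum_reindex_bij_betw[OF bij, of "\<lambda>n. inverse ((z + of_int n) ^ 4)"] by simp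
qed

text \<open>The Lipschitz formula in weight 4. The two halves of the sum are values of
  \<open>Polygamma 3\<close> at \<open>z\<close> and \<open>1 - z\<close>, and the reflection
  formula evaluates their sum.\<close>

lemma int_sum4_formula:
  assumes z: "z \<in> upper_half_plane"
  shows "int_sum4 z = 8 * of_real pi ^ 4 / 3 * cubes_gf (nome z)"
proof -
  define f where "f n = inverse ((z + of_int n) ^ 4)" for n :: int
  have fs: "f summable_on A" for A
    unfolding f_def by (rule abs_summable_summable, rule int_sum4_summable[OF z])
  have i1: "inj_on int UNIV" and i2: "inj_on (\<lambda>k. - 1 - int k) UNIV" by (auto simp: inj_on_def)
  \<comment> \<open>The factor 6 is the factorial of 3 in the series of
    \<open>Polygamma 3\<close>.\<close>
  have P: "6 * infsum (\<lambda>k::nat. inverse ((w + of_nat k) ^ 4)) UNIV = Polygamma 3 w"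
    if "(\<lambda>k::nat. inverse ((w + of_nat k) ^ 4)) summable_on UNIV" for w :: complex
  proof -
    have "(\<lambda>k::nat. inverse ((w + of_nat k) ^ 4)) sums infsum (\<lambda>k::nat. inverse ((w + of_nat k) ^ 4)) UNIV"
      by (rule has_sum_imp_sums[OF has_sum_infsum[OF that]])
    hence "(\<Sum>k. inverse ((w + of_nat k) ^ 4)) = infsum (\<lambda>k::nat. inverse ((w + of_nat k) ^ 4)) UNIV"
      by (simp add: sums_iff)
    thus ?thesis by (simp add: Polygamma_def fact_numeral)
  qed
  have e2: "f (- 1 - int k) = inverse ((1 - z + of_nat k) ^ 4)" for k
  proof -
    have "z + of_int (- 1 - int k) = - (1 - z + of_nat k)" by simp
    thus ?thesis unfolding f_def by (simp only: power_minus_even even_numeral)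
  qed
  have "int_sum4 z = infsum f (range int) + infsum f (range (\<lambda>k. - 1 - int k))"
    unfolding int_sum4_def f_def[symmetric] int_UNIV_split by (rule infsum_Un_disjoint[OF fs fs]) auto
  also have "infsum f (range int) = infsum (\<lambda>k::nat. inverse ((z + of_nat k) ^ 4)) UNIV"
    unfolding infsum_reindex[OF i1] by (simp add: o_def f_def)
  also have "infsum f (range (\<lambda>k. - 1 - int k)) = infsum (\<lambda>k::nat. inverse ((1 - z + of_nat k) ^ 4)) UNIV"
    unfolding infsum_reindex[OF i2] by (simp only: o_def e2)
  finally have s: "int_sum4 z = infsum (\<lambda>k::nat. inverse ((z + of_nat k) ^ 4)) UNIV + infsum (\<lambda>k::nat. inverse ((1 - z + of_nat k) ^ 4)) UNIV" .
  have s1: "(\<lambda>k::nat. inverse ((z + of_nat k) ^ 4)) summable_on UNIV"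
    using fs[of "range int"] unfolding summable_on_reindex[OF i1] by (simp add: o_def f_def)
  have s2: "(\<lambda>k::nat. inverse ((1 - z + of_nat k) ^ 4)) summable_on UNIV"
    using fs[of "range (\<lambda>k. - 1 - int k)"] unfolding summable_on_reindex[OF i2] by (simp only: o_def e2)
  have "6 * int_sum4 z = Polygamma 3 z + Polygamma 3 (1 - z)"
    unfolding s P[OF s1, symmetric] P[OF s2, symmetric] by (simp add: algebra_simps)
  also have "\<dots> = 16 * of_real pi ^ 4 * cubes_gf (nome z)" by (rule Polygamma_3_reflection[OF z])
  finally have "6 * int_sum4 z = 6 * (8 * of_real pi ^ 4 / 3 * cubes_gf (nome z))" by simp
  thus ?thesis by (simp only: mult_cancel_left) simp
qed

definition real_cubes_gf :: "real \<Rightarrow> real" where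
  "real_cubes_gf x = x * (1 + 4 * x + x\<^sup>2) / (1 - x) ^ 4"

lemma cubes_gf_of_real: "cubes_gf (of_real x) = of_real (real_cubes_gf x)"
  by (simp add: cubes_gf_def real_cubes_gf_def)

lemma real_cubes_gf_pos: "0 < x \<Longrightarrow> x < 1 \<Longrightarrow> real_cubes_gf x > 0"
  by (simp add: real_cubes_gf_def add_pos_pos)

text \<open>The factor \<open>1 - 4 * x + x^2\<close> is positive up to its root
  \<open>2 - sqrt 3\<close>, which exceeds 1/4.\<close>

lemma real_cubes_gf_neg:
  assumes "0 < x" "x < 1 / 4"
  shows "real_cubes_gf (- x) < 0"
proof -
  have "1 + 4 * (- x) + (- x)\<^sup>2 > 0" using assms by (simp add: add_pos_nonneg)
  thus ?thesis using assms by (simp add: real_cubes_gf_def divide_neg_pos mult_neg_pos)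
qed

text \<open>As a power series the sum is twice the part of even degree, with positive coefficients;
  the proof compares the two fractions instead.\<close>

lemma real_cubes_gf_sym_pos:
  assumes x: "0 < x" "x < 1"
  shows "real_cubes_gf x + real_cubes_gf (- x) > 0"
proof -
  define A where "A = 1 + 4 * x + x\<^sup>2"
  have A: "A > 0" using x by (simp add: A_def add_pos_pos)
  have "(1 - x) ^ 4 \<le> (1 + x) ^ 4" using x by (intro power_mono) auto
  hence "A / (1 + x) ^ 4 \<le> A / (1 - x) ^ 4" using A x by (intro divide_left_mono) auto
  moreover have "(1 - 4 * x + x\<^sup>2) / (1 + x) ^ 4 < A / (1 + x) ^ 4"
    using x by (intro divide_strict_right_mono) (auto simp: A_def)
  ultimately have "(1 - 4 * x + x\<^sup>2) / (1 + x) ^ 4 < A / (1 - x) ^ 4" by linarith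
  hence "x * ((1 - 4 * x + x\<^sup>2) / (1 + x) ^ 4) < x * (A / (1 - x) ^ 4)" using x by (intro mult_strict_left_mono)
  thus ?thesis by (simp add: real_cubes_gf_def A_def)
qed

text \<open>The closed form of row \<open>m\<close> of \<open>eis (True, b)\<close> at
  \<open>\<i> * y\<close>. The constant is \<open>8 * pi^4 / 3\<close> from the Lipschitz formula
  divided by \<open>2^4\<close>, and the sign is \<open>exp (\<i> * pi * b)\<close>.\<close>

definition axis_term :: "bool \<Rightarrow> real \<Rightarrow> int \<Rightarrow> real" where
  "axis_term b y m = pi ^ 4 / 6 * real_cubes_gf ((if b then - 1 else 1) * exp (- (pi * \<bar>of_int m\<bar> * y)))"

text \<open>Writing \<open>n = 2 * n' + b\<close> extracts \<open>2^4\<close> from each denominator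
  and leaves a full sum over the integers at \<open>z = (m \<i> y + b) / 2\<close>.\<close>

lemma eis_row:
  assumes y: "y > 0" and m: "odd m"
  shows "(\<Sum>\<^sub>\<infinity>n\<in>{n. odd n = b}. inverse ((of_int m * (\<i> * of_real y) + of_int n) ^ 4)) = of_real (axis_term b y m)"
proof -
  define z where "z = (of_int m * (\<i> * of_real y) + of_bool b) / 2"
  define s :: real where "s = (if b then - 1 else 1)"
  have bij: "bij_betw (\<lambda>n::int. 2 * n + of_bool b) UNIV {n. odd n = b}"
  proof (rule bij_betwI[of _ _ _ "\<lambda>n. n div 2"])
    show "(\<lambda>n::int. 2 * n + of_bool b) \<in> UNIV \<rightarrow> {n. odd n = b}" by auto
    show "2 * (x div 2) + of_bool b = x" if "x \<in> {n. odd n = b}" for x :: int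
      using that by (cases b) auto
  qed (auto simp: of_bool_def)
  have t: "inverse ((of_int m * (\<i> * of_real y) + of_int (2 * n + of_bool b)) ^ 4) = 1 / 16 * inverse ((z + of_int n) ^ 4)" for n
  proof -
    have eq: "of_int m * (\<i> * of_real y) + of_int (2 * n + of_bool b) = 2 * (z + of_int n)"
      by (simp add: z_def)
    show ?thesis unfolding eq power_mult_distrib by simp
  qed
  have "(\<Sum>\<^sub>\<infinity>n\<in>{n. odd n = b}. inverse ((of_int m * (\<i> * of_real y) + of_int n) ^ 4)) =
      (\<Sum>\<^sub>\<infinity>n. 1 / 16 * inverse ((z + of_int n) ^ 4))"
    unfolding infsum_reindex_bij_betw[OF bij, symmetric] t ..
  also have "\<dots> = 1 / 16 * int_sum4 z"
    unfolding int_sum4_def by (rule infsum_cmult_right')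
  also have "int_sum4 z = 8 * of_real pi ^ 4 / 3 * of_real (real_cubes_gf (s * exp (- (pi * \<bar>of_int m\<bar> * y))))"
  proof -
    have sb: "exp (\<i> * of_real pi * of_bool b) = complex_of_real s" "exp (- (\<i> * of_real pi * of_bool b)) = complex_of_real s"
      by (auto simp: s_def exp_minus)
    have "m \<noteq> 0" using m by auto
    \<comment> \<open>For negative \<open>m\<close> the point \<open>z\<close> lies in the lower
      half-plane; \<open>int_sum4\<close> is even, so \<open>- z\<close> can replace it.\<close>
    define w where "w = (if m > 0 then z else - z)"
    have "Im w = \<bar>of_int m\<bar> * y / 2" by (auto simp: w_def z_def)
    moreover have "\<bar>of_int m\<bar> * y > 0" using y \<open>m \<noteq> 0\<close> by simp
    ultimately have "Im w > 0" by linarith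
    hence w: "w \<in> upper_half_plane" by (simp add: upper_half_plane_def)
    have "nome w = of_real (s * exp (- (pi * \<bar>of_int m\<bar> * y)))"
    proof (cases "m > 0")
      case True
      have "2 * w = of_int m * (\<i> * of_real y) + of_bool b" using True by (simp add: w_def z_def)
      hence "of_real pi * \<i> * (2 * w) = of_real pi * \<i> * (of_int m * (\<i> * of_real y) + of_bool b)" by simp
      hence "2 * of_real pi * \<i> * w = of_real (- (pi * \<bar>of_int m\<bar> * y)) + \<i> * of_real pi * of_bool b"
        using True by (simp add: algebra_simps)
      hence "nome w = exp (of_real (- (pi * \<bar>of_int m\<bar> * y))) * exp (\<i> * of_real pi * of_bool b)"
        by (simp only: nome_def exp_add)
      thus ?thesis unfolding sb exp_of_real of_real_mult by (simp only: mult.commute)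
    next
      case False
      have "2 * w = - (of_int m * (\<i> * of_real y) + of_bool b)" using False by (simp add: w_def z_def add_divide_distrib)
      hence "of_real pi * \<i> * (2 * w) = of_real pi * \<i> * - (of_int m * (\<i> * of_real y) + of_bool b)" by simp
      hence "2 * of_real pi * \<i> * w = of_real (- (pi * \<bar>of_int m\<bar> * y)) + - (\<i> * of_real pi * of_bool b)"
        using False by (simp add: algebra_simps)
      hence "nome w = exp (of_real (- (pi * \<bar>of_int m\<bar> * y))) * exp (- (\<i> * of_real pi * of_bool b))"
        by (simp only: nome_def exp_add)
      thus ?thesis unfolding sb exp_of_real of_real_mult by (simp only: mult.commute)
    qed
    hence "int_sum4 w = 8 * of_real pi ^ 4 / 3 * of_real (real_cubes_gf (s * exp (- (pi * \<bar>of_int m\<bar> * y))))"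
      unfolding int_sum4_formula[OF w] cubes_gf_of_real[symmetric] by simp
    moreover have "int_sum4 w = int_sum4 z" by (simp add: w_def int_sum4_minus)
    ultimately show ?thesis by simp
  qed
  finally show ?thesis by (simp add: axis_term_def s_def)
qed

definition axis_sum :: "bool \<Rightarrow> real \<Rightarrow> real" where
  "axis_sum b y = infsum (axis_term b y) {m. odd m}"

lemma eis_axis:
  assumes y: "y > 0"
  shows "axis_term b y summable_on {m. odd m}"
    and "eis (True, b) (\<i> * of_real y) = of_real (axis_sum b y)"
proof -
  define t where "t = \<i> * of_real y"
  have t: "t \<in> upper_half_plane" using y by (simp add: t_def upper_half_plane_def)
  define f where "f p = inverse ((of_int (fst p) * t + of_int (snd p)) ^ 4)" for p :: "int \<times> int"
  have pc: "parity_class (True, b) = Sigma {m. odd m} (\<lambda>_. {n. odd n = b})"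
    by (auto simp: parity_class_def)
  have fs: "f summable_on Sigma {m. odd m} (\<lambda>_. {n. odd n = b})"
    unfolding pc[symmetric] f_def by (rule abs_summable_summable[OF eis_summable[OF _ t]]) simp
  have row: "infsum (\<lambda>n. f (m, n)) {n. odd n = b} = complex_of_real (axis_term b y m)" if "m \<in> {m. odd m}" for m
    using eis_row[OF y, of m b] that by (simp add: f_def t_def)
  have "(\<lambda>m. infsum (\<lambda>n. f (m, n)) {n. odd n = b}) summable_on {m. odd m}"
    using summable_on_Sigma_banach[of "\<lambda>m n. f (m, n)" "{m. odd m}" "\<lambda>_. {n. odd n = b}"] fs by simp
  hence s: "(\<lambda>m. complex_of_real (axis_term b y m)) summable_on {m. odd m}"
    by (rule summable_on_cong[THEN iffD1, rotated]) (rule row)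
  from summable_on_Re[OF this] show sr: "axis_term b y summable_on {m. odd m}" by simp
  have "eis (True, b) t = infsum (\<lambda>m. infsum (\<lambda>n. f (m, n)) {n. odd n = b}) {m. odd m}"
    unfolding eis_def pc case_prod_unfold f_def[symmetric] by (rule infsum_Sigma_banach[OF fs, symmetric])
  also have "\<dots> = infsum (\<lambda>m. complex_of_real (axis_term b y m)) {m. odd m}"
    by (rule infsum_cong) (rule row)
  also have "\<dots> = of_real (axis_sum b y)"
    unfolding axis_sum_def by (rule infsumI, rule has_sum_of_real, rule has_sum_infsum[OF sr])
  finally show "eis (True, b) (\<i> * of_real y) = of_real (axis_sum b y)" by (simp add: t_def)
qed

lemma infsum_pos:
  fixes f :: "int \<Rightarrow> real"
  assumes "f summable_on {m. odd m}" "\<And>m. odd m \<Longrightarrow> f m > 0"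
  shows "infsum f {m. odd m} > 0"
proof -
  have "((\<lambda>_. 0) has_sum (0::real)) {m :: int. odd m}" by simp
  thus ?thesis
    by (rule has_sum_strict_mono[OF _ has_sum_infsum[OF assms(1)], where x = 1]) (use assms(2) in \<open>auto intro: less_imp_le\<close>)
qed

lemma axis_exp_bounds:
  assumes "y > 0" "odd m"
  shows "0 < exp (- (pi * \<bar>of_int m\<bar> * y))" "exp (- (pi * \<bar>of_int m\<bar> * y)) < 1"
proof -
  have "m \<noteq> 0" using assms(2) by auto
  thus "exp (- (pi * \<bar>of_int m\<bar> * y)) < 1" using assms(1) by simp
qed simp

lemma axis_sum_pos: "y > 0 \<Longrightarrow> axis_sum False y > 0"
  unfolding axis_sum_def
  by (rule infsum_pos[OF eis_axis(1)]) (use axis_exp_bounds real_cubes_gf_pos in \<open>auto simp: axis_term_def intro!: mult_pos_pos\<close>)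

text \<open>For \<open>y \<ge> 1\<close> and odd \<open>m\<close> the nome has absolute value at
  most \<open>exp (- pi)\<close>, small enough for every row to be negative. The range suffices
  because \<open>half_mellin\<close> integrates over \<open>y \<ge> 1\<close>.\<close>

lemma axis_sum_neg:
  assumes y: "y \<ge> 1"
  shows "axis_sum True y < 0"
proof -
  have y0: "y > 0" using y by simp
  have "infsum (\<lambda>m. - axis_term True y m) {m. odd m} > 0"
  proof (rule infsum_pos)
    show "(\<lambda>m. - axis_term True y m) summable_on {m. odd m}"
      using eis_axis(1)[OF y0, of True] by (simp add: summable_on_uminus)
    fix m :: int assume m: "odd m"
    hence "m \<noteq> 0" by auto
    hence "1 \<le> \<bar>of_int m\<bar> * y" using y mult_mono[of 1 "\<bar>real_of_int m\<bar>" 1 y] by simp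
    hence "pi * 1 \<le> pi * (\<bar>of_int m\<bar> * y)" by (intro mult_left_mono) auto
    hence "3 < pi * (\<bar>of_int m\<bar> * y)" using pi_gt3 by linarith
    hence "3 < pi * \<bar>of_int m\<bar> * y" by (simp only: mult.assoc)
    hence "exp (- (pi * \<bar>of_int m\<bar> * y)) < exp (- 3)" by simp
    \<comment> \<open>From \<open>exp 3 \<ge> 1 + 3\<close>.\<close>
    also have "exp (- 3 :: real) \<le> 1 / 4"
      using exp_ge_add_one_self[of "3::real"] by (simp add: exp_minus field_simps)
    finally have "real_cubes_gf (- exp (- (pi * \<bar>of_int m\<bar> * y))) < 0" by (intro real_cubes_gf_neg) auto
    thus "- axis_term True y m > 0" by (simp add: axis_term_def mult_pos_neg)
  qed
  thus ?thesis by (simp add: axis_sum_def infsum_uminus)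
qed

lemma axis_sum_add_pos:
  assumes y: "y > 0"
  shows "axis_sum False y + axis_sum True y > 0"
proof -
  have "infsum (\<lambda>m. axis_term False y m + axis_term True y m) {m. odd m} > 0"
  proof (rule infsum_pos)
    show "(\<lambda>m. axis_term False y m + axis_term True y m) summable_on {m. odd m}"
      by (intro summable_on_add eis_axis(1)[OF y])
    fix m :: int assume "odd m"
    from real_cubes_gf_sym_pos[OF axis_exp_bounds[OF y this]]
    have "pi ^ 4 / 6 * (real_cubes_gf (exp (- (pi * \<bar>of_int m\<bar> * y))) + real_cubes_gf (- exp (- (pi * \<bar>of_int m\<bar> * y)))) > 0"
      by (intro mult_pos_pos) auto
    thus "axis_term False y m + axis_term True y m > 0"
      unfolding distrib_left by (simp add: axis_term_def)
  qed
  thus ?thesis unfolding axis_sum_def by (simp add: infsum_add eis_axis(1)[OF y])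
qed

text \<open>The class \<open>(False, True)\<close> contains the row \<open>m = 0\<close>, which the
  Lipschitz formula does not reach. The inversion of the axis carries it to
  \<open>(True, False)\<close>.\<close>

lemma eis_axis_inverse:
  assumes y: "y > 0"
  shows "eis (False, True) (\<i> * of_real y) = of_real (axis_sum False (1 / y) / y ^ 4)"
proof -
  define t where "t = \<i> * of_real y"
  have t: "t \<in> upper_half_plane" using y by (simp add: t_def upper_half_plane_def)
  have "eis (True, False) (- 1 / t) = t ^ 4 * eis (False, True) t"
    using eis_moebius[of 0 0 "- 1" 1 t "(True, False)"] t by simp
  moreover have "- 1 / t = \<i> * of_real (1 / y)" using y by (simp add: t_def field_simps)
  moreover have "t ^ 4 = of_real (y ^ 4)" by (simp add: t_def power_mult_distrib)
  ultimately have "of_real (axis_sum False (1 / y)) = of_real (y ^ 4) * eis (False, True) t"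
    using eis_axis(2)[of "1 / y" False] y by simp
  thus ?thesis using y by (simp add: t_def field_simps)
qed

text \<open>The sign makes the form positive on the imaginary axis, where \<open>eis (True, True)\<close> is negative and the
  other two factors and the sum are positive.\<close>

definition test_form :: "nat \<Rightarrow> complex \<Rightarrow> complex" where
  "test_form j t = (if t \<in> upper_half_plane then
     - (eis (True, False) t * eis (True, True) t * eis (False, True) t) *
       (eis (True, False) t + eis (True, True) t + eis (False, True) t) ^ j else 0)"

lemma moebius_upper:
  assumes det: "a * d - b * c = (1::int)" and t: "t \<in> upper_half_plane"
  shows "(of_int a * t + of_int b) / (of_int c * t + of_int d) \<in> upper_half_plane"
proof -
  have w: "area (t, 1) > 0" using t by (simp add: area_def upper_half_plane_def)
  have "area (act (a, b, c, d) (t, 1)) > 0" using w det by (simp add: area_act del: act.simps)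
  thus ?thesis using quotient_in_upper[of "act (a, b, c, d) (t, 1)"] by simp
qed

lemma test_form_modular:
  assumes det: "a * d - b * c = (1::int)" and t: "t \<in> upper_half_plane"
  shows "test_form j ((of_int a * t + of_int b) / (of_int c * t + of_int d)) =
    (of_int c * t + of_int d) ^ (12 + 4 * j) * test_form j t"
proof -
  define J where "J = of_int c * t + of_int d"
  define u where "u = (of_int a * t + of_int b) / J"
  have u: "u \<in> upper_half_plane" using moebius_upper[OF det t] by (simp add: u_def J_def)
  define e1 e2 e3 where "e1 = eis (odd a, odd b) t" and "e2 = eis (odd (a + c), odd (b + d)) t" and "e3 = eis (odd c, odd d) t"
  have e: "eis (True, False) u = J ^ 4 * e1" "eis (True, True) u = J ^ 4 * e2" "eis (False, True) u = J ^ 4 * e3"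
    unfolding u_def J_def using eis_moebius[OF det t, of "(True, False)"] eis_moebius[OF det t, of "(True, True)"]
      eis_moebius[OF det t, of "(False, True)"] by (simp_all add: e1_def e2_def e3_def)
  \<comment> \<open>Modulo 2 the matrix is invertible, so \<open>e1\<close>, \<open>e2\<close>,
    \<open>e3\<close> are the three Eisenstein series in some order.\<close>
  have "odd (a * d - b * c)" using det by simp
  hence perm: "e1 * e2 * e3 = eis (True, False) t * eis (True, True) t * eis (False, True) t"
    "e1 + e2 + e3 = eis (True, False) t + eis (True, True) t + eis (False, True) t"
    by (cases "odd a"; cases "odd b"; cases "odd c"; cases "odd d"; simp add: e1_def e2_def e3_def)+
  have "test_form j u = - (J ^ 12 * (e1 * e2 * e3)) * (J ^ 4 * (e1 + e2 + e3)) ^ j"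
    using u by (simp add: test_form_def e distrib_left flip: power_add)
  also have "\<dots> = J ^ (12 + 4 * j) * test_form j t"
    unfolding perm using t by (simp add: test_form_def power_mult_distrib power_add power_mult)
  finally show ?thesis by (simp add: u_def J_def)
qed

text \<open>At the cusp one decaying factor, \<open>eis (True, False)\<close>, is enough, as all
  others stay bounded there.\<close>

lemma test_form_cusp_form: "test_form j \<in> cusp_forms (12 + 4 * int j)"
proof -
  have hol: "test_form j holomorphic_on upper_half_plane"
  proof (rule holomorphic_transform)
    show "(\<lambda>t. - (eis (True, False) t * eis (True, True) t * eis (False, True) t) *
       (eis (True, False) t + eis (True, True) t + eis (False, True) t) ^ j) holomorphic_on upper_half_plane"
      by (intro holomorphic_intros eis_holomorphic) auto
  qed (simp add: test_form_def)
  have per: "test_form j (t + of_int n) = test_form j t" if "t \<in> upper_half_plane" for t and n :: int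
    using test_form_modular[of 1 1 n 0 t j] that by simp
  have lim: "\<exists>Y>0. \<forall>t. Im t \<ge> Y \<longrightarrow> cmod (test_form j t) < e" if e: "e > 0" for e
  proof -
    define S where "S = infsum z2_weight UNIV"
    have S: "S \<ge> 0" unfolding S_def by (rule infsum_nonneg) (simp add: z2_weight_def)
    define K where "K = 8 * S * (16 * S) * (16 * S) * (48 * S) ^ j"
    have K: "K \<ge> 0" using S by (simp add: K_def)
    have "cmod (test_form j t) < e" if t: "Im t \<ge> K / e + 1" for t
    proof -
      have y: "Im t \<ge> 1" using t K e by (smt (verit) divide_nonneg_pos)
      \<comment> \<open>The bounds hold in the strip \<open>\<bar>Re t\<bar> \<le> 1 / 2\<close>;
        periodicity moves \<open>t\<close> into it.\<close>
      define n where "n = - round (Re t)"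
      define t' where "t' = t + of_int n"
      have x: "\<bar>Re t'\<bar> \<le> 1 / 2" using of_int_round_abs_le[of "Re t"] by (simp add: t'_def n_def abs_minus_commute)
      have y': "Im t' = Im t" by (simp add: t'_def)
      have H: "t \<in> upper_half_plane" "t' \<in> upper_half_plane" using y y' by (auto simp: upper_half_plane_def)
      have b1: "cmod (eis (True, False) t') \<le> 8 / Im t * S" using eis_strip_bounds(2)[OF x, of False] y y' by (simp add: S_def)
      have b: "cmod (eis v t') \<le> 16 * S" if "v \<noteq> (False, False)" for v
        using eis_strip_bounds(1)[OF x _ that] y y' by (simp add: S_def)
      have "cmod (eis (True, False) t' + eis (True, True) t' + eis (False, True) t') \<le> 16 * S + 16 * S + 16 * S"
        by (intro order_trans[OF norm_triangle_ineq] add_mono b) auto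
      hence b48: "cmod (eis (True, False) t' + eis (True, True) t' + eis (False, True) t') \<le> 48 * S" by simp
      have "cmod (test_form j t) = cmod (test_form j t')" using per[OF H(1), of n] by (simp add: t'_def)
      also have "\<dots> = cmod (eis (True, False) t') * cmod (eis (True, True) t') * cmod (eis (False, True) t') *
          cmod (eis (True, False) t' + eis (True, True) t' + eis (False, True) t') ^ j"
        using H by (simp add: test_form_def norm_mult norm_power)
      also have "\<dots> \<le> (8 / Im t * S) * (16 * S) * (16 * S) * (48 * S) ^ j"
        using S y by (intro mult_mono power_mono b48 b b1 mult_nonneg_nonneg zero_le_power) auto
      also have "\<dots> = K / Im t" by (simp add: K_def)
      also have "\<dots> < e"
      proof -
        have "K / e < Im t" using t by simp
        thus ?thesis using e y by (simp add: field_simps)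
      qed
      finally show ?thesis .
    qed
    moreover have "K / e + 1 > 0" using K e by (simp add: add_nonneg_pos)
    ultimately show ?thesis by blast
  qed
  have ex: "\<exists>a. q_expansion (test_form j) a \<and> a 0 = 0"
    by (rule q_expansion_exists[OF hol per lim])
  have mod: "test_form j ((of_int a * t + of_int b) / (of_int c * t + of_int d)) = (of_int c * t + of_int d) powi (12 + 4 * int j) * test_form j t"
    if "a * d - b * c = 1" "t \<in> upper_half_plane" for a b c d :: int and t
  proof -
    have "12 + 4 * int j = int (12 + 4 * j)" by simp
    thus ?thesis using test_form_modular[OF that, of j] by (simp only: power_int_of_nat)
  qed
  have "\<forall>t. t \<notin> upper_half_plane \<longrightarrow> test_form j t = 0" by (simp add: test_form_def)
  thus ?thesis using hol ex mod unfolding cusp_forms_def by blast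
qed

lemma test_form_axis:
  assumes y: "y \<ge> 1"
  shows "\<exists>r>0. on_imag_axis (test_form j) y = complex_of_real r"
proof -
  have y0: "y > 0" using y by simp
  define A B C where "A = axis_sum False y" and "B = axis_sum True y" and "C = axis_sum False (1 / y) / y ^ 4"
  have p: "A > 0" "B < 0" "C > 0" "A + B > 0"
    using axis_sum_pos[OF y0] axis_sum_neg[OF y] axis_sum_pos[of "1 / y"] axis_sum_add_pos[OF y0] y0
    by (auto simp: A_def B_def C_def)
  have e: "eis (True, False) (\<i> * of_real y) = of_real A" "eis (True, True) (\<i> * of_real y) = of_real B"
    "eis (False, True) (\<i> * of_real y) = of_real C"
    by (simp_all only: eis_axis(2)[OF y0] eis_axis_inverse[OF y0] A_def B_def C_def)
  have H: "\<i> * of_real y \<in> upper_half_plane" using y0 by (simp add: upper_half_plane_def)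
  have "on_imag_axis (test_form j) y = of_real (- (A * B * C) * (A + B + C) ^ j)"
    unfolding on_imag_axis_def test_form_def e using H by simp
  moreover have "- (A * B * C) > 0" using p by (simp add: mult_pos_neg mult_neg_pos)
  hence "- (A * B * C) * (A + B + C) ^ j > 0" using p by (intro mult_pos_pos zero_less_power) auto
  ultimately show ?thesis by blast
qed

text \<open>For a real exponent the integrand is positive on the whole ray, so its integral cannot
  vanish.\<close>

lemma half_mellin_test_form:
  "half_mellin (test_form j) (of_real x) \<noteq> 0"
proof
  assume z: "half_mellin (test_form j) (of_real x) = 0"
  define h where "h y = indicat_real {1..} y * Re (on_imag_axis (test_form j) y * of_real y powr (of_real x - 1))" for y
  have int: "integrable lborel (\<lambda>y. indicat_real {1..} y *\<^sub>R (on_imag_axis (test_form j) y * of_real y powr (of_real x - 1)))"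
    using half_mellin_integrable[OF test_form_cusp_form] unfolding set_integrable_def .
  have ih: "integrable lborel h" using integrable_bounded_linear[OF bounded_linear_Re int] by (simp add: h_def[abs_def])
  have "integral\<^sup>L lborel h = Re (half_mellin (test_form j) (of_real x))"
    using integral_bounded_linear[OF bounded_linear_Re int]
    by (simp add: h_def[abs_def] half_mellin_def set_lebesgue_integral_def)
  hence h0: "integral\<^sup>L lborel h = 0" using z by simp
  have pos: "h y > 0" if "y \<ge> 1" for y
  proof -
    obtain r where r: "r > 0" "on_imag_axis (test_form j) y = complex_of_real r" using test_form_axis[OF \<open>y \<ge> 1\<close>] by blast
    have "of_real y powr (of_real x - 1) = complex_of_real (y powr (x - 1))"
      using powr_of_real[of y "x - 1"] that by simp
    thus ?thesis using r that by (simp add: h_def)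
  qed
  have "0 \<le> h y" for y using pos[of y] by (cases "y \<ge> 1") (auto simp: h_def)
  hence "AE y in lborel. h y = 0" using integral_nonneg_eq_0_iff_AE[OF ih] h0 by simp
  hence "AE y in lborel. y \<notin> {1..2::real}" by eventually_elim (use pos in force)
  \<comment> \<open>A vanishing integral would make the integrand zero almost everywhere, and this
    interval a null set.\<close>
  hence "{1..2::real} \<in> null_sets (lborel :: real measure)" by (subst (asm) AE_iff_null_sets[symmetric]) auto
  thus False by (simp add: null_sets_def)
qed

lemma half_mellin_add:
  assumes "f \<in> cusp_forms k" "g \<in> cusp_forms k"
  shows "half_mellin (\<lambda>t. f t + g t) s = half_mellin f s + half_mellin g s"
  unfolding half_mellin_def set_integral_add(2)[OF half_mellin_integrable[OF assms(1)] half_mellin_integrable[OF assms(2)], symmetric]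
  by (simp add: on_imag_axis_def distrib_right)

lemma half_mellin_scale: "half_mellin (\<lambda>t. c * f t) s = c * half_mellin f s"
  unfolding half_mellin_def set_integral_mult_right[symmetric] by (simp add: on_imag_axis_def mult.assoc)

lemma minus_one_power_int_odd: "odd k \<Longrightarrow> (- 1 :: complex) powi k = - 1"
  by (auto elim!: oddE simp: power_int_add power_int_mult)

lemma cusp_form_odd_weight:
  assumes f: "f \<in> cusp_forms k" and k: "odd k"
  shows "f = (\<lambda>t. 0)"
proof
  fix t
  show "f t = 0"
  proof (cases "t \<in> upper_half_plane")
    case True
    have "f t = (- 1) powi k * f t" using cusp_form_moebius[OF f, of "- 1" "- 1" 0 0 t] True by simp
    hence "f t = - f t" using k by (simp add: minus_one_power_int_odd)
    thus ?thesis by simp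
  qed (simp add: cusp_form_outside[OF f])
qed

theorem mainTheorem1:
  fixes k :: int
  shows "(\<exists>f. cuspidal_hecke_eigenform k f \<and> hecke_L k f (of_int k / 2) \<noteq> 0) \<longleftrightarrow>
         k \<ge> 12 \<and> 4 dvd k"
proof
  assume "\<exists>f. cuspidal_hecke_eigenform k f \<and> hecke_L k f (of_int k / 2) \<noteq> 0"
  then obtain f where f: "f \<in> cusp_forms k" "f \<noteq> (\<lambda>t. 0)" and L: "hecke_L k f (of_int k / 2) \<noteq> 0"
    by (auto simp: cuspidal_hecke_eigenform_def)
  have k10: "k > 10"
  proof (rule ccontr)
    assume "\<not> k > 10"
    hence "f = (\<lambda>t. 0)"
      using cusp_form_q_expansion(2)[OF f(1)] by (intro cusp_form_eq_0_if_high_order[OF f(1), of 1]) auto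
    thus False using f(2) by simp
  qed
  have "even k" using cusp_form_odd_weight[OF f(1)] f(2) by blast
  then obtain j where j: "k = 2 * j" by blast
  have "even j"
  proof (rule ccontr)
    assume "odd j"
    hence "(- 1 :: complex) powi j = - 1" by (simp add: minus_one_power_int_odd)
    \<comment> \<open>At the centre both arguments of \<open>half_mellin\<close> equal
      \<open>k / 2\<close>, and the two terms cancel.\<close>
    hence "hecke_L k f (of_int k / 2) = 0"
      using hecke_L_formula[of f j "of_int k / 2"] f(1) k10 by (simp add: j)
    thus False using L by simp
  qed
  then obtain i where "j = 2 * i" by blast
  thus "k \<ge> 12 \<and> 4 dvd k" using k10 j by auto
next
  assume k: "k \<ge> 12 \<and> 4 dvd k"
  then obtain i where i: "k = 4 * i" by blast
  \<comment> \<open>Here \<open>i \<ge> 3\<close>, so \<open>nat\<close> truncates nothing.\<close>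
  define j where "j = nat (i - 3)"
  have kj: "k = 12 + 4 * int j" using k i by (simp add: j_def)
  define s :: complex where "s = of_int k / 2"
  have s: "s = of_real (of_int k / 2)" by (simp add: s_def)
  \<comment> \<open>The functional is \<open>half_mellin\<close> at \<open>k / 2\<close>: it is
    linear on all cusp forms, and the formula for \<open>hecke_L\<close> relates it to the central
    value of the eigenform afterwards.\<close>
  obtain f where f: "cuspidal_hecke_eigenform k f" "half_mellin f s \<noteq> 0"
    using exists_eigenform_not_in_kernel[of k "\<lambda>f. half_mellin f s" "test_form j"]
      half_mellin_add half_mellin_scale test_form_cusp_form[of j] half_mellin_test_form[of j "of_int k / 2"]
    unfolding kj[symmetric] s by blast
  have fc: "f \<in> cusp_forms (2 * (2 * i))" using f(1) by (simp add: cuspidal_hecke_eigenform_def i)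
  have sym: "of_int (2 * (2 * i)) - s = s" by (simp add: s_def i)
  have sign: "(- 1 :: complex) powi (2 * i) = 1" by (simp add: power_int_mult)
  have "hecke_L (2 * (2 * i)) f s = of_real (2 * pi) powr s * rGamma s * (half_mellin f s + 1 * half_mellin f s)"
    using hecke_L_formula[OF fc, of s] k i unfolding sym sign by simp
  hence "hecke_L k f s = of_real (2 * pi) powr s * rGamma s * (2 * half_mellin f s)" by (simp add: i)
  \<comment> \<open>The zeros of \<open>rGamma\<close> are the nonpositive integers, so the factor
    in front of \<open>half_mellin\<close> is nonzero.\<close>
  moreover have "s \<notin> \<int>\<^sub>\<le>\<^sub>0"
  proof
    assume "s \<in> \<int>\<^sub>\<le>\<^sub>0"
    hence "Re s \<le> 0" by (auto elim!: nonpos_Ints_cases)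
    thus False using k by (simp add: s_def)
  qed
  ultimately have "hecke_L k f s \<noteq> 0" using f(2) by (simp add: rGamma_eq_zero_iff)
  thus "\<exists>f. cuspidal_hecke_eigenform k f \<and> hecke_L k f (of_int k / 2) \<noteq> 0"
    using f(1) by (auto simp: s_def)
qed

end
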